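(* Let $M$ be a compact smooth $7$-manifold and let $\varphi_0$ be a nearly $\mathrm{G}_2$-structure on $M$ with metric $g_0$ and torsion $T_{\varphi_0}=c\,g_0$, where $c\neq0$ is a constant. Then the Ricci-harmonic flow $$\frac{\partial\varphi}{\partial t}=\left(-\mathrm{Ric}+3T^tT-|T|^2g\right)\diamond\varphi+\operatorname{div}T\lrcorner\psi$$ with initial condition $\varphi(0)=\varphi_0$ exists for the finite time interval $[0,\tau)$, where $\tau=\frac{1}{20c^2}$, and $\varphi(t)$ remains nearly $\mathrm{G}_2$ for its time of existence. In particular, nearly $\mathrm{G}_2$-structures are shrinking solutions of the flow.
   Context: A $\mathrm{G}_2$-structure on a smooth $7$-manifold $M$ is a nondegenerate $3$-form $\varphi$, i.e. one that determines a Riemannian metric $g$ and an orientation by $(X\lrcorner\varphi)\wedge(Y\lrcorner\varphi)\wedge\varphi=-6\,g(X,Y)\,\mathrm{vol}$; put $\psi=*\varphi$. Indices refer to local orthonormal frames and repeated indices are summed. $\nabla$ is the Levi-Civita connection of $g$ and $\mathrm{Ric}$ its Ricci tensor. The torsion of $\varphi$ is the $2$-tensor $T$ with $\nabla_m\varphi_{ijk}=T_{mp}\psi_{pijk}$. Further: $(T^tT)_{ij}=T_{pi}T_{pj}$, $|T|^2=T_{ij}T_{ij}$, $(\operatorname{div}T)_j=\nabla_iT_{ij}$. For a symmetric $2$-tensor $h$, $(h\diamond\varphi)_{ijk}=h_{ip}\varphi_{pjk}+h_{jp}\varphi_{ipk}+h_{kp}\varphi_{ijp}$, and for a vector field $X$,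 $(X\lrcorner\psi)_{ijk}=X_l\psi_{lijk}$. A $\mathrm{G}_2$-structure $\varphi$ is nearly $\mathrm{G}_2$ if $d\varphi=\lambda\psi$ and $d\psi=0$ for a constant $\lambda$; then the torsion is a constant multiple of the metric. A solution is shrinking if $\varphi(t)=\rho(t)\Theta(t)^*\varphi_0$ with $\Theta(t)$ diffeomorphisms and $\rho(t)>0$ a decreasing scalar function with $\rho(0)=1$. *)

theory Defs
  imports "HOL-Analysis.Analysis"
begin

section \<open>Smooth maps between Euclidean spaces\<close>

primrec Ck_on :: "nat \<Rightarrow> 'a::real_normed_vector set \<Rightarrow> ('a \<Rightarrow> 'b::real_normed_vector) \<Rightarrow> bool" where
  "Ck_on 0 U f \<longleftrightarrow> continuous_on U f"
| "Ck_on (Suc k) U f \<longleftrightarrow>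
     (\<forall>x\<in>U. f differentiable (at x)) \<and> (\<forall>v. Ck_on k U (\<lambda>x. frechet_derivative f (at x) v))"

text \<open>On a set that need not be open, smooth means: has a smooth extension to an open
  neighbourhood. For open sets this is ordinary smoothness; the general case is used for
  the time interval, which is half-open.\<close>

definition smooth_on :: "'a::real_normed_vector set \<Rightarrow> ('a \<Rightarrow> 'b::real_normed_vector) \<Rightarrow> bool" where
  "smooth_on S f \<longleftrightarrow>
     (\<exists>U F. open U \<and> S \<subseteq> U \<and> (\<forall>x\<in>S. F x = f x) \<and> (\<forall>k. Ck_on k U F))"

definition pd :: "7 \<Rightarrow> (real^7 \<Rightarrow> 'b::real_normed_vector) \<Rightarrow> real^7 \<Rightarrow> 'b" where
  "pd i f x = frechet_derivative f (at x) (axis i 1)"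


section \<open>Smooth 7-manifolds\<close>

text \<open>The manifold is a whole topological type \<open>'m\<close> (Hausdorff, second countable, through type
  classes). A chart is a domain together with a coordinate map; values of the map off the domain
  are irrelevant. The smooth structure is the one generated by an atlas, which need not be
  maximal.\<close>

type_synonym 'm chart = "'m set \<times> ('m \<Rightarrow> real^7)"

abbreviation cdom :: "'m chart \<Rightarrow> 'm set" where "cdom \<equiv> fst"
abbreviation cmap :: "'m chart \<Rightarrow> 'm \<Rightarrow> real^7" where "cmap \<equiv> snd"

definition cimg :: "'m chart \<Rightarrow> (real^7) set" where
  "cimg k = cmap k ` cdom k"

definition cinv :: "'m chart \<Rightarrow> real^7 \<Rightarrow> 'm" where
  "cinv k = inv_into (cdom k) (cmap k)"

definition is_chart :: "'m::topological_space chart \<Rightarrow> bool" where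
  "is_chart k \<longleftrightarrow>
     open (cdom k) \<and> open (cimg k) \<and> homeomorphism (cdom k) (cimg k) (cmap k) (cinv k)"

definition smooth_atlas :: "'m::{t2_space,second_countable_topology} chart set \<Rightarrow> bool" where
  "smooth_atlas A \<longleftrightarrow>
     (\<forall>k\<in>A. is_chart k) \<and> (\<Union>k\<in>A. cdom k) = UNIV \<and>
     (\<forall>k\<in>A. \<forall>l\<in>A. smooth_on (cmap k ` (cdom k \<inter> cdom l)) (cmap l \<circ> cinv k))"

definition smooth_map :: "'m::{t2_space,second_countable_topology} chart set \<Rightarrow> ('m \<Rightarrow> 'm) \<Rightarrow> bool" where
  "smooth_map A \<Theta> \<longleftrightarrow> continuous_on UNIV \<Theta> \<and>
     (\<forall>k\<in>A. \<forall>l\<in>A. smooth_on (cmap k ` (cdom k \<inter> \<Theta> -` cdom l)) (cmap l \<circ> \<Theta> \<circ> cinv k))"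

definition diffeo :: "'m::{t2_space,second_countable_topology} chart set \<Rightarrow> ('m \<Rightarrow> 'm) \<Rightarrow> bool" where
  "diffeo A \<Theta> \<longleftrightarrow> bij \<Theta> \<and> smooth_map A \<Theta> \<and> smooth_map A (inv \<Theta>)"


section \<open>Covariant tensor fields\<close>

text \<open>A covariant tensor field is given by its components in each chart, as functions of the
  coordinates; only the charts of the atlas and the points of \<open>cimg\<close> matter. Tensoriality is
  invariance under pullback by the identity map.\<close>

type_synonym 'm field2 = "'m chart \<Rightarrow> real^7 \<Rightarrow> real^7^7"
type_synonym 'm field3 = "'m chart \<Rightarrow> real^7 \<Rightarrow> real^7^7^7"

definition field_eq :: "'m chart set \<Rightarrow> ('m chart \<Rightarrow> real^7 \<Rightarrow> 'b) \<Rightarrow> ('m chart \<Rightarrow> real^7 \<Rightarrow> 'b) \<Rightarrow> bool" where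
  "field_eq A \<alpha> \<beta> \<longleftrightarrow> (\<forall>k\<in>A. \<forall>x\<in>cimg k. \<alpha> k x = \<beta> k x)"

definition pull2 :: "real^7^7 \<Rightarrow> real^7^7 \<Rightarrow> real^7^7" where
  "pull2 J h = (\<chi> i j. \<Sum>a\<in>UNIV. \<Sum>b\<in>UNIV. J$a$i * J$b$j * h$a$b)"

definition pull3 :: "real^7^7 \<Rightarrow> real^7^7^7 \<Rightarrow> real^7^7^7" where
  "pull3 J \<alpha> = (\<chi> i j k. \<Sum>a\<in>UNIV. \<Sum>b\<in>UNIV. \<Sum>c\<in>UNIV. J$a$i * J$b$j * J$c$k * \<alpha>$a$b$c)"

text \<open>\<open>\<beta> = \<Theta>\<^sup>* \<alpha>\<close>, where \<open>\<P>\<close> is \<open>pull2\<close> or \<open>pull3\<close>.\<close>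

definition is_pullback ::
  "(real^7^7 \<Rightarrow> 'b \<Rightarrow> 'b) \<Rightarrow> 'm chart set \<Rightarrow> ('m \<Rightarrow> 'm) \<Rightarrow>
   ('m chart \<Rightarrow> real^7 \<Rightarrow> 'b) \<Rightarrow> ('m chart \<Rightarrow> real^7 \<Rightarrow> 'b) \<Rightarrow> bool" where
  "is_pullback \<P> A \<Theta> \<alpha> \<beta> \<longleftrightarrow>
     (\<forall>k\<in>A. \<forall>l\<in>A. \<forall>p\<in>cdom k. \<Theta> p \<in> cdom l \<longrightarrow>
        \<beta> k (cmap k p) =
          \<P> (jacobian (cmap l \<circ> \<Theta> \<circ> cinv k) (at (cmap k p))) (\<alpha> l (cmap l (\<Theta> p))))"

definition tensor2 :: "'m chart set \<Rightarrow> 'm field2 \<Rightarrow> bool" where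
  "tensor2 A h \<longleftrightarrow> (\<forall>k\<in>A. smooth_on (cimg k) (h k)) \<and> is_pullback pull2 A id h h"

definition form3 :: "'m chart set \<Rightarrow> 'm field3 \<Rightarrow> bool" where
  "form3 A \<phi> \<longleftrightarrow>
     (\<forall>k\<in>A. smooth_on (cimg k) (\<phi> k)) \<and> is_pullback pull3 A id \<phi> \<phi> \<and>
     (\<forall>k\<in>A. \<forall>x\<in>cimg k. \<forall>a b c.
        \<phi> k x $a$b$c = - \<phi> k x $b$a$c \<and> \<phi> k x $a$b$c = - \<phi> k x $a$c$b)"


section \<open>The metric, the volume form and the dual 4-form\<close>

text \<open>The coefficient of \<open>(\<partial>\<^sub>i \<lrcorner> \<phi>) \<and> (\<partial>\<^sub>j \<lrcorner> \<phi>) \<and> \<phi>\<close> with respect to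
  \<open>dx\<^sup>0 \<and> \<dots> \<and> dx\<^sup>6\<close>; the factor is \<open>1 / (2! 2! 3!)\<close>.\<close>

definition wedge_coeff :: "real^7^7^7 \<Rightarrow> 7 \<Rightarrow> 7 \<Rightarrow> real" where
  "wedge_coeff \<phi> i j = 1/24 * (\<Sum>p | p permutes (UNIV::7 set).
     of_int (sign p) * \<phi>$i$(p 0)$(p 1) * \<phi>$j$(p 2)$(p 3) * \<phi>$(p 4)$(p 5)$(p 6))"

text \<open>\<open>g\<close> is an inner product and \<open>v dx\<^sup>0 \<and> \<dots> \<and> dx\<^sup>6\<close> is its volume form for one
  of the two orientations (the sign of \<open>v\<close> encodes which one), related to \<open>\<phi>\<close> by
  \<open>(X \<lrcorner> \<phi>) \<and> (Y \<lrcorner> \<phi>) \<and> \<phi> = -6 g(X,Y) vol\<close>.\<close>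

definition metric_vol_of :: "real^7^7^7 \<Rightarrow> real^7^7 \<Rightarrow> real \<Rightarrow> bool" where
  "metric_vol_of \<phi> g v \<longleftrightarrow>
     transpose g = g \<and> (\<forall>X. X \<noteq> 0 \<longrightarrow> X \<bullet> (g *v X) > 0) \<and> v\<^sup>2 = det g \<and>
     (\<forall>i j. wedge_coeff \<phi> i j = - 6 * g$i$j * v)"

definition nondegenerate :: "real^7^7^7 \<Rightarrow> bool" where
  "nondegenerate \<phi> \<longleftrightarrow> (\<exists>g v. metric_vol_of \<phi> g v)"

definition metric :: "real^7^7^7 \<Rightarrow> real^7^7" where
  "metric \<phi> = (THE g. \<exists>v. metric_vol_of \<phi> g v)"

definition vol_coeff :: "real^7^7^7 \<Rightarrow> real" where
  "vol_coeff \<phi> = (THE v. \<exists>g. metric_vol_of \<phi> g v)"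

definition raise3 :: "real^7^7 \<Rightarrow> real^7^7^7 \<Rightarrow> real^7^7^7" where
  "raise3 g \<alpha> = (\<chi> a b c. \<Sum>i\<in>UNIV. \<Sum>j\<in>UNIV. \<Sum>k\<in>UNIV.
     matrix_inv g $a$i * matrix_inv g $b$j * matrix_inv g $c$k * \<alpha>$i$j$k)"

text \<open>\<open>\<psi> = *\<phi>\<close>, that is \<open>\<psi>\<^sub>i\<^sub>j\<^sub>k\<^sub>l = 1/3! \<phi>\<^sup>a\<^sup>b\<^sup>c vol\<^sub>a\<^sub>b\<^sub>c\<^sub>i\<^sub>j\<^sub>k\<^sub>l\<close>, the sum over
  \<open>a, b, c\<close> being written as a sum over the permutations \<open>(a,b,c,i,j,k,l)\<close>.\<close>

definition psi :: "real^7^7^7 \<Rightarrow> real^7^7^7^7" where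
  "psi \<phi> = (\<chi> i j k l. vol_coeff \<phi> / 6 *
     (\<Sum>p | p permutes (UNIV::7 set) \<and> p 3 = i \<and> p 4 = j \<and> p 5 = k \<and> p 6 = l.
        of_int (sign p) * raise3 (metric \<phi>) \<phi> $(p 0)$(p 1)$(p 2)))"

definition G2_structure :: "'m chart set \<Rightarrow> 'm field3 \<Rightarrow> bool" where
  "G2_structure A \<phi> \<longleftrightarrow> form3 A \<phi> \<and> (\<forall>k\<in>A. \<forall>x\<in>cimg k. nondegenerate (\<phi> k x))"


section \<open>Levi-Civita connection, Ricci tensor, divergence\<close>

text \<open>These are local expressions for a metric \<open>g\<close> given as a function of the coordinates.
  Contractions over orthonormal frames become contractions with the inverse metric.
  \<open>christoffel g x $k$i$j\<close> is \<open>\<Gamma>\<^sup>k\<^sub>i\<^sub>j\<close>.\<close>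

definition christoffel :: "(real^7 \<Rightarrow> real^7^7) \<Rightarrow> real^7 \<Rightarrow> real^7^7^7" where
  "christoffel g x = (\<chi> k i j. 1/2 * (\<Sum>l\<in>UNIV. matrix_inv (g x) $k$l *
     (pd i g x $j$l + pd j g x $i$l - pd l g x $i$j)))"

text \<open>The index of differentiation comes first.\<close>

definition nabla2 :: "(real^7 \<Rightarrow> real^7^7) \<Rightarrow> (real^7 \<Rightarrow> real^7^7) \<Rightarrow> real^7 \<Rightarrow> real^7^7^7" where
  "nabla2 g T x = (\<chi> m i j. pd m T x $i$j
     - (\<Sum>l\<in>UNIV. christoffel g x $l$m$i * T x $l$j)
     - (\<Sum>l\<in>UNIV. christoffel g x $l$m$j * T x $i$l))"

definition nabla3 :: "(real^7 \<Rightarrow> real^7^7) \<Rightarrow> (real^7 \<Rightarrow> real^7^7^7) \<Rightarrow> real^7 \<Rightarrow> real^7^7^7^7" where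
  "nabla3 g \<alpha> x = (\<chi> m i j k. pd m \<alpha> x $i$j$k
     - (\<Sum>l\<in>UNIV. christoffel g x $l$m$i * \<alpha> x $l$j$k)
     - (\<Sum>l\<in>UNIV. christoffel g x $l$m$j * \<alpha> x $i$l$k)
     - (\<Sum>l\<in>UNIV. christoffel g x $l$m$k * \<alpha> x $i$j$l))"

text \<open>The sign convention is the one for which round spheres have positive Ricci curvature.\<close>

definition ricci :: "(real^7 \<Rightarrow> real^7^7) \<Rightarrow> real^7 \<Rightarrow> real^7^7" where
  "ricci g x = (let \<Gamma> = christoffel g in \<chi> j k.
     \<Sum>i\<in>UNIV. pd i \<Gamma> x $i$j$k - pd j \<Gamma> x $i$i$k
       + (\<Sum>l\<in>UNIV. \<Gamma> x $i$i$l * \<Gamma> x $l$j$k - \<Gamma> x $i$j$l * \<Gamma> x $l$i$k))"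

definition divergence :: "(real^7 \<Rightarrow> real^7^7) \<Rightarrow> (real^7 \<Rightarrow> real^7^7) \<Rightarrow> real^7 \<Rightarrow> real^7" where
  "divergence g T x = (\<chi> j. \<Sum>a\<in>UNIV. \<Sum>b\<in>UNIV. matrix_inv (g x) $a$b * nabla2 g T x $a$b$j)"


section \<open>Torsion and nearly \<open>G\<^sub>2\<close>-structures\<close>

definition metric_of :: "'m field3 \<Rightarrow> 'm field2" where
  "metric_of \<phi> k x = metric (\<phi> k x)"

definition is_torsion :: "'m chart set \<Rightarrow> 'm field3 \<Rightarrow> 'm field2 \<Rightarrow> bool" where
  "is_torsion A \<phi> T \<longleftrightarrow> tensor2 A T \<and>
     (\<forall>k\<in>A. \<forall>x\<in>cimg k. \<forall>m i j l.
        nabla3 (metric_of \<phi> k) (\<phi> k) x $m$i$j$l =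
          (\<Sum>p\<in>UNIV. \<Sum>q\<in>UNIV.
             T k x $m$p * matrix_inv (metric_of \<phi> k x) $p$q * psi (\<phi> k x) $q$i$j$l))"

definition ext_deriv3 :: "(real^7 \<Rightarrow> real^7^7^7) \<Rightarrow> real^7 \<Rightarrow> real^7^7^7^7" where
  "ext_deriv3 \<alpha> x = (\<chi> i j k l.
     pd i \<alpha> x $j$k$l - pd j \<alpha> x $i$k$l + pd k \<alpha> x $i$j$l - pd l \<alpha> x $i$j$k)"

definition ext_deriv4 :: "(real^7 \<Rightarrow> real^7^7^7^7) \<Rightarrow> real^7 \<Rightarrow> real^7^7^7^7^7" where
  "ext_deriv4 \<beta> x = (\<chi> i j k l m.
     pd i \<beta> x $j$k$l$m - pd j \<beta> x $i$k$l$m + pd k \<beta> x $i$j$l$m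
     - pd l \<beta> x $i$j$k$m + pd m \<beta> x $i$j$k$l)"

definition nearly_G2 :: "'m chart set \<Rightarrow> 'm field3 \<Rightarrow> bool" where
  "nearly_G2 A \<phi> \<longleftrightarrow> G2_structure A \<phi> \<and>
     (\<exists>\<kappa>::real. \<forall>k\<in>A. \<forall>x\<in>cimg k.
        ext_deriv3 (\<phi> k) x = \<kappa> *\<^sub>R psi (\<phi> k x) \<and> ext_deriv4 (\<lambda>y. psi (\<phi> k y)) x = 0)"


section \<open>The Ricci-harmonic flow\<close>

definition diamond :: "real^7^7 \<Rightarrow> real^7^7 \<Rightarrow> real^7^7^7 \<Rightarrow> real^7^7^7" where
  "diamond g h \<phi> = (\<chi> i j k. \<Sum>p\<in>UNIV. \<Sum>q\<in>UNIV. matrix_inv g $p$q *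
     (h$i$p * \<phi>$q$j$k + h$j$p * \<phi>$i$q$k + h$k$p * \<phi>$i$j$q))"

definition interior4 :: "real^7^7 \<Rightarrow> real^7 \<Rightarrow> real^7^7^7^7 \<Rightarrow> real^7^7^7" where
  "interior4 g X \<beta> = (\<chi> i j k. \<Sum>p\<in>UNIV. \<Sum>q\<in>UNIV. matrix_inv g $p$q * X$p * \<beta>$q$i$j$k)"

definition TtT :: "real^7^7 \<Rightarrow> real^7^7 \<Rightarrow> real^7^7" where
  "TtT g T = (\<chi> i j. \<Sum>p\<in>UNIV. \<Sum>q\<in>UNIV. matrix_inv g $p$q * T$p$i * T$q$j)"

definition normsq2 :: "real^7^7 \<Rightarrow> real^7^7 \<Rightarrow> real" where
  "normsq2 g T = (\<Sum>i\<in>UNIV. \<Sum>j\<in>UNIV. \<Sum>p\<in>UNIV. \<Sum>q\<in>UNIV.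
     matrix_inv g $i$p * matrix_inv g $j$q * T$i$j * T$p$q)"

definition flow_rhs :: "(real^7 \<Rightarrow> real^7^7^7) \<Rightarrow> (real^7 \<Rightarrow> real^7^7) \<Rightarrow> real^7 \<Rightarrow> real^7^7^7" where
  "flow_rhs \<phi> T x = (let g = (\<lambda>y. metric (\<phi> y)) in
     diamond (g x) (- ricci g x + 3 *\<^sub>R TtT (g x) (T x) - normsq2 (g x) (T x) *\<^sub>R g x) (\<phi> x)
     + interior4 (g x) (divergence g T x) (psi (\<phi> x)))"

definition flow_solution :: "'m chart set \<Rightarrow> real \<Rightarrow> (real \<Rightarrow> 'm field3) \<Rightarrow> bool" where
  "flow_solution A \<tau> \<phi> \<longleftrightarrow>
     (\<forall>t\<in>{0..<\<tau>}. G2_structure A (\<phi> t)) \<and>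
     (\<forall>k\<in>A. smooth_on ({0..<\<tau>} \<times> cimg k) (\<lambda>(t, x). \<phi> t k x)) \<and>
     (\<exists>T. \<forall>t\<in>{0..<\<tau>}. is_torsion A (\<phi> t) (T t) \<and>
        (\<forall>k\<in>A. \<forall>x\<in>cimg k.
           ((\<lambda>s. \<phi> s k x) has_vector_derivative flow_rhs (\<phi> t k) (T t k) x)
             (at t within {0..<\<tau>})))"

text \<open>\<open>\<phi>(t) = \<rho>(t) \<Theta>(t)\<^sup>* \<phi>(0)\<close> on \<open>[0, \<tau>)\<close>.\<close>

definition shrinking :: "'m::{t2_space,second_countable_topology} chart set \<Rightarrow> real \<Rightarrow> (real \<Rightarrow> 'm field3) \<Rightarrow> bool" where
  "shrinking A \<tau> \<phi> \<longleftrightarrow>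
     (\<exists>(\<rho> :: real \<Rightarrow> real) \<Theta>. \<rho> 0 = 1 \<and> (\<forall>t\<in>{0..<\<tau>}. \<rho> t > 0) \<and>
        strict_antimono_on {0..<\<tau>} \<rho> \<and>
        (\<forall>t\<in>{0..<\<tau>}. diffeo A (\<Theta> t) \<and>
           (\<exists>\<eta>. is_pullback pull3 A (\<Theta> t) (\<phi> 0) \<eta> \<and>
                field_eq A (\<phi> t) (\<lambda>k x. \<rho> t *\<^sub>R \<eta> k x))))"

end

theory Submission
  imports Defs
begin

text \<open>Multiplying a \<open>G\<^sub>2\<close>-structure by \<open>r\<^sup>3\<close> multiplies the metric by \<open>r\<^sup>2\<close>, the dual 4-form
  by \<open>r\<^sup>4\<close> and a torsion \<open>c g\<close> by \<open>r\<close>, and leaves the Levi-Civita connection and the Ricci tensor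
  unchanged. So the right-hand side of the flow on the ray \<open>r\<^sup>3 \<phi>\<^sub>0\<close> is known once the
  Ricci tensor of \<open>g\<^sub>0\<close> is, and that is \<open>6 c\<^sup>2 g\<^sub>0\<close> (\<open>ricci_eq\<close>). Hence
  \<open>-Ric + 3 T\<^sup>tT - |T|\<^sup>2 g = (-6 + 3 - 7) c\<^sup>2 g\<^sub>0\<close>, the divergence vanishes because the metric is
  parallel, and the flow becomes the ordinary differential equation \<open>(r\<^sup>3)' = -30 c\<^sup>2 r\<close>. Its
  solution \<open>r = sqrt (1 - 20 c\<^sup>2 t)\<close> reaches zero at \<open>\<tau>\<close>. A longer solution would by continuity be
  the zero form at \<open>\<tau>\<close>, which is degenerate.

  The Einstein equation is the substance. At a point, \<open>\<phi>\<close> has a standard form in a suitable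
  orthonormal frame (\<open>G2_normal_form\<close>). Two facts are read off from that form. The product
  \<open>u \<times> w\<close> defined by \<open>g(u \<times> w, z) = \<phi>(u, w, z)\<close> satisfies
  \<open>|u \<times> w|\<^sup>2 = |u|\<^sup>2 |w|\<^sup>2 - g(u, w)\<^sup>2\<close> (\<open>G2_cross_product_space\<close>), and the dual 4-form is
  \<open>\<psi>(a, b, u, z) = g(Q(a, b, u), z)\<close> for a vector \<open>Q(a, b, u)\<close> made from the metric and the cross
  product (\<open>psi_eq_Q\<close>). The remaining pointwise identities follow from the axioms of a cross
  product.

  With torsion \<open>c g\<close>, one has \<open>\<nabla>\<^sub>x (u \<times> w) = \<nabla>\<^sub>x u \<times> w + u \<times> \<nabla>\<^sub>x w + c Q(x, u, w)\<close> (\<open>nab_cross\<close>).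
  Commuting two covariant derivatives of a cross product shows that the curvature operator
  \<open>R(a, b)\<close> minus \<open>c\<^sup>2\<close> times the curvature operator of the unit sphere is a derivation of the
  cross product (\<open>Rm_cross\<close>, \<open>cr_Q_alternation\<close>). A tensor with the symmetries of a curvature
  tensor whose values are derivations has vanishing Ricci trace, by the Bianchi identity
  (\<open>derivation_curvature_ricci_flat\<close>). So \<open>Ric\<close> is \<open>c\<^sup>2\<close> times that of the unit 7-sphere
  (\<open>einstein\<close>).\<close>

section \<open>Cross products in dimension seven\<close>

text \<open>The frame is part of the locale because the results on curvature concern traces; up to isometry, the only
  model is the cross product of the imaginary octonions.\<close>

locale cross_product_space =
  fixes ip :: "'v::real_vector \<Rightarrow> 'v \<Rightarrow> real"
    and cr :: "'v \<Rightarrow> 'v \<Rightarrow> 'v"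
    and e :: "7 \<Rightarrow> 'v"
  assumes ip_add_left: "ip (x + y) z = ip x z + ip y z"
    and ip_scale_left: "ip (r *\<^sub>R x) z = r * ip x z"
    and ip_commute: "ip x y = ip y x"
    and frame_orthonormal: "ip (e i) (e j) = (if i = j then 1 else 0)"
    and frame_expansion: "(\<Sum>i\<in>UNIV. ip w (e i) *\<^sub>R e i) = w"
    and cr_add_left: "cr (x + y) z = cr x z + cr y z"
    and cr_scale_left: "cr (r *\<^sub>R x) z = r *\<^sub>R cr x z"
    and cr_skew: "cr x y = - cr y x"
    and triple_cyclic: "ip (cr x y) z = ip (cr y z) x"
    and norm_cr: "ip (cr x y) (cr x y) = ip x x * ip y y - (ip x y)\<^sup>2"
begin

lemma ip_add_right: "ip z (x + y) = ip z x + ip z y"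
  using ip_add_left ip_commute by metis
lemma ip_scale_right: "ip z (r *\<^sub>R x) = r * ip z x"
  using ip_scale_left ip_commute by metis
lemma ip_minus_left: "ip (- x) z = - ip x z"
  using ip_scale_left[of "-1" x z] by simp
lemma ip_minus_right: "ip z (- x) = - ip z x"
  using ip_minus_left ip_commute by metis
lemma ip_diff_left: "ip (x - y) z = ip x z - ip y z"
  using ip_add_left[of x "- y" z] by (simp add: ip_minus_left)
lemma ip_diff_right: "ip z (x - y) = ip z x - ip z y"
  using ip_diff_left ip_commute by metis
lemma ip_zero_left: "ip 0 z = 0"
  using ip_scale_left[of 0 0 z] by simp
lemma ip_zero_right: "ip z 0 = 0"
  using ip_zero_left ip_commute by metis
lemma ip_sum_left: "ip (sum f I) z = (\<Sum>i\<in>I. ip (f i) z)"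
  by (induction I rule: infinite_finite_induct) (simp_all add: ip_zero_left ip_add_left)

lemma cr_add_right: "cr z (x + y) = cr z x + cr z y"
  using cr_add_left[of x y z] cr_skew[of z] by simp
lemma cr_scale_right: "cr z (r *\<^sub>R x) = r *\<^sub>R cr z x"
  using cr_scale_left[of r x z] cr_skew[of z] by simp
lemma cr_minus_left: "cr (- x) z = - cr x z"
  using cr_scale_left[of "-1" x z] by simp
lemma cr_minus_right: "cr z (- x) = - cr z x"
  using cr_scale_right[of z "-1" x] by simp
lemma cr_diff_left: "cr (x - y) z = cr x z - cr y z"
  using cr_add_left[of x "- y" z] by (simp add: cr_minus_left)
lemma cr_diff_right: "cr z (x - y) = cr z x - cr z y"
  using cr_add_right[of z x "- y"] by (simp add: cr_minus_right)
lemma cr_zero_left: "cr 0 z = 0"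
  using cr_scale_left[of 0 0 z] by simp
lemma cr_zero_right: "cr z 0 = 0"
  using cr_scale_right[of z 0 0] by simp
lemma cr_sum_left: "cr (sum f I) z = (\<Sum>i\<in>I. cr (f i) z)"
  by (induction I rule: infinite_finite_induct) (simp_all add: cr_zero_left cr_add_left)
lemma cr_sum_right: "cr z (sum f I) = (\<Sum>i\<in>I. cr z (f i))"
  by (induction I rule: infinite_finite_induct) (simp_all add: cr_zero_right cr_add_right)

lemmas ip_simps = ip_add_left ip_add_right ip_scale_left ip_scale_right ip_minus_left ip_minus_right
  ip_diff_left ip_diff_right ip_zero_left ip_zero_right
lemmas cr_simps = cr_add_left cr_add_right cr_scale_left cr_scale_right cr_minus_left cr_minus_right
  cr_diff_left cr_diff_right cr_zero_left cr_zero_right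

lemma vector_eqI:
  assumes "\<And>z. ip x z = ip y z"
  shows "x = y"
proof -
  have "x = (\<Sum>i\<in>UNIV. ip x (e i) *\<^sub>R e i)" by (rule frame_expansion[symmetric])
  also have "\<dots> = (\<Sum>i\<in>UNIV. ip y (e i) *\<^sub>R e i)" by (simp only: assms)
  also have "\<dots> = y" by (rule frame_expansion)
  finally show ?thesis .
qed

lemma triple_swap12: "ip (cr y x) z = - ip (cr x y) z"
  using cr_skew[of y x] by (simp add: ip_minus_left)

lemma triple_swap: "ip (cr x y) z = - ip (cr x z) y"
  using triple_cyclic[of x y z] triple_cyclic[of z y x] triple_cyclic[of x z y] triple_swap12[of z y x]
  by simp

lemma triple_perms:
  "ip (cr y x) z = - ip (cr x y) z" "ip (cr x z) y = - ip (cr x y) z" "ip (cr z y) x = - ip (cr x y) z"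
  "ip (cr y z) x = ip (cr x y) z" "ip (cr z x) y = ip (cr x y) z"
  using triple_cyclic[of x y z] triple_cyclic[of y z x] triple_cyclic[of z x y]
    triple_swap12[of y x z] triple_swap[of x z y] triple_swap12[of z y x] triple_cyclic[of y x z]
    triple_cyclic[of z y x]
  by linarith+

text \<open>The polarised norm identity, with one factor moved to the other side by skewness of the triple
  product.\<close>

lemma cr_cr: "cr u (cr u v) = ip u v *\<^sub>R u - ip u u *\<^sub>R v"
proof (rule vector_eqI)
  fix w
  have "ip (cr u (v + w)) (cr u (v + w)) = ip u u * ip (v + w) (v + w) - (ip u (v + w))\<^sup>2"
    by (rule norm_cr)
  then have "ip (cr u v) (cr u w) = ip u u * ip v w - ip u v * ip u w"
    using norm_cr[of u v] norm_cr[of u w]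
    unfolding ip_simps cr_simps ip_commute[of w v] ip_commute[of "cr u w" "cr u v"]
      by algebra
  moreover have "ip (cr u (cr u v)) w = - ip (cr u v) (cr u w)"
    using triple_swap[of u "cr u v" w] ip_commute[of "cr u w" "cr u v"] by simp
  ultimately show "ip (cr u (cr u v)) w = ip (ip u v *\<^sub>R u - ip u u *\<^sub>R v) w"
    unfolding ip_diff_left ip_scale_left by linarith
qed

lemma cr_cr_polarized:
  "cr u (cr w v) + cr w (cr u v) = ip u v *\<^sub>R w + ip w v *\<^sub>R u - (2 * ip u w) *\<^sub>R v"
proof (rule vector_eqI)
  fix z
  have "ip (cr (u + w) (cr (u + w) v)) z = ip (ip (u + w) v *\<^sub>R (u + w) - ip (u + w) (u + w) *\<^sub>R v) z"
    "ip (cr u (cr u v)) z = ip (ip u v *\<^sub>R u - ip u u *\<^sub>R v) z"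
    "ip (cr w (cr w v)) z = ip (ip w v *\<^sub>R w - ip w w *\<^sub>R v) z"
    by (simp_all only: cr_cr)
  then show "ip (cr u (cr w v) + cr w (cr u v)) z
      = ip (ip u v *\<^sub>R w + ip w v *\<^sub>R u - (2 * ip u w) *\<^sub>R v) z"
    unfolding cr_simps ip_simps ip_commute[of w u] ring_distribs by linarith
qed

text \<open>In \<open>G\<^sub>2\<close>-geometry \<open>ip (Q a b u) z\<close> is \<open>\<psi>(a, b, u, z)\<close>. This formula is free of frames, and
  \<open>cr_cr_polarized\<close> makes it alternating.\<close>

definition Q :: "'v \<Rightarrow> 'v \<Rightarrow> 'v \<Rightarrow> 'v" where
  "Q a b u = ip a u *\<^sub>R b - ip b u *\<^sub>R a - cr (cr a b) u"

lemma Q_swap12: "Q a b u = - Q b a u"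
  unfolding Q_def using cr_skew[of a b] by (simp add: cr_simps)

lemma Q_swap23: "Q a b u = - Q a u b"
proof (rule vector_eqI)
  fix z
  have "cr (cr a b) u = cr u (cr b a)" "cr (cr a u) b = cr b (cr u a)"
    using cr_skew[of "cr a b" u] cr_skew[of "cr a u" b] cr_skew[of a b] cr_skew[of a u]
    by (simp_all add: cr_minus_right)
  then have c: "ip (cr (cr a b) u) z = ip (cr u (cr b a)) z" "ip (cr (cr a u) b) z = ip (cr b (cr u a)) z"
    by simp_all
  have "ip (cr u (cr b a) + cr b (cr u a)) z
      = ip (ip u a *\<^sub>R b + ip b a *\<^sub>R u - (2 * ip u b) *\<^sub>R a) z"
    by (simp only: cr_cr_polarized)
  then show "ip (Q a b u) z = ip (- Q a u b) z"
    unfolding Q_def ip_simps ip_commute[of u a] ip_commute[of b a] ip_commute[of u b] c by linarith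
qed

lemma Q_cyclic: "Q a b u = Q b u a"
  using Q_swap12[of a b u] Q_swap23[of b a u] by simp

lemma ip_Q_swap: "ip (Q a b u) w = - ip (Q a b w) u"
  unfolding Q_def using triple_swap[of "cr a b" u w]
  by (simp add: ip_simps)

lemma ip_Q_swap2: "ip (Q a b u) w = - ip (Q w b u) a"
  using ip_Q_swap[of b u a w] Q_cyclic[of a b u] Q_cyclic[of w b u] by simp

text \<open>This is the contraction of \<open>\<phi>\<close> with \<open>\<psi>\<close> over one index. Put
  \<open>t i j c a b = ip (i \<times> j) ((a \<times> b) \<times> c)\<close>. By \<open>cr_cr_polarized\<close>, exchanging \<open>c\<close> with \<open>b\<close>, or \<open>c\<close>
  with \<open>j\<close>, changes the sign of \<open>t\<close> up to products of an inner product and a triple product. Six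
  such exchanges, with skewness in each pair, turn \<open>t i j c a b\<close> into \<open>t a b c i j\<close>, and this is \<open>- t i j c a b\<close> by skewness of
  the triple product. So \<open>2 * t i j c a b\<close> is the sum of the correction terms.\<close>

lemma ip_cr_Q:
  "ip (cr i j) (Q a b c) = ip i a * ip (cr j b) c + ip i b * ip (cr j c) a + ip i c * ip (cr j a) b
    - ip j a * ip (cr i b) c - ip j b * ip (cr i c) a - ip j c * ip (cr i a) b"
proof -
  define t where "t i j c a b = ip (cr i j) (cr (cr a b) c)" for i j c a b
  have swap: "t i j c a b = - t a b c i j" for i j c a b
    unfolding t_def using triple_swap[of "cr a b" c "cr i j"] triple_swap[of "cr i j" c "cr a b"]
        triple_swap12[of "cr i j" "cr a b" c] ip_commute[of "cr i j" "cr (cr a b) c"]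
        ip_commute[of "cr a b" "cr (cr i j) c"]
    by simp
  have t1: "t j i c a b = - t i j c a b" for i j c a b
    unfolding t_def by (rule triple_swap12)
  have t2: "t i j c b a = - t i j c a b" for i j c a b
    unfolding t_def using cr_skew[of b a] by (simp add: cr_minus_left ip_minus_right)
  have right: "t i j c a b + t i j b a c
      = ip c a * ip (cr i j) b + ip a b * ip (cr i j) c - 2 * ip b c * ip (cr i j) a" for i j c a b
  proof -
    have "cr (cr a b) c = cr c (cr b a)" "cr (cr a c) b = cr b (cr c a)"
      using cr_skew[of "cr a b" c] cr_skew[of "cr a c" b] cr_skew[of a b] cr_skew[of a c]
      by (simp_all add: cr_minus_right)
    then have "t i j c a b + t i j b a c = ip (cr i j) (cr c (cr b a) + cr b (cr c a))"
      unfolding t_def by (simp add: ip_simps)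
    then show ?thesis
      by (simp add: cr_cr_polarized ip_simps ip_commute)
  qed
  have left: "t i j c a b + t i c j a b
      = - (ip j i * ip (cr a b) c + ip i c * ip (cr a b) j - 2 * ip c j * ip (cr a b) i)" for i j c a b
    using right[of a b c i j] swap[of i j c a b] swap[of i c j a b] by (simp add: ip_commute)
  have eqs:
    "t i j c a b = - t i j b a c + (ip c a * ip (cr i j) b + ip a b * ip (cr i j) c - 2 * ip b c * ip (cr i j) a)"
    "t i j b a c = - t i b j a c - (ip j i * ip (cr a c) b + ip i b * ip (cr a c) j - 2 * ip b j * ip (cr a c) i)"
    "t i b j a c = - t i b c a j + (ip j a * ip (cr i b) c + ip a c * ip (cr i b) j - 2 * ip c j * ip (cr i b) a)"
    "t b i c j a = - t b i a j c + (ip c j * ip (cr b i) a + ip j a * ip (cr b i) c - 2 * ip a c * ip (cr b i) j)"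
    "t b i a j c = - t b a i j c - (ip i b * ip (cr j c) a + ip b a * ip (cr j c) i - 2 * ip a i * ip (cr j c) b)"
    "t b a i j c = - t b a c j i + (ip i j * ip (cr b a) c + ip j c * ip (cr b a) i - 2 * ip c i * ip (cr b a) j)"
    using right[of i j c a b] left[of i j b a c] right[of i b j a c]
      right[of b i c j a] left[of b i a j c] right[of b a i j c] by simp_all
  have "t i b c a j = t b i c j a" "t b a c j i = t a b c i j"
    using t1[of i b c a j] t2[of b i c a j] t1[of b a c j i] t2[of a b c j i] by simp_all
  note eqs = eqs this swap[of i j c a b]
  define p where "p x y z = ip (cr x y) z" for x y z
  have canon: "p a c b = - p a b c" "p a c j = p j a c" "p a c i = p i a c" "p i b j = - p i j b"
    "p i b a = - p i a b" "p b i a = p i a b" "p b i c = - p i b c" "p b i j = p i j b"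
    "p j c a = - p j a c" "p j c i = p i j c" "p j c b = - p j b c" "p b a c = - p a b c"
    "p b a i = - p i a b" "p b a j = - p j a b" "p i c a = - p i a c"
    unfolding p_def
    by (simp_all only: triple_perms[where x=a and y=b and z=c] triple_perms[where x=i and y=a and z=b]
      triple_perms[where x=i and y=a and z=c] triple_perms[where x=i and y=b and z=c]
      triple_perms[where x=j and y=a and z=b] triple_perms[where x=j and y=a and z=c]
      triple_perms[where x=j and y=b and z=c] triple_perms[where x=i and y=j and z=b]
      triple_perms[where x=i and y=j and z=c])
  note com = ip_commute[of a c] ip_commute[of j i] ip_commute[of b i] ip_commute[of b j]
    ip_commute[of b a] ip_commute[of a i] ip_commute[of c j] ip_commute[of c i] ip_commute[of a j] ip_commute[of c b]
  have "2 * t i j c a b =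
     (ip c a * p i j b + ip a b * p i j c - 2 * ip b c * p i j a)
   + (ip j i * p a c b + ip i b * p a c j - 2 * ip b j * p a c i)
   + (ip j a * p i b c + ip a c * p i b j - 2 * ip c j * p i b a)
   - (ip c j * p b i a + ip j a * p b i c - 2 * ip a c * p b i j)
   - (ip i b * p j c a + ip b a * p j c i - 2 * ip a i * p j c b)
   - (ip i j * p b a c + ip j c * p b a i - 2 * ip c i * p b a j)"
    using eqs unfolding p_def mult.assoc by linarith
  then have "t i j c a b = ip a c * p i j b - ip b c * p i j a
    - (ip i a * p j b c + ip i b * p j c a + ip i c * p j a b - ip j a * p i b c - ip j b * p i c a - ip j c * p i a b)"
    unfolding canon com mult.assoc mult_minus_right by linarith
  then show ?thesis
    unfolding t_def p_def Q_def by (simp add: ip_simps)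
qed

text \<open>The curvature operator of the unit sphere.\<close>

definition R\<^sub>0 :: "'v \<Rightarrow> 'v \<Rightarrow> 'v \<Rightarrow> 'v" where
  "R\<^sub>0 a b w = ip b w *\<^sub>R a - ip a w *\<^sub>R b"

text \<open>The left side is what torsion contributes at second order to the commutator of two covariant
  derivatives of \<open>u \<times> v\<close>; the right side measures how far \<open>R\<^sub>0 a b\<close> is from being a derivation.
  Paired with a vector \<open>z\<close>, both sides become sums of products of an inner product and a triple
  product by \<open>ip_cr_Q\<close>, and these agree once each triple product is written in a fixed order.\<close>

lemma cr_Q_alternation:
  "(cr (Q a b u) v + Q a (cr b u) v) - (cr (Q b a u) v + Q b (cr a u) v)
    = cr (R\<^sub>0 a b u) v + cr u (R\<^sub>0 a b v) - R\<^sub>0 a b (cr u v)"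
proof (rule vector_eqI)
  fix z
  have 1: "ip (cr (Q x y u) v) z = ip (cr v z) (Q x y u)" for x y
    by (rule triple_cyclic)
  have 2: "ip (Q x (cr y u) v) z = ip (cr y u) (Q v z x)" for x y
    using Q_cyclic[of x "cr y u" v] ip_Q_swap2[of "cr y u" v x z] Q_swap12[of z v x]
      ip_commute[of "cr y u" "Q v z x"]
    by (simp add: ip_minus_left)
  note canon = triple_perms[where x=a and y=b and z=u] triple_perms[where x=a and y=b and z=v]
    triple_perms[where x=a and y=b and z=z] triple_perms[where x=a and y=u and z=v]
    triple_perms[where x=a and y=u and z=z] triple_perms[where x=a and y=v and z=z]
    triple_perms[where x=b and y=u and z=v] triple_perms[where x=b and y=u and z=z]
    triple_perms[where x=b and y=v and z=z] triple_perms[where x=u and y=v and z=z]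
    ip_commute[of b a] ip_commute[of u a] ip_commute[of v a] ip_commute[of z a] ip_commute[of u b]
    ip_commute[of v b] ip_commute[of z b] ip_commute[of v u] ip_commute[of z u] ip_commute[of z v]
    ip_commute[of a "cr u v"] ip_commute[of b "cr u v"]
  show "ip ((cr (Q a b u) v + Q a (cr b u) v) - (cr (Q b a u) v + Q b (cr a u) v)) z
    = ip (cr (R\<^sub>0 a b u) v + cr u (R\<^sub>0 a b v) - R\<^sub>0 a b (cr u v)) z"
    unfolding R\<^sub>0_def ip_simps cr_simps 1 2 ip_cr_Q
    by (simp only: canon) (simp add: algebra_simps)
qed

lemma cr_cr_Q: "cr x (cr y u) = Q x y u + ip u x *\<^sub>R y - ip x y *\<^sub>R u"
proof -
  have "cr x (cr y u) = cr (cr u y) x"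
    using cr_skew[of x "cr y u"] cr_skew[of y u] by (simp add: cr_minus_left)
  moreover have "Q u y x = - Q x y u"
    using Q_cyclic[of x y u] Q_cyclic[of y u x] Q_swap12[of u y x] Q_swap23[of y u x] by (simp add: Q_cyclic)
  ultimately show ?thesis
    unfolding Q_def[of u y x] by (simp add: algebra_simps ip_commute[of y x])
qed

lemma Q_sum_middle: "Q a (\<Sum>l\<in>I. s l *\<^sub>R f l) w = (\<Sum>l\<in>I. s l *\<^sub>R Q a (f l) w)"
proof (induction I rule: infinite_finite_induct)
  case (insert x F)
  then show ?case
    by (simp add: Q_def ip_simps cr_simps algebra_simps)
qed (simp_all add: Q_def ip_simps cr_simps)

text \<open>Contraction with \<open>\<psi>\<close> acts on 2-forms, and on those which are derivations of the cross product
  (the component of dimension 14) it acts as a scalar. The scalar is found by writing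
  \<open>\<Sum>i. e\<^sub>i \<times> D (e\<^sub>i \<times> w)\<close> in two ways, by the derivation rule and by expanding \<open>D\<close> in the frame:
  both give the trace \<open>q\<close> on the left-hand side, with opposite signs, and multiples of \<open>D w\<close>.\<close>

lemma derivation_Q_trace:
  assumes lin: "linear D"
    and skew: "\<And>x y. ip (D x) y = - ip x (D y)"
    and der: "\<And>x y. D (cr x y) = cr (D x) y + cr x (D y)"
  shows "(\<Sum>i\<in>UNIV. Q (e i) (D (e i)) w) = 2 *\<^sub>R D w"
proof -
  let ?q = "\<Sum>i\<in>UNIV. Q (e i) (D (e i)) w"
  have Dexp: "D x = (\<Sum>i\<in>UNIV. ip x (e i) *\<^sub>R D (e i))" for x
  proof -
    have "D (\<Sum>i\<in>UNIV. ip x (e i) *\<^sub>R e i) = (\<Sum>i\<in>UNIV. ip x (e i) *\<^sub>R D (e i))"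
      by (simp add: linear_sum[OF lin] linear_scale[OF lin])
    then show ?thesis by (simp only: frame_expansion)
  qed
  have diag: "ip (e i) (D (e i)) = 0" for i
    using skew[of "e i" "e i"] ip_commute[of "e i"] by simp
  have s1: "(\<Sum>i\<in>UNIV. cr (e i) (cr (e i) (D w))) = - (6 *\<^sub>R D w)"
  proof -
    have "cr (e i) (cr (e i) (D w)) = ip (D w) (e i) *\<^sub>R e i - D w" for i
      by (simp add: cr_cr frame_orthonormal ip_commute[of "e i" "D w"])
    then have "(\<Sum>i\<in>UNIV. cr (e i) (cr (e i) (D w))) = (\<Sum>i\<in>UNIV. ip (D w) (e i) *\<^sub>R e i - D w)"
      by simp
    also have "\<dots> = D w - 7 *\<^sub>R D w"
      by (simp add: sum_subtractf frame_expansion sum_constant_scaleR)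
    also have "\<dots> = - (6 *\<^sub>R D w)"
      using scaleR_left_diff_distrib[of 1 7 "D w"] by simp
    finally show ?thesis .
  qed
  have s3: "(\<Sum>i\<in>UNIV. cr (e i) (cr (D (e i)) w)) = ?q + D w"
  proof -
    have "(\<Sum>i\<in>UNIV. cr (e i) (cr (D (e i)) w)) = (\<Sum>i\<in>UNIV. Q (e i) (D (e i)) w + ip w (e i) *\<^sub>R D (e i))"
      by (simp add: cr_cr_Q diag)
    then show ?thesis
      using Dexp[of w] by (simp add: sum.distrib)
  qed
  have s4: "(\<Sum>i\<in>UNIV. cr (e i) (D (cr (e i) w))) = - ?q - D w"
  proof -
    have "(\<Sum>i\<in>UNIV. cr (e i) (D (cr (e i) w)))
        = (\<Sum>i\<in>UNIV. \<Sum>j\<in>UNIV. ip (cr (e i) w) (e j) *\<^sub>R cr (e i) (D (e j)))"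
      by (subst Dexp) (simp add: cr_sum_right cr_scale_right)
    also have "\<dots> = (\<Sum>j\<in>UNIV. \<Sum>i\<in>UNIV. ip (cr (e i) w) (e j) *\<^sub>R cr (e i) (D (e j)))"
      by (rule sum.swap)
    also have "\<dots> = (\<Sum>j\<in>UNIV. cr (\<Sum>i\<in>UNIV. ip (cr w (e j)) (e i) *\<^sub>R e i) (D (e j)))"
      by (simp add: cr_sum_left cr_scale_left triple_cyclic[of "e _" w])
    also have "\<dots> = (\<Sum>j\<in>UNIV. cr (cr w (e j)) (D (e j)))"
      by (simp add: frame_expansion)
    also have "\<dots> = (\<Sum>j\<in>UNIV. - Q (e j) (D (e j)) w - ip (D w) (e j) *\<^sub>R e j)"
    proof (rule sum.cong[OF refl])
      fix j
      have "cr (cr w (e j)) (D (e j)) = - cr (D (e j)) (cr w (e j))" by (rule cr_skew)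
      also have "\<dots> = - (Q (D (e j)) w (e j) + ip (e j) (D (e j)) *\<^sub>R w - ip (D (e j)) w *\<^sub>R e j)"
        by (simp only: cr_cr_Q)
      also have "\<dots> = - Q (e j) (D (e j)) w - ip (D w) (e j) *\<^sub>R e j"
        using Q_cyclic[of "e j" "D (e j)" w] skew[of "e j" w] ip_commute[of "e j" "D w"] by (simp add: diag)
      finally show "cr (cr w (e j)) (D (e j)) = - Q (e j) (D (e j)) w - ip (D w) (e j) *\<^sub>R e j" .
    qed
    also have "\<dots> = - ?q - D w"
      by (simp add: sum_subtractf sum_negf frame_expansion)
    finally show ?thesis .
  qed
  have "(\<Sum>i\<in>UNIV. cr (e i) (D (cr (e i) w)))
      = (\<Sum>i\<in>UNIV. cr (e i) (cr (D (e i)) w)) + (\<Sum>i\<in>UNIV. cr (e i) (cr (e i) (D w)))"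
    by (simp add: der cr_add_right sum.distrib)
  then have "- ?q - D w = ?q + D w - 6 *\<^sub>R D w"
    by (simp only: s1 s3 s4) simp
  then have "?q + ?q = 6 *\<^sub>R D w - D w - D w"
    by (simp add: algebra_simps)
  also have "\<dots> = 4 *\<^sub>R D w"
    using scaleR_left_diff_distrib[of 6 1 "D w"] scaleR_left_diff_distrib[of 5 1 "D w"] by simp
  finally have "2 *\<^sub>R ?q = 4 *\<^sub>R D w"
    by (simp add: scaleR_2)
  then have "(1/2) *\<^sub>R 2 *\<^sub>R ?q = (1/2) *\<^sub>R 4 *\<^sub>R D w" by simp
  then show ?thesis by simp
qed

text \<open>Applying \<open>derivation_Q_trace\<close> to each \<open>R (e\<^sub>i) b\<close> turns twice the Ricci trace into a sum \<open>T\<close> of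
  products of \<open>R\<close> with the totally skew coefficients \<open>f\<close> of \<open>Q\<close>. The Bianchi identity gives
  \<open>T = - T + V\<close>, where \<open>V\<close> contracts three arguments of \<open>R\<close> with \<open>f\<close>. Since \<open>f\<close> is invariant under
  cyclic permutations, the Bianchi identity makes \<open>V\<close> vanish.\<close>

lemma derivation_curvature_ricci_flat:
  assumes skew12: "\<And>x y z. R x y z = - R y x z"
    and bianchi: "\<And>x y z. R x y z + R y z x + R z x y = 0"
    and lin: "\<And>x y. linear (R x y)"
    and skew: "\<And>x y z w. ip (R x y z) w = - ip z (R x y w)"
    and der: "\<And>x y u v. R x y (cr u v) = cr (R x y u) v + cr u (R x y v)"
  shows "(\<Sum>i\<in>UNIV. ip (R (e i) b k) (e i)) = 0"
proof -
  define s where "s x y z w = ip (R x y z) w" for x y z w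
  define f where "f i j l = ip (Q (e j) (e l) k) (e i)" for i j l
  have f1: "f j i l = - f i j l" for i j l
    unfolding f_def using ip_Q_swap2[of "e i" "e l" k "e j"] by simp
  have f2: "f i l j = - f i j l" for i j l
    unfolding f_def using Q_swap12[of "e l" "e j" k] by (simp add: ip_minus_left)
  have s12: "s y x z w = - s x y z w" for x y z w
    unfolding s_def using skew12[of y x z] by (simp add: ip_minus_left)
  have s34: "s x y w z = - s x y z w" for x y z w
    unfolding s_def using skew[of x y w z] by (simp add: ip_commute)
  have sb: "s x y z w + s y z x w + s z x y w = 0" for x y z w
    unfolding s_def using arg_cong[OF bianchi[of x y z], of "\<lambda>v. ip v w"] by (simp add: ip_simps)
  define T where "T = (\<Sum>i\<in>UNIV. \<Sum>j\<in>UNIV. \<Sum>l\<in>UNIV. s (e i) b (e j) (e l) * f i j l)"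
  define V where "V = (\<Sum>i\<in>UNIV. \<Sum>j\<in>UNIV. \<Sum>l\<in>UNIV. s (e j) (e i) (e l) b * f i j l)"
  have "2 * (\<Sum>i\<in>UNIV. ip (R (e i) b k) (e i)) = T"
  proof -
    have "2 * ip (R (e i) b k) (e i) = (\<Sum>j\<in>UNIV. \<Sum>l\<in>UNIV. s (e i) b (e j) (e l) * f i j l)" for i
    proof -
      have "2 * ip (R (e i) b k) (e i) = ip (\<Sum>j\<in>UNIV. Q (e j) (R (e i) b (e j)) k) (e i)"
        by (simp add: derivation_Q_trace[OF lin skew der] ip_scale_left)
      also have "\<dots> = (\<Sum>j\<in>UNIV. ip (Q (e j) (\<Sum>l\<in>UNIV. s (e i) b (e j) (e l) *\<^sub>R e l) k) (e i))"
        by (simp add: ip_sum_left s_def frame_expansion)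
      also have "\<dots> = (\<Sum>j\<in>UNIV. \<Sum>l\<in>UNIV. s (e i) b (e j) (e l) * f i j l)"
        by (simp only: Q_sum_middle ip_sum_left ip_scale_left f_def)
      finally show ?thesis .
    qed
    then show ?thesis
      unfolding T_def sum_distrib_left by simp
  qed
  moreover have "T = - T + V"
  proof -
    have key: "s (e i) b (e j) (e l) = s (e j) b (e i) (e l) + s (e j) (e i) (e l) b" for i j l
      using sb[of "e i" b "e j" "e l"] s12[of b "e j" "e i" "e l"] s34[of "e j" "e i" "e l" b]
      by linarith
    have summand: "s (e i) b (e j) (e l) * f i j l
        = - (s (e j) b (e i) (e l) * f j i l) + s (e j) (e i) (e l) b * f i j l" for i j l
      by (subst key) (simp add: f1[of i j l] distrib_right)
    have "T = (\<Sum>i\<in>UNIV. \<Sum>j\<in>UNIV. \<Sum>l\<in>UNIV. - (s (e j) b (e i) (e l) * f j i l)) + V"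
      unfolding T_def V_def sum.distrib[symmetric] by (intro sum.cong refl) (rule summand)
    also have "(\<Sum>i\<in>UNIV. \<Sum>j\<in>UNIV. \<Sum>l\<in>UNIV. - (s (e j) b (e i) (e l) * f j i l)) = - T"
      unfolding T_def sum_negf[symmetric] by (rule sum.swap)
    finally show ?thesis .
  qed
  moreover have "V = 0"
  proof -
    have rotate: "(\<Sum>i\<in>UNIV. \<Sum>j\<in>UNIV. \<Sum>l\<in>UNIV. F i j l)
        = (\<Sum>i\<in>UNIV. \<Sum>j\<in>UNIV. \<Sum>l\<in>UNIV. F j l i)" for F :: "7 \<Rightarrow> 7 \<Rightarrow> 7 \<Rightarrow> real"
      by (subst (2) sum.swap, rule sum.cong[OF refl], rule sum.swap)
    define F where "F i j l = s (e j) (e i) (e l) b * f i j l" for i j l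
    have "V = (\<Sum>i\<in>UNIV. \<Sum>j\<in>UNIV. \<Sum>l\<in>UNIV. F i j l)"
      by (simp add: V_def F_def)
    moreover from this have "V = (\<Sum>i\<in>UNIV. \<Sum>j\<in>UNIV. \<Sum>l\<in>UNIV. F j l i)"
      using rotate[of F] by simp
    moreover from this have "V = (\<Sum>i\<in>UNIV. \<Sum>j\<in>UNIV. \<Sum>l\<in>UNIV. F l i j)"
      using rotate[of "\<lambda>i j l. F j l i"] by simp
    ultimately have "3 * V = (\<Sum>i\<in>UNIV. \<Sum>j\<in>UNIV. \<Sum>l\<in>UNIV. F i j l + F j l i + F l i j)"
      by (simp only: sum.distrib)
    also have "\<dots> = 0"
    proof -
      have "F i j l + F j l i + F l i j
          = (s (e j) (e i) (e l) b + s (e i) (e l) (e j) b + s (e l) (e j) (e i) b) * f i j l" for i j l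
        using f2[of j i l] f1[of i j l] f1[of i l j] f2[of i j l] by (simp add: F_def distrib_right)
      then show ?thesis
        by (simp add: sb)
    qed
    finally show ?thesis by simp
  qed
  ultimately show ?thesis by simp
qed

text \<open>By \<open>cr_Q_alternation\<close> the hypothesis on \<open>R a b (cr u v)\<close> says that \<open>R - k R\<^sub>0\<close> takes values in
  derivations. Its Ricci trace vanishes, and the unit sphere of dimension seven has Ricci tensor
  \<open>6 g\<close>.\<close>

theorem einstein:
  assumes skew12: "\<And>x y z. R x y z = - R y x z"
    and bianchi: "\<And>x y z. R x y z + R y z x + R z x y = 0"
    and lin: "\<And>x y. linear (R x y)"
    and skew: "\<And>x y z w. ip (R x y z) w = - ip z (R x y w)"
    and der: "\<And>a b u v. R a b (cr u v) = cr (R a b u) v + cr u (R a b v)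
       - k *\<^sub>R ((cr (Q a b u) v + Q a (cr b u) v) - (cr (Q b a u) v + Q b (cr a u) v))"
  shows "(\<Sum>i\<in>UNIV. ip (R (e i) x y) (e i)) = 6 * k * ip x y"
proof -
  define W where "W x y z = R x y z - k *\<^sub>R R\<^sub>0 x y z" for x y z
  have R0_skew: "ip (R\<^sub>0 x y z) w = - ip z (R\<^sub>0 x y w)" for x y z w
    by (simp add: R\<^sub>0_def ip_simps ip_commute)
  have R0_bianchi: "R\<^sub>0 x y z + R\<^sub>0 y z x + R\<^sub>0 z x y = 0" for x y z
    by (simp add: R\<^sub>0_def ip_commute)
  have "(\<Sum>i\<in>UNIV. ip (W (e i) x y) (e i)) = 0"
  proof (rule derivation_curvature_ricci_flat)
    show "W x y z = - W y x z" for x y z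
      unfolding W_def using skew12[of x y z] by (simp add: R\<^sub>0_def algebra_simps)
    have "W x y z + W y z x + W z x y = (R x y z + R y z x + R z x y) - k *\<^sub>R (R\<^sub>0 x y z + R\<^sub>0 y z x + R\<^sub>0 z x y)" for x y z
      unfolding W_def by (simp add: algebra_simps)
    then show "W x y z + W y z x + W z x y = 0" for x y z
      by (simp add: bianchi R0_bianchi)
    show "linear (W x y)" for x y
      unfolding W_def R\<^sub>0_def using lin[of x y]
      by (auto intro!: linearI simp: linear_add linear_scale ip_simps algebra_simps)
    show "ip (W x y z) w = - ip z (W x y w)" for x y z w
      unfolding W_def using skew[of x y z w] R0_skew[of x y z w] by (simp add: ip_simps algebra_simps)
    show "W a b (cr u v) = cr (W a b u) v + cr u (W a b v)" for a b u v
      unfolding W_def der cr_Q_alternation by (simp add: cr_simps algebra_simps)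
  qed
  then have "(\<Sum>i\<in>UNIV. ip (R (e i) x y) (e i)) = k * (\<Sum>i\<in>UNIV. ip (R\<^sub>0 (e i) x y) (e i))"
    by (simp add: W_def ip_simps sum_subtractf sum_distrib_left)
  also have "(\<Sum>i\<in>UNIV. ip (R\<^sub>0 (e i) x y) (e i)) = 7 * ip x y - ip (\<Sum>i\<in>UNIV. ip x (e i) *\<^sub>R e i) y"
    by (simp add: R\<^sub>0_def ip_simps ip_sum_left frame_orthonormal sum_subtractf mult.commute)
  also have "\<dots> = 6 * ip x y"
    by (simp add: frame_expansion)
  finally show ?thesis by simp
qed

end

section \<open>Alternating sums over seven indices\<close>

lemma exhaust_7: fixes x :: 7 shows "x = 0 \<or> x = 1 \<or> x = 2 \<or> x = 3 \<or> x = 4 \<or> x = 5 \<or> x = 6"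
proof (induct x)
  case (of_int z)
  then have "0 \<le> z" and "z < 7" by simp_all
  then have "z = 0 \<or> z = 1 \<or> z = 2 \<or> z = 3 \<or> z = 4 \<or> z = 5 \<or> z = 6" by arith
  then show ?case by auto
qed
lemma UNIV_7: "(UNIV::7 set) = {0,1,2,3,4,5,6}" using exhaust_7 by auto
lemma sum_7: "sum f (UNIV::7 set) = f 0 + f 1 + f 2 + f 3 + f 4 + f 5 + f 6"
  unfolding UNIV_7 by (simp add: ac_simps)
lemma less_7: "(0::7) < 1" "(0::7) < 2" "(0::7) < 3" "(0::7) < 4" "(0::7) < 5" "(0::7) < 6"
  "(1::7) < 2" "(1::7) < 3" "(1::7) < 4" "(1::7) < 5" "(1::7) < 6"
  "(2::7) < 3" "(2::7) < 4" "(2::7) < 5" "(2::7) < 6" "(3::7) < 4" "(3::7) < 5" "(3::7) < 6"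
  "(4::7) < 5" "(4::7) < 6" "(5::7) < 6"
  by (simp_all add: less_bit1_def bit1.Rep_numeral bit1.Rep_0 bit1.Rep_1)

lemma all7: "(\<forall>i::7. P i) \<longleftrightarrow> P 0 \<and> P 1 \<and> P 2 \<and> P 3 \<and> P 4 \<and> P 5 \<and> P 6"
proof
  assume R: "P 0 \<and> P 1 \<and> P 2 \<and> P 3 \<and> P 4 \<and> P 5 \<and> P 6"
  show "\<forall>i. P i"
  proof
    fix i :: 7 show "P i" using exhaust_7[of i] R by auto
  qed
qed simp

lemmas not_less_7 = less_7[THEN order_less_not_sym]

text \<open>Separating this case distinction from the terms it is applied to keeps the number of terms to
  simplify at 35 instead of 2401.\<close>

lemma increasing4I:
  fixes F :: "7 \<Rightarrow> 7 \<Rightarrow> 7 \<Rightarrow> 7 \<Rightarrow> bool"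
  assumes "F 0 1 2 3" "F 0 1 2 4" "F 0 1 2 5" "F 0 1 2 6" "F 0 1 3 4"
    "F 0 1 3 5" "F 0 1 3 6" "F 0 1 4 5" "F 0 1 4 6" "F 0 1 5 6"
    "F 0 2 3 4" "F 0 2 3 5" "F 0 2 3 6" "F 0 2 4 5" "F 0 2 4 6"
    "F 0 2 5 6" "F 0 3 4 5" "F 0 3 4 6" "F 0 3 5 6" "F 0 4 5 6"
    "F 1 2 3 4" "F 1 2 3 5" "F 1 2 3 6" "F 1 2 4 5" "F 1 2 4 6"
    "F 1 2 5 6" "F 1 3 4 5" "F 1 3 4 6" "F 1 3 5 6" "F 1 4 5 6"
    "F 2 3 4 5" "F 2 3 4 6" "F 2 3 5 6" "F 2 4 5 6" "F 3 4 5 6"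
  shows "a < b \<Longrightarrow> b < c \<Longrightarrow> c < d \<Longrightarrow> F a b c d"
proof -
  have "\<forall>a b c d. a < b \<longrightarrow> b < c \<longrightarrow> c < d \<longrightarrow> F a b c d"
    unfolding all7 by (simp add: less_7 not_less_7 assms)
  then show "a < b \<Longrightarrow> b < c \<Longrightarrow> c < d \<Longrightarrow> F a b c d" by blast
qed

text \<open>Index tuples are functions on the index type, so that permutations act by composition.\<close>

definition tup :: "'a \<Rightarrow> 'a \<Rightarrow> 'a \<Rightarrow> 'a \<Rightarrow> 'a \<Rightarrow> 'a \<Rightarrow> 'a \<Rightarrow> 7 \<Rightarrow> 'a" where
  "tup x0 x1 x2 x3 x4 x5 x6 i =
    (if i = 0 then x0 else if i = 1 then x1 else if i = 2 then x2 else if i = 3 then x3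
     else if i = 4 then x4 else if i = 5 then x5 else x6)"

lemma tup_simps [simp]:
  "tup x0 x1 x2 x3 x4 x5 x6 0 = x0" "tup x0 x1 x2 x3 x4 x5 x6 1 = x1" "tup x0 x1 x2 x3 x4 x5 x6 2 = x2" "tup x0 x1 x2 x3 x4 x5 x6 3 = x3"
  "tup x0 x1 x2 x3 x4 x5 x6 4 = x4" "tup x0 x1 x2 x3 x4 x5 x6 5 = x5" "tup x0 x1 x2 x3 x4 x5 x6 6 = x6"
  by (simp_all add: tup_def)

lemma tup_eta: "tup (f 0) (f 1) (f 2) (f 3) (f 4) (f 5) (f 6) = f"
proof
  fix i :: 7 show "tup (f 0) (f 1) (f 2) (f 3) (f 4) (f 5) (f 6) i = f i"
    using exhaust_7[of i] by auto
qed

lemma tup_id: "tup 0 1 2 3 4 5 6 = id"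
  using tup_eta[of id] by simp

lemma tup_transpose:
  "tup x0 x1 x2 x3 x4 x5 x6 \<circ> Transposition.transpose 0 1 = tup x1 x0 x2 x3 x4 x5 x6"
  "tup x0 x1 x2 x3 x4 x5 x6 \<circ> Transposition.transpose 0 2 = tup x2 x1 x0 x3 x4 x5 x6"
  "tup x0 x1 x2 x3 x4 x5 x6 \<circ> Transposition.transpose 0 3 = tup x3 x1 x2 x0 x4 x5 x6"
  "tup x0 x1 x2 x3 x4 x5 x6 \<circ> Transposition.transpose 0 4 = tup x4 x1 x2 x3 x0 x5 x6"
  "tup x0 x1 x2 x3 x4 x5 x6 \<circ> Transposition.transpose 0 5 = tup x5 x1 x2 x3 x4 x0 x6"
  "tup x0 x1 x2 x3 x4 x5 x6 \<circ> Transposition.transpose 0 6 = tup x6 x1 x2 x3 x4 x5 x0"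
  "tup x0 x1 x2 x3 x4 x5 x6 \<circ> Transposition.transpose 1 2 = tup x0 x2 x1 x3 x4 x5 x6"
  "tup x0 x1 x2 x3 x4 x5 x6 \<circ> Transposition.transpose 1 3 = tup x0 x3 x2 x1 x4 x5 x6"
  "tup x0 x1 x2 x3 x4 x5 x6 \<circ> Transposition.transpose 1 4 = tup x0 x4 x2 x3 x1 x5 x6"
  "tup x0 x1 x2 x3 x4 x5 x6 \<circ> Transposition.transpose 1 5 = tup x0 x5 x2 x3 x4 x1 x6"
  "tup x0 x1 x2 x3 x4 x5 x6 \<circ> Transposition.transpose 1 6 = tup x0 x6 x2 x3 x4 x5 x1"
  "tup x0 x1 x2 x3 x4 x5 x6 \<circ> Transposition.transpose 2 3 = tup x0 x1 x3 x2 x4 x5 x6"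
  "tup x0 x1 x2 x3 x4 x5 x6 \<circ> Transposition.transpose 2 4 = tup x0 x1 x4 x3 x2 x5 x6"
  "tup x0 x1 x2 x3 x4 x5 x6 \<circ> Transposition.transpose 2 5 = tup x0 x1 x5 x3 x4 x2 x6"
  "tup x0 x1 x2 x3 x4 x5 x6 \<circ> Transposition.transpose 2 6 = tup x0 x1 x6 x3 x4 x5 x2"
  "tup x0 x1 x2 x3 x4 x5 x6 \<circ> Transposition.transpose 3 4 = tup x0 x1 x2 x4 x3 x5 x6"
  "tup x0 x1 x2 x3 x4 x5 x6 \<circ> Transposition.transpose 3 5 = tup x0 x1 x2 x5 x4 x3 x6"
  "tup x0 x1 x2 x3 x4 x5 x6 \<circ> Transposition.transpose 3 6 = tup x0 x1 x2 x6 x4 x5 x3"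
  "tup x0 x1 x2 x3 x4 x5 x6 \<circ> Transposition.transpose 4 5 = tup x0 x1 x2 x3 x5 x4 x6"
  "tup x0 x1 x2 x3 x4 x5 x6 \<circ> Transposition.transpose 4 6 = tup x0 x1 x2 x3 x6 x5 x4"
  "tup x0 x1 x2 x3 x4 x5 x6 \<circ> Transposition.transpose 5 6 = tup x0 x1 x2 x3 x4 x6 x5"
  by (rule ext, rename_tac i, cut_tac x=i in exhaust_7, auto simp: Transposition.transpose_def)+

text \<open>Restricting the permutations to a set \<open>S\<close> gives a recursion (\<open>alt_sum_insert\<close>), by which sums over
  all 5040 permutations can be evaluated while using the symmetries of the summand on the way.\<close>

definition alt_sum :: "7 set \<Rightarrow> ((7 \<Rightarrow> 'a) \<Rightarrow> real) \<Rightarrow> (7 \<Rightarrow> 'a) \<Rightarrow> real" where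
  "alt_sum S H \<nu> = (\<Sum>q | q permutes S. of_int (sign q) * H (\<nu> \<circ> q))"

lemma alt_sum_empty: "alt_sum {} H \<nu> = H \<nu>"
  by (simp add: alt_sum_def)

text \<open>Each permutation of \<open>insert a S\<close> is a permutation of \<open>S\<close> followed by the transposition of \<open>a\<close> with
  an element of \<open>S\<close>, which changes the sign, or by the identity.\<close>

lemma alt_sum_insert:
  assumes "a \<notin> S"
  shows "alt_sum (insert a S) H \<nu>
    = alt_sum S H \<nu> - (\<Sum>b\<in>S. alt_sum S H (\<nu> \<circ> Transposition.transpose a b))"
proof -
  have fin: "finite S" by simp
  have sgn: "sign (Transposition.transpose a b \<circ> q) = - sign q" if "b \<in> S" "q permutes S" for b q
  proof -
    have "a \<noteq> b" using assms that by auto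
    then show ?thesis
      using permutation_permutes[of q] that fin
      by (subst sign_compose) (auto simp: sign_swap_id permutation_swap_id)
  qed
  have "alt_sum (insert a S) H \<nu> = (\<Sum>b\<in>insert a S. \<Sum>q | q permutes S.
      of_int (sign (Transposition.transpose a b \<circ> q)) * H (\<nu> \<circ> (Transposition.transpose a b \<circ> q)))"
    unfolding alt_sum_def by (rule sum_over_permutations_insert[OF fin assms])
  also have "\<dots> = alt_sum S H \<nu> + (\<Sum>b\<in>S. - alt_sum S H (\<nu> \<circ> Transposition.transpose a b))"
  proof -
    have "(\<Sum>q | q permutes S. of_int (sign (Transposition.transpose a b \<circ> q)) * H (\<nu> \<circ> (Transposition.transpose a b \<circ> q)))
        = - alt_sum S H (\<nu> \<circ> Transposition.transpose a b)" if "b \<in> S" for b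
      unfolding alt_sum_def sum_negf[symmetric]
      by (rule sum.cong) (use sgn[OF that] in \<open>auto simp: o_assoc\<close>)
    then show ?thesis
      using fin assms by (simp add: alt_sum_def)
  qed
  finally show ?thesis by (simp add: sum_negf)
qed

text \<open>The value of \<open>B \<and> C\<close> on five arguments, for a 2-form \<open>B\<close> and a 3-form \<open>C\<close>: one term for each
  of the ten shuffles.\<close>

definition pair_triple :: "('a \<Rightarrow> 'a \<Rightarrow> real) \<Rightarrow> ('a \<Rightarrow> 'a \<Rightarrow> 'a \<Rightarrow> real) \<Rightarrow> 'a \<Rightarrow> 'a \<Rightarrow> 'a \<Rightarrow> 'a \<Rightarrow> 'a \<Rightarrow> real" where
  "pair_triple B C a b c d e =
    B a b * C c d e - B a c * C b d e + B a d * C b c e - B a e * C b c d + B b c * C a d e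
    - B b d * C a c e + B b e * C a c d + B c d * C a b e - B c e * C a b d + B d e * C a b c"

text \<open>The coefficient of \<open>A \<and> B \<and> C\<close> with respect to the standard volume form, for 2-forms \<open>A\<close>, \<open>B\<close>
  and a 3-form \<open>C\<close>.\<close>

definition pair_pair_triple :: "(7 \<Rightarrow> 7 \<Rightarrow> real) \<Rightarrow> (7 \<Rightarrow> 7 \<Rightarrow> real) \<Rightarrow> (7 \<Rightarrow> 7 \<Rightarrow> 7 \<Rightarrow> real) \<Rightarrow> real" where
  "pair_pair_triple A B C =
      A 0 1 * pair_triple B C 2 3 4 5 6
      - A 0 2 * pair_triple B C 1 3 4 5 6
      + A 0 3 * pair_triple B C 1 2 4 5 6
      - A 0 4 * pair_triple B C 1 2 3 5 6
      + A 0 5 * pair_triple B C 1 2 3 4 6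
      - A 0 6 * pair_triple B C 1 2 3 4 5
      + A 1 2 * pair_triple B C 0 3 4 5 6
      - A 1 3 * pair_triple B C 0 2 4 5 6
      + A 1 4 * pair_triple B C 0 2 3 5 6
      - A 1 5 * pair_triple B C 0 2 3 4 6
      + A 1 6 * pair_triple B C 0 2 3 4 5
      + A 2 3 * pair_triple B C 0 1 4 5 6
      - A 2 4 * pair_triple B C 0 1 3 5 6
      + A 2 5 * pair_triple B C 0 1 3 4 6
      - A 2 6 * pair_triple B C 0 1 3 4 5
      + A 3 4 * pair_triple B C 0 1 2 5 6
      - A 3 5 * pair_triple B C 0 1 2 4 6
      + A 3 6 * pair_triple B C 0 1 2 4 5
      + A 4 5 * pair_triple B C 0 1 2 3 6
      - A 4 6 * pair_triple B C 0 1 2 3 5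
      + A 5 6 * pair_triple B C 0 1 2 3 4"

context
  fixes A B :: "7 \<Rightarrow> 7 \<Rightarrow> real" and C :: "7 \<Rightarrow> 7 \<Rightarrow> 7 \<Rightarrow> real"
  assumes A: "A x y = - A y x" and B: "B x y = - B y x"
    and C1: "C x y z = - C y x z" and C2: "C x y z = - C x z y"
begin

abbreviation "ABC \<equiv> \<lambda>\<nu>::7\<Rightarrow>7. A (\<nu> 0) (\<nu> 1) * B (\<nu> 2) (\<nu> 3) * C (\<nu> 4) (\<nu> 5) (\<nu> 6)"

lemma alt_sum_456: "alt_sum {4,5,6} ABC (tup x0 x1 x2 x3 x4 x5 x6) = 6 * (A x0 x1 * B x2 x3 * C x4 x5 x6)"
proof -
  have "C x4 x6 x5 = - C x4 x5 x6" "C x5 x4 x6 = - C x4 x5 x6" "C x6 x5 x4 = - C x4 x5 x6"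
    "C x5 x6 x4 = C x4 x5 x6" "C x6 x4 x5 = C x4 x5 x6"
    using C1[of x4 x5 x6] C2[of x4 x5 x6] C1[of x4 x6 x5] C2[of x5 x4 x6] C1[of x5 x6 x4] C2[of x6 x4 x5]
    by linarith+
  then show ?thesis
    by (simp add: alt_sum_insert alt_sum_empty tup_transpose)
qed

lemma pair_triple_swap:
  "pair_triple B C b a c d e = - pair_triple B C a b c d e"
  "pair_triple B C a c b d e = - pair_triple B C a b c d e"
  "pair_triple B C a b d c e = - pair_triple B C a b c d e"
  "pair_triple B C a b c e d = - pair_triple B C a b c d e"
  unfolding pair_triple_def
  by (simp_all add: B[of b a] C1[of b a] B[of c b] C1[of c b] C2[of _ c b] B[of d c] C1[of d c] C2[of _ d c]
      B[of e d] C1[of e d] C2[of _ e d])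

lemma alt_sum_23456:
  "alt_sum {2,3,4,5,6} ABC (tup x0 x1 x2 x3 x4 x5 x6) = 12 * (A x0 x1 * pair_triple B C x2 x3 x4 x5 x6)"
proof -
  have "alt_sum {3,4,5,6} ABC (tup x0 x1 x2 x3 x4 x5 x6) = 6 * (A x0 x1 * B x2 x3 * C x4 x5 x6)
      - 6 * (A x0 x1 * B x2 x4 * C x3 x5 x6) - 6 * (A x0 x1 * B x2 x5 * C x4 x3 x6)
      - 6 * (A x0 x1 * B x2 x6 * C x4 x5 x3)" for x0 x1 x2 x3 x4 x5 x6
    by (subst alt_sum_insert) (simp_all add: tup_transpose alt_sum_456)
  then have "alt_sum {2,3,4,5,6} ABC (tup x0 x1 x2 x3 x4 x5 x6) =
      6 * (A x0 x1 * B x2 x3 * C x4 x5 x6) - 6 * (A x0 x1 * B x2 x4 * C x3 x5 x6)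
      - 6 * (A x0 x1 * B x2 x5 * C x4 x3 x6) - 6 * (A x0 x1 * B x2 x6 * C x4 x5 x3)
      - (6 * (A x0 x1 * B x3 x2 * C x4 x5 x6) - 6 * (A x0 x1 * B x3 x4 * C x2 x5 x6)
      - 6 * (A x0 x1 * B x3 x5 * C x4 x2 x6) - 6 * (A x0 x1 * B x3 x6 * C x4 x5 x2))
      - (6 * (A x0 x1 * B x4 x3 * C x2 x5 x6) - 6 * (A x0 x1 * B x4 x2 * C x3 x5 x6)
      - 6 * (A x0 x1 * B x4 x5 * C x2 x3 x6) - 6 * (A x0 x1 * B x4 x6 * C x2 x5 x3))
      - (6 * (A x0 x1 * B x5 x3 * C x4 x2 x6) - 6 * (A x0 x1 * B x5 x4 * C x3 x2 x6)
      - 6 * (A x0 x1 * B x5 x2 * C x4 x3 x6) - 6 * (A x0 x1 * B x5 x6 * C x4 x2 x3))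
      - (6 * (A x0 x1 * B x6 x3 * C x4 x5 x2) - 6 * (A x0 x1 * B x6 x4 * C x3 x5 x2)
      - 6 * (A x0 x1 * B x6 x5 * C x4 x3 x2) - 6 * (A x0 x1 * B x6 x2 * C x4 x5 x3))"
    by (subst alt_sum_insert) (simp_all add: tup_transpose)
  also have "\<dots> = 12 * (A x0 x1 * pair_triple B C x2 x3 x4 x5 x6)"
    unfolding pair_triple_def
    by (simp only: B[of x3 x2] C1[of x3 x2] C2[of _ x3 x2] B[of x4 x2] C1[of x4 x2] C2[of _ x4 x2] B[of x5 x2] C1[of x5 x2] C2[of _ x5 x2] B[of x6 x2] C1[of x6 x2] C2[of _ x6 x2] B[of x4 x3] C1[of x4 x3] C2[of _ x4 x3] B[of x5 x3] C1[of x5 x3] C2[of _ x5 x3] B[of x6 x3] C1[of x6 x3] C2[of _ x6 x3] B[of x5 x4] C1[of x5 x4] C2[of _ x5 x4] B[of x6 x4] C1[of x6 x4] C2[of _ x6 x4] B[of x6 x5] C1[of x6 x5] C2[of _ x6 x5]) (simp add: algebra_simps)?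
  finally show ?thesis .
qed

text \<open>Each shuffle occurs \<open>2! 2! 3! = 24\<close> times among the permutations.\<close>

lemma alt_sum_pair_pair_triple: "alt_sum UNIV ABC id = 24 * pair_pair_triple A B C"
proof -
  have A': "y < x \<Longrightarrow> A x y = - A y x" for x y by (rule A)
  have P1: "b < a \<Longrightarrow> pair_triple B C a b c d e = - pair_triple B C b a c d e"
    and P2: "c < b \<Longrightarrow> pair_triple B C a b c d e = - pair_triple B C a c b d e"
    and P3: "d < c \<Longrightarrow> pair_triple B C a b c d e = - pair_triple B C a b d c e"
    and P4: "e < d \<Longrightarrow> pair_triple B C a b c d e = - pair_triple B C a b c e d" for a b c d e
    by (rule pair_triple_swap)+
  have step1: "alt_sum {1,2,3,4,5,6} ABC (tup x0 x1 x2 x3 x4 x5 x6) = 12 * (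
      A x0 x1 * pair_triple B C x2 x3 x4 x5 x6 - A x0 x2 * pair_triple B C x1 x3 x4 x5 x6
      - A x0 x3 * pair_triple B C x2 x1 x4 x5 x6 - A x0 x4 * pair_triple B C x2 x3 x1 x5 x6
      - A x0 x5 * pair_triple B C x2 x3 x4 x1 x6 - A x0 x6 * pair_triple B C x2 x3 x4 x5 x1)" for x0 x1 x2 x3 x4 x5 x6
    by (subst alt_sum_insert) (simp_all add: tup_transpose alt_sum_23456)
  have "alt_sum UNIV ABC (tup 0 1 2 3 4 5 6) = alt_sum (insert 0 {1,2,3,4,5,6}) ABC (tup 0 1 2 3 4 5 6)"
    by (simp only: UNIV_7)
  also have "\<dots> = alt_sum {1,2,3,4,5,6} ABC (tup 0 1 2 3 4 5 6)
    - alt_sum {1,2,3,4,5,6} ABC (tup 1 0 2 3 4 5 6) - alt_sum {1,2,3,4,5,6} ABC (tup 2 1 0 3 4 5 6)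
    - alt_sum {1,2,3,4,5,6} ABC (tup 3 1 2 0 4 5 6) - alt_sum {1,2,3,4,5,6} ABC (tup 4 1 2 3 0 5 6)
    - alt_sum {1,2,3,4,5,6} ABC (tup 5 1 2 3 4 0 6) - alt_sum {1,2,3,4,5,6} ABC (tup 6 1 2 3 4 5 0)"
    by (subst alt_sum_insert) (simp_all add: tup_transpose)
  finally show ?thesis
    unfolding step1 unfolding tup_id pair_pair_triple_def
    by (simp add: less_7 A' P1 P2 P3 P4)
qed

end

section \<open>Change of frame for the wedge coefficients and the dual 4-form\<close>

lemma prod_7: "prod f (UNIV::7 set) = f 0 * f 1 * f 2 * f 3 * f 4 * f 5 * (f 6 :: real)"
  unfolding UNIV_7 by (simp add: mult_ac)

lemma sum_triple: "(\<Sum>i\<in>UNIV. \<Sum>j\<in>UNIV. \<Sum>k\<in>UNIV. F i j k)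
    = (\<Sum>t\<in>(UNIV :: ('a::finite \<times> 'b::finite \<times> 'c::finite) set). F (fst t) (fst (snd t)) (snd (snd t)))"
  by (simp add: sum.cartesian_product split_def)

lemma sum_swap_triples:
  fixes F :: "7 \<Rightarrow> 7 \<Rightarrow> 7 \<Rightarrow> 7 \<Rightarrow> 7 \<Rightarrow> 7 \<Rightarrow> real"
  shows "(\<Sum>i\<in>UNIV. \<Sum>j\<in>UNIV. \<Sum>k\<in>UNIV. \<Sum>e\<in>UNIV. \<Sum>f\<in>UNIV. \<Sum>h\<in>UNIV. F i j k e f h)
    = (\<Sum>e\<in>UNIV. \<Sum>f\<in>UNIV. \<Sum>h\<in>UNIV. \<Sum>i\<in>UNIV. \<Sum>j\<in>UNIV. \<Sum>k\<in>UNIV. F i j k e f h)"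
proof -
  have "(\<Sum>t\<in>UNIV. \<Sum>e\<in>UNIV. \<Sum>f\<in>UNIV. \<Sum>h\<in>UNIV. F (fst t) (fst (snd t)) (snd (snd t)) e f h)
    = (\<Sum>t\<in>UNIV. \<Sum>s\<in>UNIV. F (fst t) (fst (snd t)) (snd (snd t)) (fst s) (fst (snd s)) (snd (snd s)))"
    by (intro sum.cong refl sum_triple)
  also have "\<dots> = (\<Sum>s\<in>UNIV. \<Sum>t\<in>UNIV. F (fst t) (fst (snd t)) (snd (snd t)) (fst s) (fst (snd s)) (snd (snd s)))"
    by (rule sum.swap)
  also have "\<dots> = (\<Sum>s\<in>UNIV. \<Sum>i\<in>UNIV. \<Sum>j\<in>UNIV. \<Sum>k\<in>UNIV. F i j k (fst s) (fst (snd s)) (snd (snd s)))"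
    by (intro sum.cong refl sum_triple[symmetric])
  finally show ?thesis
    by (subst (1 2) sum_triple)
qed

lemma sum_quadruple: "(\<Sum>i\<in>UNIV. \<Sum>j\<in>UNIV. \<Sum>k\<in>UNIV. \<Sum>l\<in>UNIV. F i j k l)
    = (\<Sum>t\<in>(UNIV :: ('a::finite \<times> 'b::finite \<times> 'c::finite \<times> 'd::finite) set).
        F (fst t) (fst (snd t)) (fst (snd (snd t))) (snd (snd (snd t))))"
  by (simp add: sum.cartesian_product split_def)

lemma nested_sum_7:
  fixes F :: "7 \<Rightarrow> 7 \<Rightarrow> 7 \<Rightarrow> 7 \<Rightarrow> 7 \<Rightarrow> 7 \<Rightarrow> 7 \<Rightarrow> real"
  shows "(\<Sum>a0\<in>UNIV. \<Sum>a1\<in>UNIV. \<Sum>a2\<in>UNIV. \<Sum>a3\<in>UNIV. \<Sum>a4\<in>UNIV. \<Sum>a5\<in>UNIV. \<Sum>a6\<in>UNIV. F a0 a1 a2 a3 a4 a5 a6)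
    = (\<Sum>a\<in>(UNIV :: (7 \<Rightarrow> 7) set). F (a 0) (a 1) (a 2) (a 3) (a 4) (a 5) (a 6))"
proof -
  have "(\<Sum>a0\<in>UNIV. \<Sum>a1\<in>UNIV. \<Sum>a2\<in>UNIV. \<Sum>a3\<in>UNIV. \<Sum>a4\<in>UNIV. \<Sum>a5\<in>UNIV. \<Sum>a6\<in>UNIV. F a0 a1 a2 a3 a4 a5 a6)
    = (\<Sum>(a0,a1,a2,a3,a4,a5,a6)\<in>UNIV. F a0 a1 a2 a3 a4 a5 a6)"
    by (simp add: sum.cartesian_product split_def)
  also have "\<dots> = (\<Sum>a\<in>(UNIV :: (7 \<Rightarrow> 7) set). F (a 0) (a 1) (a 2) (a 3) (a 4) (a 5) (a 6))"
    by (rule sum.reindex_bij_witness[where j = "\<lambda>(a0,a1,a2,a3,a4,a5,a6). tup a0 a1 a2 a3 a4 a5 a6"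
          and i = "\<lambda>a. (a 0, a 1, a 2, a 3, a 4, a 5, a 6)"])
      (auto simp: tup_eta)
  finally show ?thesis .
qed

text \<open>The Levi-Civita symbol.\<close>

definition eps :: "(7 \<Rightarrow> 7) \<Rightarrow> real" where
  "eps a = (if a permutes UNIV then of_int (sign a) else 0)"

lemma permutes_UNIV_7: "a permutes UNIV \<longleftrightarrow> inj (a :: 7 \<Rightarrow> 7)"
proof
  assume "inj a"
  then have "bij a" by (simp add: bij_def finite_UNIV_inj_surj)
  then show "a permutes UNIV" by (intro bij_imp_permutes) auto
qed (simp add: permutes_inj)

lemma det_select_rows: "det (\<chi> i. P $ a i) = eps a * det (P :: real^7^7)"
proof (cases "a permutes UNIV")
  case True
  then show ?thesis by (simp add: eps_def det_permute_rows)
next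
  case False
  then obtain i j where "i \<noteq> j" "a i = a j"
    unfolding permutes_UNIV_7 inj_def by blast
  then have "det (\<chi> i. P $ a i) = 0"
    by (intro det_identical_rows[of i j]) (auto simp: row_def)
  then show ?thesis using False by (simp add: eps_def)
qed

text \<open>Summation over the permutation first produces the determinants of the matrices whose rows are
  the rows of \<open>P\<close> selected by \<open>a\<close>, and these vanish unless \<open>a\<close> is itself a permutation.\<close>

lemma alt_sum_transform:
  fixes P :: "real^7^7"
  shows "(\<Sum>p | p permutes (UNIV::7 set). of_int (sign p) * (\<Sum>a\<in>UNIV. (\<Prod>k\<in>UNIV. P $ a k $ p k) * H a))
    = det P * (\<Sum>p | p permutes (UNIV::7 set). of_int (sign p) * H p)"
proof -
  have "(\<Sum>p | p permutes (UNIV::7 set). of_int (sign p) * (\<Sum>a\<in>UNIV. (\<Prod>k\<in>UNIV. P $ a k $ p k) * H a))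
     = (\<Sum>p | p permutes (UNIV::7 set). \<Sum>a\<in>UNIV. of_int (sign p) * (\<Prod>k\<in>UNIV. P $ a k $ p k) * H a)"
    by (simp add: sum_distrib_left mult.assoc)
  also have "\<dots> = (\<Sum>a\<in>UNIV. \<Sum>p | p permutes (UNIV::7 set). of_int (sign p) * (\<Prod>k\<in>UNIV. P $ a k $ p k) * H a)"
    by (rule sum.swap)
  also have "\<dots> = (\<Sum>a\<in>UNIV. det (\<chi> i. P $ a i) * H a)"
    by (simp add: det_def sum_distrib_right)
  also have "\<dots> = (\<Sum>a\<in>UNIV. if a permutes UNIV then det P * (of_int (sign a) * H a) else 0)"
    by (rule sum.cong) (simp_all add: det_select_rows eps_def)
  also have "\<dots> = (\<Sum>a | a permutes (UNIV::7 set). det P * (of_int (sign a) * H a))"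
    by (simp add: sum.If_cases)
  finally show ?thesis by (simp add: sum_distrib_left)
qed

text \<open>The seven indices that are antisymmetrised contribute the factor \<open>det P\<close>; the other two
  transform as those of a bilinear form.\<close>

lemma wedge_coeff_pull3:
  "wedge_coeff (pull3 P \<phi>) i j
    = det P * (\<Sum>x\<in>UNIV. \<Sum>y\<in>UNIV. P $ x $ i * P $ y $ j * wedge_coeff \<phi> x y)"
proof -
  let ?H = "\<lambda>x y a. \<phi> $ x $ a 0 $ a 1 * \<phi> $ y $ a 2 $ a 3 * \<phi> $ a 4 $ a 5 $ a (6::7)"
  have pair: "pull3 P \<phi> $ i $ b $ c = (\<Sum>x\<in>UNIV. P $ x $ i * (\<Sum>k\<in>UNIV. \<Sum>l\<in>UNIV. P $ k $ b * P $ l $ c * \<phi> $ x $ k $ l))" for i b c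
    by (simp add: pull3_def sum_distrib_left mult.assoc)
  have trip: "pull3 P \<phi> $ b $ c $ d = (\<Sum>k\<in>UNIV. \<Sum>l\<in>UNIV. \<Sum>m\<in>UNIV. P $ k $ b * P $ l $ c * P $ m $ d * \<phi> $ k $ l $ m)" for b c d
    by (simp add: pull3_def)
  have prods: "(\<Sum>a0\<in>UNIV. \<Sum>a1\<in>UNIV. A a0 a1) * (\<Sum>a2\<in>UNIV. \<Sum>a3\<in>UNIV. B a2 a3)
        * (\<Sum>a4\<in>UNIV. \<Sum>a5\<in>UNIV. \<Sum>a6\<in>UNIV. C a4 a5 a6)
      = (\<Sum>a\<in>UNIV. A (a 0) (a 1) * B (a 2) (a 3) * C (a 4) (a 5) (a (6::7)))"
    for A B :: "7 \<Rightarrow> 7 \<Rightarrow> real" and C :: "7 \<Rightarrow> 7 \<Rightarrow> 7 \<Rightarrow> real"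
    unfolding nested_sum_7[symmetric, of "\<lambda>a0 a1 a2 a3 a4 a5 a6. A a0 a1 * B a2 a3 * C a4 a5 a6"]
    by (simp only: sum_distrib_left[symmetric] sum_distrib_right[symmetric])
  have "pull3 P \<phi> $ i $ p 0 $ p 1 * pull3 P \<phi> $ j $ p 2 $ p 3 * pull3 P \<phi> $ p 4 $ p 5 $ p 6
      = (\<Sum>x\<in>UNIV. \<Sum>y\<in>UNIV. P $ x $ i * P $ y $ j * (\<Sum>a\<in>UNIV. (\<Prod>k\<in>UNIV. P $ a k $ p k) * ?H x y a))" for p :: "7 \<Rightarrow> 7"
  proof -
    have "(\<Sum>x\<in>UNIV. a x * X x) * (\<Sum>y\<in>UNIV. b y * Y y) * Z
        = (\<Sum>x\<in>UNIV. \<Sum>y\<in>UNIV. a x * b y * (X x * Y y * Z))"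
      for a X b Y :: "7 \<Rightarrow> real" and Z
      by (subst sum_product) (simp add: sum_distrib_left sum_distrib_right mult_ac)
    then have "pull3 P \<phi> $ i $ p 0 $ p 1 * pull3 P \<phi> $ j $ p 2 $ p 3 * pull3 P \<phi> $ p 4 $ p 5 $ p 6
      = (\<Sum>x\<in>UNIV. \<Sum>y\<in>UNIV. P $ x $ i * P $ y $ j *
         ((\<Sum>k\<in>UNIV. \<Sum>l\<in>UNIV. P $ k $ p 0 * P $ l $ p 1 * \<phi> $ x $ k $ l)
         * (\<Sum>k\<in>UNIV. \<Sum>l\<in>UNIV. P $ k $ p 2 * P $ l $ p 3 * \<phi> $ y $ k $ l)
         * (\<Sum>k\<in>UNIV. \<Sum>l\<in>UNIV. \<Sum>m\<in>UNIV. P $ k $ p 4 * P $ l $ p 5 * P $ m $ p 6 * \<phi> $ k $ l $ m)))"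
      unfolding pair[of i "p 0" "p 1"] pair[of j "p 2" "p 3"] trip[of "p 4" "p 5" "p 6"] .
    then show ?thesis
      by (simp only: prods) (simp add: prod_7 mult_ac)
  qed
  then have "wedge_coeff (pull3 P \<phi>) i j = 1/24 * (\<Sum>p | p permutes (UNIV::7 set).
      of_int (sign p) * (\<Sum>x\<in>UNIV. \<Sum>y\<in>UNIV. P $ x $ i * P $ y $ j * (\<Sum>a\<in>UNIV. (\<Prod>k\<in>UNIV. P $ a k $ p k) * ?H x y a)))"
    by (simp only: wedge_coeff_def mult.assoc)
  also have "\<dots> = (\<Sum>p | p permutes (UNIV::7 set). \<Sum>x\<in>UNIV. \<Sum>y\<in>UNIV. 1/24 * (P $ x $ i * P $ y $ j) *
      (of_int (sign p) * (\<Sum>a\<in>UNIV. (\<Prod>k\<in>UNIV. P $ a k $ p k) * ?H x y a)))"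
    by (simp only: sum_distrib_left mult_ac)
  also have "\<dots> = (\<Sum>x\<in>UNIV. \<Sum>p | p permutes (UNIV::7 set). \<Sum>y\<in>UNIV. 1/24 * (P $ x $ i * P $ y $ j) *
      (of_int (sign p) * (\<Sum>a\<in>UNIV. (\<Prod>k\<in>UNIV. P $ a k $ p k) * ?H x y a)))"
    by (rule sum.swap)
  also have "\<dots> = (\<Sum>x\<in>UNIV. \<Sum>y\<in>UNIV. \<Sum>p | p permutes (UNIV::7 set). 1/24 * (P $ x $ i * P $ y $ j) *
      (of_int (sign p) * (\<Sum>a\<in>UNIV. (\<Prod>k\<in>UNIV. P $ a k $ p k) * ?H x y a)))"
    by (intro sum.cong refl sum.swap)
  also have "\<dots> = (\<Sum>x\<in>UNIV. \<Sum>y\<in>UNIV. 1/24 * (P $ x $ i * P $ y $ j) *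
      (det P * (\<Sum>p | p permutes (UNIV::7 set). of_int (sign p) * ?H x y p)))"
    unfolding sum_distrib_left[symmetric] alt_sum_transform ..
  also have "\<dots> = det P * (\<Sum>x\<in>UNIV. \<Sum>y\<in>UNIV. P $ x $ i * P $ y $ j * wedge_coeff \<phi> x y)"
    by (simp add: wedge_coeff_def sum_distrib_left mult_ac)
  finally show ?thesis .
qed

definition quad :: "real^7^7^7^7 \<Rightarrow> real^7 \<Rightarrow> real^7 \<Rightarrow> real^7 \<Rightarrow> real^7 \<Rightarrow> real" where
  "quad \<beta> u v w z = (\<Sum>i\<in>UNIV. \<Sum>j\<in>UNIV. \<Sum>k\<in>UNIV. \<Sum>l\<in>UNIV. \<beta>$i$j$k$l * (u$i * v$j * w$k * z$l))"

lemma raise3_pull3: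
  assumes "\<And>a i. matrix_inv g $ a $ i = (\<Sum>e\<in>UNIV. P $ a $ e * P $ i $ e)"
  shows "raise3 g \<alpha> $ x $ y $ z = (\<Sum>e\<in>UNIV. \<Sum>f\<in>UNIV. \<Sum>h\<in>UNIV. P $ x $ e * P $ y $ f * P $ z $ h * pull3 P \<alpha> $ e $ f $ h)"
proof -
  have "raise3 g \<alpha> $ x $ y $ z = (\<Sum>i\<in>UNIV. \<Sum>j\<in>UNIV. \<Sum>k\<in>UNIV.
      (\<Sum>e\<in>UNIV. P $ x $ e * P $ i $ e) * (\<Sum>f\<in>UNIV. P $ y $ f * P $ j $ f) * (\<Sum>h\<in>UNIV. P $ z $ h * P $ k $ h) * \<alpha> $ i $ j $ k)"
    by (simp add: raise3_def assms)
  also have "\<dots> = (\<Sum>i\<in>UNIV. \<Sum>j\<in>UNIV. \<Sum>k\<in>UNIV. \<Sum>e\<in>UNIV. \<Sum>f\<in>UNIV. \<Sum>h\<in>UNIV.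
      P $ x $ e * P $ i $ e * (P $ y $ f * P $ j $ f) * (P $ z $ h * P $ k $ h) * \<alpha> $ i $ j $ k)"
    by (simp only: sum_distrib_left[symmetric] sum_distrib_right[symmetric])
  also have "\<dots> = (\<Sum>e\<in>UNIV. \<Sum>f\<in>UNIV. \<Sum>h\<in>UNIV. \<Sum>i\<in>UNIV. \<Sum>j\<in>UNIV. \<Sum>k\<in>UNIV.
      P $ x $ e * P $ i $ e * (P $ y $ f * P $ j $ f) * (P $ z $ h * P $ k $ h) * \<alpha> $ i $ j $ k)"
    by (rule sum_swap_triples)
  also have "\<dots> = (\<Sum>e\<in>UNIV. \<Sum>f\<in>UNIV. \<Sum>h\<in>UNIV. P $ x $ e * P $ y $ f * P $ z $ h * pull3 P \<alpha> $ e $ f $ h)"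
    by (simp add: pull3_def sum_distrib_left mult_ac)
  finally show ?thesis .
qed

text \<open>The hypothesis says that the columns of \<open>P\<close> are orthonormal. The three raised indices of \<open>\<phi>\<close> each
  carry a factor \<open>P\<close> by \<open>raise3_pull3\<close> and the four arguments supply four more, so the sum over
  permutations becomes a determinant of seven columns of \<open>P\<close>.\<close>

lemma quad_psi_frame:
  assumes "\<And>a i. matrix_inv (metric \<phi>) $ a $ i = (\<Sum>e\<in>UNIV. P $ a $ e * P $ i $ e)"
  shows "quad (psi \<phi>) (column a P) (column b P) (column c P) (column d P)
    = vol_coeff \<phi> * det P / 6 * (\<Sum>e\<in>UNIV. \<Sum>f\<in>UNIV. \<Sum>h\<in>UNIV. pull3 P \<phi> $ e $ f $ h * eps (tup e f h a b c d))"
proof -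
  let ?S = "{p. p permutes (UNIV::7 set)}"
  let ?r = "\<lambda>p. raise3 (metric \<phi>) \<phi> $ p 0 $ p 1 $ p (2::7)"
  let ?m = "\<lambda>p. P $ p 3 $ a * P $ p 4 $ b * P $ p 5 $ c * P $ p (6::7) $ d"
  let ?g = "\<lambda>p. (p 3, p 4, p 5, p (6::7))"
  have "quad (psi \<phi>) (column a P) (column b P) (column c P) (column d P)
    = (\<Sum>t\<in>UNIV. \<Sum>p\<in>{p\<in>?S. ?g p = t}. vol_coeff \<phi> / 6 * (of_int (sign p) * ?r p * ?m p))"
    unfolding quad_def sum_quadruple
  proof (rule sum.cong[OF refl])
    fix t :: "7 \<times> 7 \<times> 7 \<times> 7"
    obtain i j k l where t: "t = (i, j, k, l)" by (cases t) auto
    have "psi \<phi> $ i $ j $ k $ l * (column a P $ i * column b P $ j * column c P $ k * column d P $ l)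
      = (\<Sum>p | p permutes (UNIV::7 set) \<and> p 3 = i \<and> p 4 = j \<and> p 5 = k \<and> p 6 = l.
          vol_coeff \<phi> / 6 * (of_int (sign p) * ?r p * (P $ i $ a * P $ j $ b * P $ k $ c * P $ l $ d)))"
      by (simp add: psi_def column_def sum_distrib_left sum_distrib_right mult_ac)
    also have "\<dots> = (\<Sum>p\<in>{p\<in>?S. ?g p = t}. vol_coeff \<phi> / 6 * (of_int (sign p) * ?r p * ?m p))"
      by (rule sum.cong) (auto simp: t)
    finally show "psi \<phi> $ fst t $ fst (snd t) $ fst (snd (snd t)) $ snd (snd (snd t)) * (column a P $ fst t * column b P $ fst (snd t) * column c P $ fst (snd (snd t)) * column d P $ snd (snd (snd t)))
      = (\<Sum>p\<in>{p\<in>?S. ?g p = t}. vol_coeff \<phi> / 6 * (of_int (sign p) * ?r p * ?m p))"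
      by (simp add: t)
  qed
  also have "\<dots> = (\<Sum>p\<in>?S. vol_coeff \<phi> / 6 * (of_int (sign p) * ?r p * ?m p))"
    by (rule sum.group) (auto simp: finite_permutations)
  also have "\<dots> = vol_coeff \<phi> / 6 * (\<Sum>p\<in>?S. \<Sum>e\<in>UNIV. \<Sum>f\<in>UNIV. \<Sum>h\<in>UNIV.
      pull3 P \<phi> $ e $ f $ h * (of_int (sign p) * (\<Prod>k\<in>UNIV. P $ p k $ tup e f h a b c d k)))"
    by (simp add: raise3_pull3[OF assms] sum_distrib_left sum_distrib_right prod_7 mult_ac)
  also have "\<dots> = vol_coeff \<phi> / 6 * (\<Sum>e\<in>UNIV. \<Sum>f\<in>UNIV. \<Sum>h\<in>UNIV. \<Sum>p\<in>?S.
      pull3 P \<phi> $ e $ f $ h * (of_int (sign p) * (\<Prod>k\<in>UNIV. P $ p k $ tup e f h a b c d k)))"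
    unfolding sum_triple by (subst sum.swap) (rule refl)
  also have "\<dots> = vol_coeff \<phi> / 6 * (\<Sum>e\<in>UNIV. \<Sum>f\<in>UNIV. \<Sum>h\<in>UNIV.
      pull3 P \<phi> $ e $ f $ h * (det P * eps (tup e f h a b c d)))"
  proof -
    have "(\<Sum>p\<in>?S. of_int (sign p) * (\<Prod>k\<in>UNIV. P $ p k $ t k)) = det P * eps t" for t
    proof -
      have "det (\<chi> i. transpose P $ t i) = eps t * det P"
        by (simp add: det_select_rows det_transpose)
      then show ?thesis
        by (simp add: det_def transpose_def mult.commute)
    qed
    then show ?thesis by (simp only: sum_distrib_left[symmetric])
  qed
  finally show ?thesis by (simp add: sum_distrib_left mult_ac)
qed

section \<open>The normal form of a nondegenerate 3-form\<close>

text \<open>The unknowns are the components of \<open>\<phi>\<close> in the frame of \<open>G2_normal_form\<close>: \<open>a\<close> is \<open>\<phi>\<^sub>0\<^sub>1\<^sub>2\<close>, the letters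
  \<open>p\<close>, \<open>q\<close>, \<open>r\<close> stand for a first index 0, 1, 2 and \<open>s\<close> for indices all at least 3. The equations
  state that the wedge coefficients are \<open>-6 V\<close> times the identity matrix. The sign conditions force
  \<open>V = 1\<close>, hence that certain factors are nonzero, and dividing by these makes the equations
  triangular: the vanishing components are eliminated one after the other, each step using the
  previous ones, and the seven diagonal equations fix the absolute values of the rest.\<close>

lemma normal_form_algebra:
  fixes a :: real
  assumes e00: "a * (p34 * p56) = - V"
    and e01: "a * (p56 * q34 - p46 * q35 + p34 * q56) = 0"
    and e02: "a * (p56 * r34 - p46 * r35 + p45 * r36 + p34 * r56) = 0"
    and e03: "a * (p34 * s356) = 0"
    and e04: "a * (p34 * s456 - p45 * s346 + p46 * s345) = 0"
    and e05: "a * (p56 * s345 - p45 * s356) = 0"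
    and e06: "a * (p56 * s346 - p46 * s356) = 0"
    and e11: "a * (q34 * q56 - q35 * q46) = - V"
    and e12: "a * (q56 * r34 - q46 * r35 + q45 * r36 - q35 * r46 + q34 * r56) = 0"
    and e22: "a * (r34 * r56 - r35 * r46 + r36 * r45) = - V"
    and e33: "p34 * q35 * r36 = V"
    and e34: "- p34 * q45 * r36 + p34 * q46 * r35 - p34 * q35 * r46 + p45 * q34 * r36 - p46 * q34 * r35 + p46 * q35 * r34 = 0"
    and e35: "- p34 * q35 * r56 + p34 * q56 * r35 - p56 * q34 * r35 + p45 * q35 * r36 + p56 * q35 * r34 = 0"
    and e36: "p34 * q56 * r36 - p56 * q34 * r36 + p46 * q35 * r36 = 0"
    and e45: "- p34 * q45 * r56 + p34 * q56 * r45 + p45 * q35 * r46 - p45 * q56 * r34 - p45 * q46 * r35 + p45 * q34 * r56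
        - p46 * q35 * r45 + p46 * q45 * r35 - p56 * q34 * r45 + p56 * q45 * r34 = 0"
    and e46: "- p34 * q46 * r56 + p34 * q56 * r46 - p45 * q46 * r36 - p46 * q56 * r34 + p46 * q45 * r36 + p46 * q34 * r56
        - p56 * q34 * r46 + p56 * q46 * r34 = 0"
    and e44: "- p34 * q45 * r46 + p34 * q46 * r45 + p45 * q34 * r46 - p45 * q46 * r34 - p46 * q34 * r45 + p46 * q45 * r34 = - V"
    and e55: "p45 * q35 * r56 - p45 * q56 * r35 - p56 * q35 * r45 + p56 * q45 * r35 = - V"
    and e56: "- p45 * q56 * r36 + p56 * q46 * r35 + p56 * q45 * r36 - p56 * q35 * r46 + p46 * q35 * r56 - p46 * q56 * r35 = 0"
    and e66: "- p46 * q56 * r36 + p56 * q46 * r36 = - V"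
    and V: "V\<^sup>2 = 1"
    and nonneg: "a \<ge> 0" "p34 \<ge> 0" "q35 \<ge> 0" "r36 \<ge> 0"
  shows "V = 1 \<and> a = 1 \<and> p34 = 1 \<and> q35 = 1 \<and> r36 = 1 \<and> p56 = -1 \<and> q46 = 1 \<and> r45 = -1 \<and>
    p45 = 0 \<and> p46 = 0 \<and> q34 = 0 \<and> q45 = 0 \<and> q56 = 0 \<and> r34 = 0 \<and> r35 = 0 \<and> r46 = 0 \<and> r56 = 0 \<and>
    s345 = 0 \<and> s346 = 0 \<and> s356 = 0 \<and> s456 = 0"
proof -
  have "V = 1 \<or> V = -1" using V by (simp add: power2_eq_1_iff)
  moreover have "V \<ge> 0" unfolding e33[symmetric] using nonneg by (intro mult_nonneg_nonneg)
  ultimately have V1: "V = 1" by auto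
  have nz: "a \<noteq> 0" "p34 \<noteq> 0" "p56 \<noteq> 0" "q35 \<noteq> 0" "r36 \<noteq> 0"
    using e00 e33 V1 by auto
  have s356: "s356 = 0" using e03 nz by simp
  have s345: "s345 = 0" using e05 nz s356 by simp
  have s346: "s346 = 0" using e06 nz s356 by simp
  have s456: "s456 = 0" using e04 nz s345 s346 by simp
  have "r36 * (p34 * q56 - p56 * q34 + p46 * q35) = 0" using e36 by algebra
  then have 36: "p34 * q56 - p56 * q34 + p46 * q35 = 0" using nz by simp
  have 01: "p56 * q34 - p46 * q35 + p34 * q56 = 0" using e01 nz by simp
  have "p34 * q56 = 0" using 01 36 by linarith
  then have q56: "q56 = 0" using nz by simp
  then have 01: "p56 * q34 = p46 * q35" using 01 by simp
  have q46: "q46 \<noteq> 0" using e66 q56 V1 by auto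
  have 02: "p56 * r34 - p46 * r35 + p45 * r36 + p34 * r56 = 0" using e02 nz by simp
  have "p34 * q35 * r56 = 0" using e35 02 01 q56 by algebra
  then have r56: "r56 = 0" using nz by simp
  have 12: "- q46 * r35 + q45 * r36 - q35 * r46 = 0" using e12 nz q56 r56 by simp
  have "p34 * q35 * r46 = 0" using e34 12 02 01 r56 by algebra
  then have r46: "r46 = 0" using nz by simp
  have "p56 * (q46 * r35 + q45 * r36) = 0" using e56 q56 r46 r56 by algebra
  then have "q46 * r35 + q45 * r36 = 0" using nz by simp
  then have "q45 * r36 = 0" "q46 * r35 = 0" using 12 r46 by simp_all
  then have q45: "q45 = 0" and r35: "r35 = 0" using nz q46 by simp_all
  have "q46 * (p56 * r34 - p45 * r36) = 0" using e46 r56 q56 q45 r46 by algebra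
  then have "p56 * r34 = p45 * r36" using q46 by simp
  then have "p45 * r36 = 0" "p56 * r34 = 0" using 02 r35 r56 by simp_all
  then have p45: "p45 = 0" and r34: "r34 = 0" using nz by simp_all
  have "a * (r36 * r45) = - V" using e22 r34 r35 by simp
  then have r45: "r45 \<noteq> 0" using V1 by auto
  have "r45 * (p46 * q35 + p56 * q34) = 0" using e45 q45 q56 p45 r56 r34 r35 by algebra
  then have "p46 * q35 + p56 * q34 = 0" using r45 by simp
  then have "p46 * q35 = 0" "p56 * q34 = 0" using 01 by simp_all
  then have p46: "p46 = 0" and q34: "q34 = 0" using nz by simp_all
  have f00: "a * p34 * p56 = - 1" and f11: "a * q35 * q46 = 1" and f22: "a * r36 * r45 = - 1"
    and f33: "p34 * q35 * r36 = 1" and f44: "p34 * q46 * r45 = - 1" and f55: "p56 * q35 * r45 = 1"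
    and f66: "p56 * q46 * r36 = - 1"
    using e00 e11 e22 e33 e44 e55 e66 q34 q45 q56 p45 p46 r34 r35 r46 r56 V1 by simp_all
  have "p34\<^sup>2 = a\<^sup>2"
  proof -
    have "(p34 * q35 * r36) * (p34 * q46 * r45) = - 1" "(a * q35 * q46) * (a * r36 * r45) = - 1"
      using f33 f44 f11 f22 by simp_all
    then have "(p34\<^sup>2 - a\<^sup>2) * (q35 * r36 * q46 * r45) = 0"
      by (simp add: power2_eq_square algebra_simps)
    then show ?thesis using nz q46 r45 by simp
  qed
  moreover have "q35\<^sup>2 = a\<^sup>2"
  proof -
    have "(p34 * q35 * r36) * (p56 * q35 * r45) = 1" "(a * p34 * p56) * (a * r36 * r45) = 1"
      using f33 f55 f00 f22 by simp_all
    then have "(q35\<^sup>2 - a\<^sup>2) * (p34 * r36 * p56 * r45) = 0"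
      by (simp add: power2_eq_square algebra_simps)
    then show ?thesis using nz q46 r45 by simp
  qed
  moreover have "r36\<^sup>2 = a\<^sup>2"
  proof -
    have "(p34 * q35 * r36) * (p56 * q46 * r36) = - 1" "(a * p34 * p56) * (a * q35 * q46) = - 1"
      using f33 f66 f00 f11 by simp_all
    then have "(r36\<^sup>2 - a\<^sup>2) * (p34 * q35 * p56 * q46) = 0"
      by (simp add: power2_eq_square algebra_simps)
    then show ?thesis using nz q46 r45 by simp
  qed
  ultimately have "p34 = a" "q35 = a" "r36 = a"
    using nonneg by (simp_all add: power2_eq_imp_eq)
  moreover from this have "a ^ 3 = 1 ^ 3" using f33 by (simp add: power3_eq_cube)
  then have "a = 1" by (rule power_eq_imp_eq_base) (use nonneg in auto)
  ultimately have 1: "a = 1" "p34 = 1" "q35 = 1" "r36 = 1" by simp_all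
  then have "p56 = -1" "q46 = 1" "r45 = -1"
    using f00 f11 f22 by simp_all
  then show ?thesis
    using V1 1 p45 p46 q34 q45 q56 r34 r35 r46 r56 s345 s346 s356 s456 by simp
qed

definition gip :: "real^7^7 \<Rightarrow> real^7 \<Rightarrow> real^7 \<Rightarrow> real" where
  "gip g u v = u \<bullet> (g *v v)"

definition tri :: "real^7^7^7 \<Rightarrow> real^7 \<Rightarrow> real^7 \<Rightarrow> real^7 \<Rightarrow> real" where
  "tri \<phi> u v w = (\<Sum>i\<in>UNIV. \<Sum>j\<in>UNIV. \<Sum>k\<in>UNIV. \<phi>$i$j$k * (u$i * v$j * w$k))"

definition alternating3 :: "real^7^7^7 \<Rightarrow> bool" where
  "alternating3 \<phi> \<longleftrightarrow> (\<forall>a b c. \<phi>$a$b$c = - \<phi>$b$a$c \<and> \<phi>$a$b$c = - \<phi>$a$c$b)"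

lemma gip_simps:
  "gip g (u + u') v = gip g u v + gip g u' v" "gip g u (v + v') = gip g u v + gip g u v'"
  "gip g (r *\<^sub>R u) v = r * gip g u v" "gip g u (r *\<^sub>R v) = r * gip g u v"
  by (simp_all add: gip_def inner_add_left inner_add_right matrix_vector_right_distrib
      matrix_vector_mult_scaleR)

lemma gip_commute: "transpose g = g \<Longrightarrow> gip g u v = gip g v u"
  unfolding gip_def using dot_lmul_matrix[of u g v] vector_transpose_matrix[of u g]
  by (simp add: inner_commute)

lemma tri_simps:
  "tri \<phi> (u + u') v w = tri \<phi> u v w + tri \<phi> u' v w" "tri \<phi> u (v + v') w = tri \<phi> u v w + tri \<phi> u v' w"
  "tri \<phi> u v (w + w') = tri \<phi> u v w + tri \<phi> u v w'"
  "tri \<phi> (r *\<^sub>R u) v w = r * tri \<phi> u v w" "tri \<phi> u (r *\<^sub>R v) w = r * tri \<phi> u v w"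
  "tri \<phi> u v (r *\<^sub>R w) = r * tri \<phi> u v w"
  by (simp_all add: tri_def sum.distrib sum_distrib_left algebra_simps)

lemma tri_minus:
  "tri \<phi> (- u) v w = - tri \<phi> u v w" "tri \<phi> u (- v) w = - tri \<phi> u v w" "tri \<phi> u v (- w) = - tri \<phi> u v w"
  using tri_simps(4)[of \<phi> "-1"] tri_simps(5)[of \<phi> _ "-1"] tri_simps(6)[of \<phi> _ _ "-1"] by simp_all

lemma tri_swap12:
  assumes "alternating3 \<phi>" shows "tri \<phi> u v w = - tri \<phi> v u w"
proof -
  have "tri \<phi> u v w = (\<Sum>j\<in>UNIV. \<Sum>i\<in>UNIV. \<Sum>k\<in>UNIV. \<phi>$i$j$k * (u$i * v$j * w$k))"
    unfolding tri_def by (rule sum.swap)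
  also have "\<dots> = (\<Sum>j\<in>UNIV. \<Sum>i\<in>UNIV. \<Sum>k\<in>UNIV. - (\<phi>$j$i$k * (v$j * u$i * w$k)))"
  proof (intro sum.cong refl)
    fix i j k
    have "\<phi>$i$j$k = - \<phi>$j$i$k" using assms unfolding alternating3_def by blast
    then show "\<phi>$i$j$k * (u$i * v$j * w$k) = - (\<phi>$j$i$k * (v$j * u$i * w$k))" by simp
  qed
  finally show ?thesis by (simp add: tri_def sum_negf)
qed

lemma tri_swap23:
  assumes "alternating3 \<phi>" shows "tri \<phi> u v w = - tri \<phi> u w v"
proof -
  have "tri \<phi> u v w = (\<Sum>i\<in>UNIV. \<Sum>k\<in>UNIV. \<Sum>j\<in>UNIV. \<phi>$i$j$k * (u$i * v$j * w$k))"
    unfolding tri_def by (rule sum.cong[OF refl], rule sum.swap)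
  also have "\<dots> = (\<Sum>i\<in>UNIV. \<Sum>k\<in>UNIV. \<Sum>j\<in>UNIV. - (\<phi>$i$k$j * (u$i * w$k * v$j)))"
  proof (intro sum.cong refl)
    fix i j k
    have "\<phi>$i$j$k = - \<phi>$i$k$j" using assms unfolding alternating3_def by blast
    then show "\<phi>$i$j$k * (u$i * v$j * w$k) = - (\<phi>$i$k$j * (u$i * w$k * v$j))" by simp
  qed
  finally show ?thesis by (simp add: tri_def sum_negf)
qed

lemma tri_sum_right: "tri \<phi> u v (sum f I) = (\<Sum>i\<in>I. tri \<phi> u v (f i))"
proof (induction I rule: infinite_finite_induct)
qed (simp_all add: tri_simps, simp_all add: tri_def)

lemma tri_inner: "tri \<phi> u v w = (\<chi> k. tri \<phi> u v (axis k 1)) \<bullet> w"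
proof -
  have "tri \<phi> u v w = tri \<phi> u v (\<Sum>k\<in>UNIV. w $ k *\<^sub>R axis k 1)"
    using basis_expansion[of w] by (simp add: scalar_mult_eq_scaleR)
  also have "\<dots> = (\<Sum>k\<in>UNIV. w $ k * tri \<phi> u v (axis k 1))"
    by (simp add: tri_sum_right tri_simps)
  finally show ?thesis by (simp add: inner_vec_def mult.commute)
qed

lemma pull3_tri: "pull3 P \<phi> $ i $ j $ k = tri \<phi> (column i P) (column j P) (column k P)"
  by (simp add: pull3_def tri_def column_def mult_ac)

lemma pull2_gip: "pull2 P g $ i $ j = gip g (column i P) (column j P)"
  by (simp add: pull2_def gip_def column_def inner_vec_def matrix_vector_mult_def sum_distrib_left mult_ac)

lemma pull2_matrix: "pull2 P g = transpose P ** g ** P"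
proof -
  have "(\<Sum>a\<in>UNIV. \<Sum>b\<in>UNIV. P$a$i * P$b$j * g$a$b)
      = (\<Sum>b\<in>UNIV. (\<Sum>a\<in>UNIV. P$a$i * g$a$b) * P$b$j)" for i j
    by (subst sum.swap) (simp add: sum_distrib_left sum_distrib_right mult_ac)
  then show ?thesis
    unfolding vec_eq_iff pull2_def matrix_matrix_mult_def transpose_def
    by simp
qed

lemma wedge_coeff_expand:
  assumes alt: "alternating3 \<psi>"
  shows "wedge_coeff \<psi> i j = pair_pair_triple (\<lambda>x y. \<psi>$i$x$y) (\<lambda>x y. \<psi>$j$x$y) (\<lambda>x y z. \<psi>$x$y$z)"
proof -
  have swap1: "\<psi>$x$y$z = - \<psi>$y$x$z" and swap2: "\<psi>$x$y$z = - \<psi>$x$z$y" for x y z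
    using alt unfolding alternating3_def by blast+
  have "wedge_coeff \<psi> i j = 1/24 * alt_sum UNIV
      (\<lambda>\<nu>. \<psi>$i$(\<nu> 0)$(\<nu> 1) * \<psi>$j$(\<nu> 2)$(\<nu> 3) * \<psi>$(\<nu> 4)$(\<nu> 5)$(\<nu> 6)) id"
    by (simp add: wedge_coeff_def alt_sum_def mult.assoc)
  also have "\<dots> = pair_pair_triple (\<lambda>x y. \<psi>$i$x$y) (\<lambda>x y. \<psi>$j$x$y) (\<lambda>x y z. \<psi>$x$y$z)"
    using alt_sum_pair_pair_triple[where A="\<lambda>x y. \<psi>$i$x$y" and B="\<lambda>x y. \<psi>$j$x$y"
        and C="\<lambda>x y z. \<psi>$x$y$z", OF swap2 swap2 swap1 swap2]
    by simp
  finally show ?thesis .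
qed

text \<open>Frames are built one vector at a time. The list \<open>ws\<close> collects the linear conditions on the next
  vector, both orthogonality and the vanishing of chosen components of \<open>\<phi>\<close>, and \<open>l\<close> is a component
  whose sign is prescribed.\<close>

lemma unit_vector_orthogonal:
  fixes g :: "real^7^7"
  assumes pos: "\<And>X. X \<noteq> 0 \<Longrightarrow> gip g X X > 0" and len: "length ws < 7"
  shows "\<exists>x. gip g x x = 1 \<and> (\<forall>w\<in>set ws. w \<bullet> x = 0) \<and> l \<bullet> x \<ge> 0"
proof -
  have "dim (set ws) < DIM(real^7)"
    using dim_le_card'[of "set ws"] card_length[of ws] len by simp
  then obtain y where y: "y \<noteq> 0" "\<And>z. z \<in> span (set ws) \<Longrightarrow> orthogonal y z"
    by (rule orthogonal_to_subspace_exists) auto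
  define x where "x = (1 / sqrt (gip g y y)) *\<^sub>R y"
  have "gip g y y > 0" using pos y by simp
  then have 1: "gip g x x = 1"
    by (simp add: x_def gip_simps real_sqrt_mult[symmetric] divide_simps)
  have 2: "w \<bullet> x = 0" if "w \<in> set ws" for w
    using y(2)[OF span_base[OF that]] by (simp add: x_def orthogonal_def inner_commute)
  show ?thesis
  proof (cases "l \<bullet> x \<ge> 0")
    case True
    with 1 2 show ?thesis by blast
  next
    case False
    have "gip g (- x) (- x) = gip g x x"
      using gip_simps(3)[of g "-1" x] gip_simps(4)[of g _ "-1" x] by simp
    with 1 2 False show ?thesis by (intro exI[of _ "- x"]) auto
  qed
qed

lemma compact_unit_sphere:
  fixes g :: "real^7^7"
  assumes pos: "\<And>X. X \<noteq> 0 \<Longrightarrow> gip g X X > 0"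
  shows "compact {x. gip g x x = 1}"
proof -
  have cont: "continuous_on A (\<lambda>x. gip g x x)" for A
    unfolding gip_def
    by (intro continuous_intros bounded_linear.continuous_on[OF matrix_vector_mul_bounded_linear])
  have "axis 0 1 \<in> sphere (0::real^7) 1" by (simp add: norm_axis_1)
  then obtain m where m: "m \<in> sphere (0::real^7) 1" "\<And>x. x \<in> sphere 0 1 \<Longrightarrow> gip g m m \<le> gip g x x"
    using continuous_attains_inf[OF compact_sphere _ cont, of "0::real^7" 1] by blast
  define c where "c = gip g m m"
  have c: "c > 0" unfolding c_def using m by (intro pos) auto
  have bound: "norm x \<le> 1 / c + 1" if "gip g x x = 1" for x
  proof -
    have "x \<noteq> 0" using that by (auto simp: gip_def)
    then have "c \<le> gip g ((1 / norm x) *\<^sub>R x) ((1 / norm x) *\<^sub>R x)"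
      unfolding c_def by (intro m) simp
    also have "\<dots> = 1 / (norm x)\<^sup>2"
      using that by (simp add: gip_simps power2_eq_square)
    finally have "(norm x)\<^sup>2 \<le> 1 / c"
      using c \<open>x \<noteq> 0\<close> by (simp add: field_simps)
    moreover have "2 * norm x \<le> (norm x)\<^sup>2 + 1"
      using sum_squares_bound[of "norm x" 1] by simp
    ultimately show ?thesis using norm_ge_zero[of x] by linarith
  qed
  have "closed {x. gip g x x = 1}"
    by (intro closed_Collect_eq cont continuous_intros)
  moreover have "bounded {x. gip g x x = 1}"
    using bound by (auto simp: bounded_iff)
  ultimately show ?thesis by (simp add: compact_eq_bounded_closed)
qed

lemma maximal_triple:
  fixes g :: "real^7^7"
  assumes pos: "\<And>X. X \<noteq> 0 \<Longrightarrow> gip g X X > 0"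
  obtains u v w where "gip g u u = 1" "gip g v v = 1" "gip g w w = 1"
    "\<And>x y z. gip g x x = 1 \<Longrightarrow> gip g y y = 1 \<Longrightarrow> gip g z z = 1 \<Longrightarrow> tri \<phi> x y z \<le> tri \<phi> u v w"
proof -
  let ?S = "{x. gip g x x = 1}"
  have "?S \<noteq> {}" using unit_vector_orthogonal[OF pos, where ws="[]" and l=0] by fastforce
  moreover have "compact (?S \<times> ?S \<times> ?S)"
    by (intro compact_Times compact_unit_sphere pos)
  moreover have "continuous_on (?S \<times> ?S \<times> ?S) (\<lambda>p. tri \<phi> (fst p) (fst (snd p)) (snd (snd p)))"
    unfolding tri_def by (intro continuous_intros)
  ultimately obtain p where "p \<in> ?S \<times> ?S \<times> ?S"
      "\<And>q. q \<in> ?S \<times> ?S \<times> ?S \<Longrightarrow> tri \<phi> (fst q) (fst (snd q)) (snd (snd q)) \<le> tri \<phi> (fst p) (fst (snd p)) (snd (snd p))"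
    using continuous_attains_sup[of "?S \<times> ?S \<times> ?S" "\<lambda>p. tri \<phi> (fst p) (fst (snd p)) (snd (snd p))"] by auto
  then show ?thesis
    by (intro that[of "fst p" "fst (snd p)" "snd (snd p)"]) (auto simp: mem_Times_iff dest: spec)
qed

text \<open>The first-order condition at a maximum on the unit sphere. If \<open>f z > 0\<close> for some \<open>z\<close> orthogonal to
  \<open>e\<close>, then the normalisation of \<open>e + t z\<close> has a larger value for small \<open>t > 0\<close>; so \<open>f\<close> vanishes on the
  orthogonal complement of \<open>e\<close>.\<close>

lemma maximal_functional:
  fixes g :: "real^7^7" and f :: "real^7 \<Rightarrow> real"
  assumes pos: "\<And>X. X \<noteq> 0 \<Longrightarrow> gip g X X > 0" and sym: "transpose g = g"
    and f: "\<And>x y. f (x + y) = f x + f y" "\<And>r x. f (r *\<^sub>R x) = r * f x"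
    and max: "\<And>x. gip g x x = 1 \<Longrightarrow> f x \<le> a" and e: "gip g e e = 1" "f e = a" and a: "a > 0"
  shows "f x = a * gip g e x"
proof -
  have orth: "f z \<le> 0" if "gip g e z = 0" for z
  proof (rule ccontr)
    assume "\<not> f z \<le> 0"
    then have F: "f z > 0" by simp
    define q where "q = gip g z z"
    have q: "q \<ge> 0" using pos[of z] by (cases "z = 0") (auto simp: q_def gip_def less_imp_le)
    have ineq: "(a + t * f z)\<^sup>2 \<le> a\<^sup>2 * (1 + t\<^sup>2 * q)" if "t > 0" for t
    proof -
      define y where "y = e + t *\<^sub>R z"
      define N where "N = gip g y y"
      have N: "N = 1 + t\<^sup>2 * q"
        unfolding N_def y_def q_def gip_simps using \<open>gip g e z = 0\<close> gip_commute[OF sym, of z e] e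
        by (simp add: power2_eq_square)
      then have "N > 0" using q by (simp add: add_pos_nonneg)
      then have "gip g ((1 / sqrt N) *\<^sub>R y) ((1 / sqrt N) *\<^sub>R y) = 1"
        unfolding gip_simps N_def[symmetric] by (simp add: real_sqrt_mult[symmetric] divide_simps)
      then have "f ((1 / sqrt N) *\<^sub>R y) \<le> a" by (rule max)
      then have "a + t * f z \<le> a * sqrt N"
        using \<open>N > 0\<close> by (simp add: f y_def e field_simps)
      moreover have "0 \<le> a + t * f z" using a F that by simp
      ultimately have "(a + t * f z)\<^sup>2 \<le> (a * sqrt N)\<^sup>2" by (intro power_mono)
      then show ?thesis using \<open>N > 0\<close> by (simp add: power_mult_distrib N)
    qed
    (* Small enough for the linear gain t f(z) to exceed the quadratic loss from normalisation. *)
    define t where "t = f z / (a * (q + 1))"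
    have t: "t > 0" using F a q by (simp add: t_def add_nonneg_pos)
    have "2 * a * t * f z + t\<^sup>2 * (f z)\<^sup>2 \<le> a\<^sup>2 * t\<^sup>2 * q"
      using ineq[OF t] by (simp add: power2_eq_square algebra_simps)
    then have "2 * a * t * f z \<le> a\<^sup>2 * t\<^sup>2 * q"
      by (smt (verit) zero_le_mult_iff zero_le_power2)
    then have "t * (2 * a * f z) \<le> t * (a\<^sup>2 * t * q)" by (simp add: power2_eq_square mult_ac)
    then have "2 * a * f z \<le> a\<^sup>2 * t * q" using t by simp
    also have "\<dots> = a * f z * (q / (q + 1))" using a q by (simp add: t_def power2_eq_square)
    also have "\<dots> \<le> a * f z * 1" using a F q by (intro mult_left_mono) (auto simp: divide_simps)
    finally show False using a F by simp
  qed
  define z where "z = x - gip g e x *\<^sub>R e"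
  have z1: "gip g e z = 0"
    using gip_simps(2)[of g e z "gip g e x *\<^sub>R e"] e by (simp add: z_def gip_simps(4))
  have z2: "gip g e ((-1) *\<^sub>R z) = 0"
    unfolding gip_simps(4) z1 by simp
  have "f z = 0" using orth[OF z1] orth[OF z2] unfolding f(2) by simp
  moreover have "f x = f z + gip g e x * f e"
    using f(1)[of z "gip g e x *\<^sub>R e"] f(2)[of "gip g e x" e] by (simp add: z_def)
  ultimately show ?thesis using e by simp
qed

text \<open>The components of the 3-form \<open>dx\<^sup>a \<and> dx\<^sup>b \<and> dx\<^sup>c\<close>.\<close>

definition alt3 :: "7 \<Rightarrow> 7 \<Rightarrow> 7 \<Rightarrow> 7 \<Rightarrow> 7 \<Rightarrow> 7 \<Rightarrow> real" where
  "alt3 a b c i j k =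
    of_bool (a = i) * (of_bool (b = j) * of_bool (c = k) - of_bool (b = k) * of_bool (c = j))
    - of_bool (a = j) * (of_bool (b = i) * of_bool (c = k) - of_bool (b = k) * of_bool (c = i))
    + of_bool (a = k) * (of_bool (b = i) * of_bool (c = j) - of_bool (b = j) * of_bool (c = i))"

definition phi_std :: "real^7^7^7" where
  "phi_std = (\<chi> i j k. alt3 0 1 2 i j k + alt3 0 3 4 i j k - alt3 0 5 6 i j k + alt3 1 3 5 i j k
     + alt3 1 4 6 i j k + alt3 2 3 6 i j k - alt3 2 4 5 i j k)"

lemma alternating_zeroI3:
  fixes d :: "7 \<Rightarrow> 7 \<Rightarrow> 7 \<Rightarrow> real"
  assumes swap: "\<And>i j k. d i j k = - d j i k" "\<And>i j k. d i j k = - d i k j"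
    and inc: "\<And>i j k. i < j \<Longrightarrow> j < k \<Longrightarrow> d i j k = 0"
  shows "d i j k = 0"
proof -
  have eq: "d i i k = 0" "d i k k = 0" for i k
    using swap(1)[of i i k] swap(2)[of i k k] by simp_all
  have less: "d i j k = 0" if "i < j" for i j k
  proof (cases j k rule: linorder_cases)
    case less then show ?thesis using inc that by simp
  next
    case equal then show ?thesis using eq by simp
  next
    case greater
    have "d i k j = 0"
    proof (cases i k rule: linorder_cases)
      case less then show ?thesis using inc greater by simp
    next
      case equal then show ?thesis using eq by simp
    next
      case 3: greater
      then show ?thesis using inc[OF 3 that] swap(1)[of i k j] by simp
    qed
    then show ?thesis using swap(2)[of i j k] by simp
  qed
  show ?thesis
  proof (cases i j rule: linorder_cases)
    case greater
    then show ?thesis using less[OF greater] swap(1)[of i j k] by simp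
  qed (use less eq in auto)
qed

lemma alternating_zeroI4:
  fixes d :: "7 \<Rightarrow> 7 \<Rightarrow> 7 \<Rightarrow> 7 \<Rightarrow> real"
  assumes swap: "\<And>i j k l. d i j k l = - d j i k l" "\<And>i j k l. d i j k l = - d i k j l"
      "\<And>i j k l. d i j k l = - d i j l k"
    and inc: "\<And>i j k l. i < j \<Longrightarrow> j < k \<Longrightarrow> k < l \<Longrightarrow> d i j k l = 0"
  shows "d i j k l = 0"
proof (rule alternating_zeroI3[where d="\<lambda>i j k. d i j k l"])
  fix i j k :: 7
  assume ij: "i < j" and jk: "j < k"
  have eq: "d i i k l = 0" "d i k k l = 0" "d i j k k = 0" for i j k l
    using swap(1)[of i i k l] swap(2)[of i k k l] swap(3)[of i j k k] by simp_all
  show "d i j k l = 0"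
  proof (cases k l rule: linorder_cases)
    case less then show ?thesis using inc ij jk by simp
  next
    case equal then show ?thesis using eq by simp
  next
    case lk: greater
    have "d i j l k = 0"
    proof (cases j l rule: linorder_cases)
      case less then show ?thesis using inc ij lk by simp
    next
      case equal then show ?thesis using eq by simp
    next
      case lj: greater
      have "d i l j k = 0"
      proof (cases i l rule: linorder_cases)
        case less then show ?thesis using inc lj jk by simp
      next
        case equal then show ?thesis using eq by simp
      next
        case li: greater
        then show ?thesis using inc[OF li ij jk] swap(1)[of i l j k] by simp
      qed
      then show ?thesis using swap(2)[of i j l k] by simp
    qed
    then show ?thesis using swap(3)[of i j k l] by simp
  qed
qed (fact swap)+

lemma alternating3_eqI:
  assumes "alternating3 \<alpha>" "alternating3 \<beta>"
    and "\<And>i j k. i < j \<Longrightarrow> j < k \<Longrightarrow> \<alpha>$i$j$k = \<beta>$i$j$k"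
  shows "\<alpha> = \<beta>"
proof -
  have sw: "\<alpha>$i$j$k = - \<alpha>$j$i$k" "\<beta>$i$j$k = - \<beta>$j$i$k" "\<alpha>$i$j$k = - \<alpha>$i$k$j" "\<beta>$i$j$k = - \<beta>$i$k$j" for i j k
    using assms(1,2) unfolding alternating3_def by blast+
  have "\<alpha>$i$j$k - \<beta>$i$j$k = 0" for i j k
  proof (rule alternating_zeroI3[where d="\<lambda>i j k. \<alpha>$i$j$k - \<beta>$i$j$k"])
    show "\<alpha>$i$j$k - \<beta>$i$j$k = - (\<alpha>$j$i$k - \<beta>$j$i$k)" for i j k using sw(1,2)[of i j k] by simp
    show "\<alpha>$i$j$k - \<beta>$i$j$k = - (\<alpha>$i$k$j - \<beta>$i$k$j)" for i j k using sw(3,4)[of i j k] by simp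
  qed (use assms(3) in auto)
  then show ?thesis by (simp add: vec_eq_iff)
qed

lemma alt3_swap:
  "alt3 a b c i j k = - alt3 a b c j i k" "alt3 a b c i j k = - alt3 a b c i k j"
  unfolding alt3_def by (simp_all only: algebra_simps)

lemma alternating3_phi_std: "alternating3 phi_std"
  unfolding alternating3_def
proof (intro allI conjI)
  fix i j k :: 7
  show "phi_std$i$j$k = - phi_std$j$i$k"
    unfolding phi_std_def
    using alt3_swap(1)[of 0 1 2 i j k] alt3_swap(1)[of 0 3 4 i j k] alt3_swap(1)[of 0 5 6 i j k]
      alt3_swap(1)[of 1 3 5 i j k] alt3_swap(1)[of 1 4 6 i j k] alt3_swap(1)[of 2 3 6 i j k]
      alt3_swap(1)[of 2 4 5 i j k] by simp
  show "phi_std$i$j$k = - phi_std$i$k$j"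
    unfolding phi_std_def
    using alt3_swap(2)[of 0 1 2 i j k] alt3_swap(2)[of 0 3 4 i j k] alt3_swap(2)[of 0 5 6 i j k]
      alt3_swap(2)[of 1 3 5 i j k] alt3_swap(2)[of 1 4 6 i j k] alt3_swap(2)[of 2 3 6 i j k]
      alt3_swap(2)[of 2 4 5 i j k] by simp
qed

lemma sum_axis: "(\<Sum>c\<in>UNIV. f c * axis k (1::real) $ c) = f (k :: 'n::finite)"
proof -
  have "f c * axis k (1::real) $ c = (if c = k then f c else 0)" for c
    by (simp add: axis_def)
  then show ?thesis by simp
qed

lemma tri_axis: "tri \<phi> (axis i 1) (axis j 1) (axis k 1) = \<phi>$i$j$k"
  unfolding tri_def mult.assoc[symmetric] sum_axis ..

lemma metric_vol_nonzero:
  assumes "metric_vol_of \<phi> g v"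
  shows "v \<noteq> 0"
proof
  assume "v = 0"
  then have "det g = 0" using assms by (simp add: metric_vol_of_def)
  then have "\<not> invertible g" by (simp add: invertible_det_nz)
  then obtain x where "x \<noteq> 0" "g *v x = 0"
    using matrix_left_invertible_ker[of g] invertible_left_inverse[of g] by auto
  then show False using assms unfolding metric_vol_of_def by force
qed

text \<open>Let \<open>e\<^sub>0, e\<^sub>1, e\<^sub>2\<close> maximise \<open>\<phi>\<close> over triples of unit vectors. By the first-order conditions they are
  orthonormal and every component of \<open>\<phi>\<close> with exactly two indices among \<open>0, 1, 2\<close> vanishes. The next
  vector \<open>e\<^sub>3\<close> is any unit vector orthogonal to them. Then \<open>e\<^sub>6\<close>, \<open>e\<^sub>5\<close> and \<open>e\<^sub>4\<close> are chosen in this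
  order, with \<open>\<phi>\<^sub>0\<^sub>3\<^sub>6 = \<phi>\<^sub>1\<^sub>3\<^sub>6 = \<phi>\<^sub>0\<^sub>3\<^sub>5 = 0\<close> and \<open>\<phi>\<^sub>2\<^sub>3\<^sub>6, \<phi>\<^sub>1\<^sub>3\<^sub>5, \<phi>\<^sub>0\<^sub>3\<^sub>4 \<ge> 0\<close>. These are as many linear
  conditions as the dimension leaves room for, and they leave the equations of
  \<open>normal_form_algebra\<close> with a single solution.\<close>

theorem G2_normal_form:
  assumes mv: "metric_vol_of \<phi> g v" and alt: "alternating3 \<phi>"
  obtains P where "\<And>i j. gip g (column i P) (column j P) = (if i = j then 1 else 0)"
    "v * det P = 1" "pull3 P \<phi> = phi_std"
proof -
  have sym: "transpose g = g" and pos: "\<And>X. X \<noteq> 0 \<Longrightarrow> gip g X X > 0"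
    and vol: "v\<^sup>2 = det g" and wedge: "\<And>i j. wedge_coeff \<phi> i j = - 6 * g$i$j * v"
    using mv by (auto simp: metric_vol_of_def gip_def)
  have com: "gip g x y = gip g y x" for x y by (rule gip_commute[OF sym])
  have dual: "(g *v u) \<bullet> x = gip g u x" for u x
    using com[of u x] by (simp add: gip_def inner_commute)
  obtain e0 e1 e2 where unit: "gip g e0 e0 = 1" "gip g e1 e1 = 1" "gip g e2 e2 = 1"
    and max: "\<And>x y z. gip g x x = 1 \<Longrightarrow> gip g y y = 1 \<Longrightarrow> gip g z z = 1 \<Longrightarrow> tri \<phi> x y z \<le> tri \<phi> e0 e1 e2"
    using maximal_triple[OF pos, of \<phi>] by metis
  define a where "a = tri \<phi> e0 e1 e2"
  have a: "a > 0"
  proof (rule ccontr)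
    assume "\<not> a > 0"
    then have le: "tri \<phi> x y z \<le> 0" if "gip g x x = 1" "gip g y y = 1" "gip g z z = 1" for x y z
      using max[OF that] by (simp add: a_def)
    have nonpos: "tri \<phi> x y z \<le> 0" for x y z
    proof (cases "x = 0 \<or> y = 0 \<or> z = 0")
      case True
      then show ?thesis by (auto simp: tri_def)
    next
      case False
      define n where "n u = sqrt (gip g u u)" for u
      have n: "n u > 0" "gip g ((1 / n u) *\<^sub>R u) ((1 / n u) *\<^sub>R u) = 1" if "u \<noteq> 0" for u
        using pos[OF that] by (simp_all add: n_def gip_simps real_sqrt_mult[symmetric] divide_simps)
      have "tri \<phi> ((1 / n x) *\<^sub>R x) ((1 / n y) *\<^sub>R y) ((1 / n z) *\<^sub>R z) \<le> 0"
        using False by (intro le n) auto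
      moreover have "n x * n y * n z > 0"
        using n(1)[of x] n(1)[of y] n(1)[of z] False by simp
      ultimately show ?thesis
        by (simp add: tri_simps divide_le_0_iff mult_ac)
    qed
    have zero: "tri \<phi> x y z = 0" for x y z
      using nonpos[of x y z] nonpos[of "- x" y z] by (simp add: tri_minus)
    have "\<phi>$i$j$k = 0" for i j k using zero tri_axis[of \<phi> i j k] by simp
    then have "wedge_coeff \<phi> i j = 0" for i j by (simp add: wedge_coeff_def)
    then have "g$i$j = 0" for i j using wedge[of i j] metric_vol_nonzero[OF mv] by simp
    then have "gip g e0 e0 = 0" by (simp add: gip_def matrix_vector_mult_def inner_vec_def)
    then show False using unit by simp
  qed
  have t2: "tri \<phi> e0 e1 x = a * gip g e2 x" for x
    by (rule maximal_functional[OF pos sym]) (use unit max a in \<open>auto simp: tri_simps a_def\<close>)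
  have t1: "tri \<phi> e0 x e2 = a * gip g e1 x" for x
    by (rule maximal_functional[OF pos sym, where f="\<lambda>x. tri \<phi> e0 x e2"]) (use unit max a in \<open>auto simp: tri_simps a_def\<close>)
  have t0: "tri \<phi> x e1 e2 = a * gip g e0 x" for x
    by (rule maximal_functional[OF pos sym, where f="\<lambda>x. tri \<phi> x e1 e2"]) (use unit max a in \<open>auto simp: tri_simps a_def\<close>)
  have diag: "tri \<phi> x x y = 0" "tri \<phi> y x x = 0" "tri \<phi> x y x = 0" for x y
    using tri_swap12[OF alt, of x x y] tri_swap23[OF alt, of y x x] tri_swap12[OF alt, of x y x] by simp_all
  have o3: "gip g e0 e1 = 0" "gip g e0 e2 = 0" "gip g e1 e2 = 0"
    using t0[of e1] t0[of e2] t1[of e2] a diag by simp_all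
  (* The linear functionals x -> \<phi>(u, v, x), as vectors for the standard inner product. *)
  define D where "D u v = (\<chi> k. tri \<phi> u v (axis k 1))" for u v
  have D: "D u v \<bullet> x = tri \<phi> u v x" for u v x
    unfolding D_def by (rule tri_inner[symmetric])
  obtain e3 where e3: "gip g e3 e3 = 1" "gip g e0 e3 = 0" "gip g e1 e3 = 0" "gip g e2 e3 = 0"
    using unit_vector_orthogonal[OF pos, where ws="[g *v e0, g *v e1, g *v e2]" and l=0] by (auto simp: dual)
  obtain e6 where e6: "gip g e6 e6 = 1" "gip g e0 e6 = 0" "gip g e1 e6 = 0" "gip g e2 e6 = 0" "gip g e3 e6 = 0"
      "tri \<phi> e0 e3 e6 = 0" "tri \<phi> e1 e3 e6 = 0" "tri \<phi> e2 e3 e6 \<ge> 0"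
    using unit_vector_orthogonal[OF pos, where ws="[g *v e0, g *v e1, g *v e2, g *v e3, D e0 e3, D e1 e3]"
        and l="D e2 e3"] by (auto simp: dual D)
  obtain e5 where e5: "gip g e5 e5 = 1" "gip g e0 e5 = 0" "gip g e1 e5 = 0" "gip g e2 e5 = 0" "gip g e3 e5 = 0"
      "gip g e5 e6 = 0" "tri \<phi> e0 e3 e5 = 0" "tri \<phi> e1 e3 e5 \<ge> 0"
    using unit_vector_orthogonal[OF pos, where ws="[g *v e0, g *v e1, g *v e2, g *v e3, g *v e6, D e0 e3]"
        and l="D e1 e3"] com[of _ e6] by (auto simp: dual D)
  obtain e4 where e4: "gip g e4 e4 = 1" "gip g e0 e4 = 0" "gip g e1 e4 = 0" "gip g e2 e4 = 0" "gip g e3 e4 = 0"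
      "gip g e4 e5 = 0" "gip g e4 e6 = 0" "tri \<phi> e0 e3 e4 \<ge> 0"
    using unit_vector_orthogonal[OF pos, where ws="[g *v e0, g *v e1, g *v e2, g *v e3, g *v e5, g *v e6]"
        and l="D e0 e3"] com[of _ e5] com[of _ e6] by (auto simp: dual D)
  define E where "E = tup e0 e1 e2 e3 e4 e5 e6"
  define P :: "real^7^7" where "P = (\<chi> i j. E j $ i)"
  have col: "column j P = E j" for j by (simp add: P_def column_def)
  have orth: "gip g (E i) (E j) = (if i = j then 1 else 0)" for i j
  proof -
    have "\<forall>i j. gip g (E i) (E j) = (if i = j then 1 else 0)"
      unfolding all7 E_def
      by (simp add: unit o3 e3 e4 e5 e6 com[of e1 e0] com[of e2 e0] com[of e3 e0] com[of e4 e0] com[of e5 e0] com[of e6 e0]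
        com[of e2 e1] com[of e3 e1] com[of e4 e1] com[of e5 e1] com[of e6 e1] com[of e3 e2] com[of e4 e2] com[of e5 e2] com[of e6 e2]
        com[of e4 e3] com[of e5 e3] com[of e6 e3] com[of e5 e4] com[of e6 e4] com[of e6 e5])
    then show ?thesis by blast
  qed
  let ?\<psi> = "pull3 P \<phi>"
  let ?F = "\<lambda>i j k. pull3 P \<phi> $ i $ j $ k"
  define V where "V = v * det P"
  have id: "pull2 P g = mat 1"
    by (simp add: vec_eq_iff pull2_gip col orth mat_def)
  have "det (pull2 P g) = (det P)\<^sup>2 * det g"
    by (simp add: pull2_matrix det_mul det_transpose power2_eq_square)
  then have V2: "V\<^sup>2 = 1"
    by (simp add: id V_def power_mult_distrib vol mult.commute)
  have wedge': "wedge_coeff ?\<psi> i j = (if i = j then - 6 * V else 0)" for i j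
  proof -
    have "wedge_coeff ?\<psi> i j = - 6 * V * pull2 P g $ i $ j"
      by (simp add: wedge_coeff_pull3 wedge V_def pull2_def sum_distrib_left mult_ac)
    then show ?thesis by (simp add: id mat_def)
  qed
  have F: "?F i j k = tri \<phi> (E i) (E j) (E k)" for i j k
    by (simp add: pull3_tri col)
  have F1: "?F i j k = - ?F j i k" and F2: "?F i j k = - ?F i k j" for i j k
    unfolding F by (rule tri_swap12[OF alt], rule tri_swap23[OF alt])
  have alt': "alternating3 ?\<psi>"
    unfolding alternating3_def using F1 F2 by blast
  have sort: "j < i \<Longrightarrow> ?F i j k = - ?F j i k" "k < j \<Longrightarrow> ?F i j k = - ?F i k j"
    "?F i i k = 0" "?F i k k = 0" for i j k
    by (rule F1, rule F2) (simp_all add: F diag)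
  have c02: "tri \<phi> e0 e2 x = - (a * gip g e1 x)" for x
    using tri_swap23[OF alt, of e0 e2 x] t1[of x] by simp
  have c12: "tri \<phi> e1 e2 x = a * gip g e0 x" for x
    using tri_swap23[OF alt, of e1 e2 x] tri_swap12[OF alt, of e1 x e2] t0[of x] by simp
  have vals: "?F 0 1 2 = a" "?F 0 1 3 = 0" "?F 0 1 4 = 0" "?F 0 1 5 = 0" "?F 0 1 6 = 0"
    "?F 0 2 3 = 0" "?F 0 2 4 = 0" "?F 0 2 5 = 0" "?F 0 2 6 = 0"
    "?F 1 2 3 = 0" "?F 1 2 4 = 0" "?F 1 2 5 = 0" "?F 1 2 6 = 0" "?F 0 3 5 = 0" "?F 0 3 6 = 0" "?F 1 3 6 = 0"
    unfolding F E_def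
    by (simp_all add: t2 c02 c12 e3 e4 e5 e6 unit)
  note formula = wedge_coeff_expand[OF alt']
  have "wedge_coeff ?\<psi> 0 0 = 6 * (a * (?F 0 3 4 * ?F 0 5 6))" (is "_ = _ * ?w00")
    by (simp add: formula pair_pair_triple_def pair_triple_def less_7 sort vals) (simp add: algebra_simps)?
  then have e00: "?w00 = - V"
    using wedge'[of 0 0] by simp
  have "wedge_coeff ?\<psi> 0 1 = 3 * (a * (?F 0 5 6 * ?F 1 3 4 - ?F 0 4 6 * ?F 1 3 5 + ?F 0 3 4 * ?F 1 5 6))" (is "_ = _ * ?w01")
    by (simp add: formula pair_pair_triple_def pair_triple_def less_7 sort vals) (simp add: algebra_simps)?
  then have e01: "?w01 = 0"
    using wedge'[of 0 1] by simp
  have "wedge_coeff ?\<psi> 0 2 = 3 * (a * (?F 0 5 6 * ?F 2 3 4 - ?F 0 4 6 * ?F 2 3 5 + ?F 0 4 5 * ?F 2 3 6 + ?F 0 3 4 * ?F 2 5 6))" (is "_ = _ * ?w02")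
    by (simp add: formula pair_pair_triple_def pair_triple_def less_7 sort vals) (simp add: algebra_simps)?
  then have e02: "?w02 = 0"
    using wedge'[of 0 2] by simp
  have "wedge_coeff ?\<psi> 0 3 = 3 * (a * (?F 0 3 4 * ?F 3 5 6))" (is "_ = _ * ?w03")
    by (simp add: formula pair_pair_triple_def pair_triple_def less_7 sort vals) (simp add: algebra_simps)?
  then have e03: "?w03 = 0"
    using wedge'[of 0 3] by simp
  have "wedge_coeff ?\<psi> 0 4 = 3 * (a * (?F 0 3 4 * ?F 4 5 6 - ?F 0 4 5 * ?F 3 4 6 + ?F 0 4 6 * ?F 3 4 5))" (is "_ = _ * ?w04")
    by (simp add: formula pair_pair_triple_def pair_triple_def less_7 sort vals) (simp add: algebra_simps)?
  then have e04: "?w04 = 0"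
    using wedge'[of 0 4] by simp
  have "wedge_coeff ?\<psi> 0 5 = 3 * (a * (?F 0 5 6 * ?F 3 4 5 - ?F 0 4 5 * ?F 3 5 6))" (is "_ = _ * ?w05")
    by (simp add: formula pair_pair_triple_def pair_triple_def less_7 sort vals) (simp add: algebra_simps)?
  then have e05: "?w05 = 0"
    using wedge'[of 0 5] by simp
  have "wedge_coeff ?\<psi> 0 6 = 3 * (a * (?F 0 5 6 * ?F 3 4 6 - ?F 0 4 6 * ?F 3 5 6))" (is "_ = _ * ?w06")
    by (simp add: formula pair_pair_triple_def pair_triple_def less_7 sort vals) (simp add: algebra_simps)?
  then have e06: "?w06 = 0"
    using wedge'[of 0 6] by simp
  have "wedge_coeff ?\<psi> 1 1 = 6 * (a * (?F 1 3 4 * ?F 1 5 6 - ?F 1 3 5 * ?F 1 4 6))" (is "_ = _ * ?w11")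
    by (simp add: formula pair_pair_triple_def pair_triple_def less_7 sort vals) (simp add: algebra_simps)?
  then have e11: "?w11 = - V"
    using wedge'[of 1 1] by simp
  have "wedge_coeff ?\<psi> 1 2 = 3 * (a * (?F 1 5 6 * ?F 2 3 4 - ?F 1 4 6 * ?F 2 3 5 + ?F 1 4 5 * ?F 2 3 6 - ?F 1 3 5 * ?F 2 4 6 + ?F 1 3 4 * ?F 2 5 6))" (is "_ = _ * ?w12")
    by (simp add: formula pair_pair_triple_def pair_triple_def less_7 sort vals) (simp add: algebra_simps)?
  then have e12: "?w12 = 0"
    using wedge'[of 1 2] by simp
  have "wedge_coeff ?\<psi> 2 2 = 6 * (a * (?F 2 3 4 * ?F 2 5 6 - ?F 2 3 5 * ?F 2 4 6 + ?F 2 3 6 * ?F 2 4 5))" (is "_ = _ * ?w22")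
    by (simp add: formula pair_pair_triple_def pair_triple_def less_7 sort vals) (simp add: algebra_simps)?
  then have e22: "?w22 = - V"
    using wedge'[of 2 2] by simp
  have "wedge_coeff ?\<psi> 3 3 = - 6 * (?F 0 3 4 * ?F 1 3 5 * ?F 2 3 6)" (is "_ = _ * ?w33")
    by (simp add: formula pair_pair_triple_def pair_triple_def less_7 sort vals) (simp add: algebra_simps)?
  then have e33: "?w33 = V"
    using wedge'[of 3 3] by simp
  have "wedge_coeff ?\<psi> 3 4 = 3 * (- ?F 0 3 4 * ?F 1 4 5 * ?F 2 3 6 + ?F 0 3 4 * ?F 1 4 6 * ?F 2 3 5 - ?F 0 3 4 * ?F 1 3 5 * ?F 2 4 6 + ?F 0 4 5 * ?F 1 3 4 * ?F 2 3 6 - ?F 0 4 6 * ?F 1 3 4 * ?F 2 3 5 + ?F 0 4 6 * ?F 1 3 5 * ?F 2 3 4)" (is "_ = _ * ?w34")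
    by (simp add: formula pair_pair_triple_def pair_triple_def less_7 sort vals) (simp add: algebra_simps)?
  then have e34: "?w34 = 0"
    using wedge'[of 3 4] by simp
  have "wedge_coeff ?\<psi> 3 5 = 3 * (- ?F 0 3 4 * ?F 1 3 5 * ?F 2 5 6 + ?F 0 3 4 * ?F 1 5 6 * ?F 2 3 5 - ?F 0 5 6 * ?F 1 3 4 * ?F 2 3 5 + ?F 0 4 5 * ?F 1 3 5 * ?F 2 3 6 + ?F 0 5 6 * ?F 1 3 5 * ?F 2 3 4)" (is "_ = _ * ?w35")
    by (simp add: formula pair_pair_triple_def pair_triple_def less_7 sort vals) (simp add: algebra_simps)?
  then have e35: "?w35 = 0"
    using wedge'[of 3 5] by simp
  have "wedge_coeff ?\<psi> 3 6 = 3 * (?F 0 3 4 * ?F 1 5 6 * ?F 2 3 6 - ?F 0 5 6 * ?F 1 3 4 * ?F 2 3 6 + ?F 0 4 6 * ?F 1 3 5 * ?F 2 3 6)" (is "_ = _ * ?w36")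
    by (simp add: formula pair_pair_triple_def pair_triple_def less_7 sort vals) (simp add: algebra_simps)?
  then have e36: "?w36 = 0"
    using wedge'[of 3 6] by simp
  have "wedge_coeff ?\<psi> 4 5 = 3 * (- ?F 0 3 4 * ?F 1 4 5 * ?F 2 5 6 + ?F 0 3 4 * ?F 1 5 6 * ?F 2 4 5 + ?F 0 4 5 * ?F 1 3 5 * ?F 2 4 6 - ?F 0 4 5 * ?F 1 5 6 * ?F 2 3 4 - ?F 0 4 5 * ?F 1 4 6 * ?F 2 3 5 + ?F 0 4 5 * ?F 1 3 4 * ?F 2 5 6 - ?F 0 4 6 * ?F 1 3 5 * ?F 2 4 5 + ?F 0 4 6 * ?F 1 4 5 * ?F 2 3 5 - ?F 0 5 6 * ?F 1 3 4 * ?F 2 4 5 + ?F 0 5 6 * ?F 1 4 5 * ?F 2 3 4)" (is "_ = _ * ?w45")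
    by (simp add: formula pair_pair_triple_def pair_triple_def less_7 sort vals) (simp add: algebra_simps)?
  then have e45: "?w45 = 0"
    using wedge'[of 4 5] by simp
  have "wedge_coeff ?\<psi> 4 6 = 3 * (- ?F 0 3 4 * ?F 1 4 6 * ?F 2 5 6 + ?F 0 3 4 * ?F 1 5 6 * ?F 2 4 6 - ?F 0 4 5 * ?F 1 4 6 * ?F 2 3 6 - ?F 0 4 6 * ?F 1 5 6 * ?F 2 3 4 + ?F 0 4 6 * ?F 1 4 5 * ?F 2 3 6 + ?F 0 4 6 * ?F 1 3 4 * ?F 2 5 6 - ?F 0 5 6 * ?F 1 3 4 * ?F 2 4 6 + ?F 0 5 6 * ?F 1 4 6 * ?F 2 3 4)" (is "_ = _ * ?w46")
    by (simp add: formula pair_pair_triple_def pair_triple_def less_7 sort vals) (simp add: algebra_simps)?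
  then have e46: "?w46 = 0"
    using wedge'[of 4 6] by simp
  have "wedge_coeff ?\<psi> 4 4 = 6 * (- ?F 0 3 4 * ?F 1 4 5 * ?F 2 4 6 + ?F 0 3 4 * ?F 1 4 6 * ?F 2 4 5 + ?F 0 4 5 * ?F 1 3 4 * ?F 2 4 6 - ?F 0 4 5 * ?F 1 4 6 * ?F 2 3 4 - ?F 0 4 6 * ?F 1 3 4 * ?F 2 4 5 + ?F 0 4 6 * ?F 1 4 5 * ?F 2 3 4)" (is "_ = _ * ?w44")
    by (simp add: formula pair_pair_triple_def pair_triple_def less_7 sort vals) (simp add: algebra_simps)?
  then have e44: "?w44 = - V"
    using wedge'[of 4 4] by simp
  have "wedge_coeff ?\<psi> 5 5 = 6 * (?F 0 4 5 * ?F 1 3 5 * ?F 2 5 6 - ?F 0 4 5 * ?F 1 5 6 * ?F 2 3 5 - ?F 0 5 6 * ?F 1 3 5 * ?F 2 4 5 + ?F 0 5 6 * ?F 1 4 5 * ?F 2 3 5)" (is "_ = _ * ?w55")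
    by (simp add: formula pair_pair_triple_def pair_triple_def less_7 sort vals) (simp add: algebra_simps)?
  then have e55: "?w55 = - V"
    using wedge'[of 5 5] by simp
  have "wedge_coeff ?\<psi> 5 6 = 3 * (- ?F 0 4 5 * ?F 1 5 6 * ?F 2 3 6 + ?F 0 5 6 * ?F 1 4 6 * ?F 2 3 5 + ?F 0 5 6 * ?F 1 4 5 * ?F 2 3 6 - ?F 0 5 6 * ?F 1 3 5 * ?F 2 4 6 + ?F 0 4 6 * ?F 1 3 5 * ?F 2 5 6 - ?F 0 4 6 * ?F 1 5 6 * ?F 2 3 5)" (is "_ = _ * ?w56")
    by (simp add: formula pair_pair_triple_def pair_triple_def less_7 sort vals) (simp add: algebra_simps)?
  then have e56: "?w56 = 0"
    using wedge'[of 5 6] by simp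
  have "wedge_coeff ?\<psi> 6 6 = 6 * (- ?F 0 4 6 * ?F 1 5 6 * ?F 2 3 6 + ?F 0 5 6 * ?F 1 4 6 * ?F 2 3 6)" (is "_ = _ * ?w66")
    by (simp add: formula pair_pair_triple_def pair_triple_def less_7 sort vals) (simp add: algebra_simps)?
  then have e66: "?w66 = - V"
    using wedge'[of 6 6] by simp
  have res: "V = 1 \<and> a = 1 \<and> ?F 0 3 4 = 1 \<and> ?F 1 3 5 = 1 \<and> ?F 2 3 6 = 1 \<and> ?F 0 5 6 = -1 \<and> ?F 1 4 6 = 1 \<and> ?F 2 4 5 = -1 \<and>
    ?F 0 4 5 = 0 \<and> ?F 0 4 6 = 0 \<and> ?F 1 3 4 = 0 \<and> ?F 1 4 5 = 0 \<and> ?F 1 5 6 = 0 \<and> ?F 2 3 4 = 0 \<and> ?F 2 3 5 = 0 \<and> ?F 2 4 6 = 0 \<and> ?F 2 5 6 = 0 \<and>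
    ?F 3 4 5 = 0 \<and> ?F 3 4 6 = 0 \<and> ?F 3 5 6 = 0 \<and> ?F 4 5 6 = 0"
  proof (rule normal_form_algebra[OF e00 e01 e02 e03 e04 e05 e06 e11 e12 e22 e33 e34 e35 e36 e45 e46 e44 e55 e56 e66 V2])
    show "a \<ge> 0" using a by simp
    show "?F 0 3 4 \<ge> 0" "?F 1 3 5 \<ge> 0" "?F 2 3 6 \<ge> 0"
      unfolding F E_def using e4 e5 e6 by simp_all
  qed
  have "pull3 P \<phi> = phi_std"
  proof (rule alternating3_eqI[OF alt' alternating3_phi_std])
    have "\<forall>i j k. i < j \<longrightarrow> j < k \<longrightarrow> ?F i j k = phi_std $ i $ j $ k"
      unfolding all7 by (simp add: less_7 not_less_7 phi_std_def alt3_def vals res)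
    then show "i < j \<Longrightarrow> j < k \<Longrightarrow> ?F i j k = phi_std $ i $ j $ k" for i j k by blast
  qed
  then show ?thesis
    using that[of P] orth res by (simp add: col V_def)
qed

section \<open>Metric, cross product and dual 4-form in an adapted frame\<close>

lemma det_scaleR: "det (s *\<^sub>R g) = s ^ 7 * det (g :: real^7^7)"
proof -
  have "s *\<^sub>R g = (\<chi> i. s *s (g $ i))" by (simp add: vec_eq_iff)
  then show ?thesis by (simp add: det_rows_mul)
qed

text \<open>Two solutions have proportional metrics, \<open>g' = s g\<close> with \<open>s = v / v'\<close>. Comparing the squares of
  the volume coefficients with the determinants gives \<open>s\<^sup>9 = 1\<close>.\<close>

lemma metric_vol_unique:
  assumes mv: "metric_vol_of \<phi> g v" and mv': "metric_vol_of \<phi> g' v'"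
  shows "g' = g \<and> v' = v"
proof -
  have nz: "v \<noteq> 0" "v' \<noteq> 0" using metric_vol_nonzero assms by blast+
  define s where "s = v / v'"
  have g': "g' = s *\<^sub>R g"
  proof -
    have "- 6 * g$i$j * v = - 6 * g'$i$j * v'" for i j
      using mv mv' by (simp add: metric_vol_of_def)
    then show ?thesis using nz by (simp add: vec_eq_iff s_def field_simps)
  qed
  have ax: "axis 0 1 \<noteq> (0 :: real^7)" by (simp add: axis_eq_0_iff)
  have "axis 0 1 \<bullet> (g *v axis 0 1) > 0" "axis 0 1 \<bullet> (g' *v axis (0::7) (1::real)) > 0"
    using mv mv' ax unfolding metric_vol_of_def by blast+
  then have s: "s > 0"
    unfolding g' by (simp add: scaleR_matrix_vector_assoc[symmetric] zero_less_mult_iff)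
  have "det g' = s ^ 7 * det g"
    by (simp add: g' det_scaleR)
  then have "v'\<^sup>2 = s ^ 7 * (s * v')\<^sup>2"
    using mv mv' nz by (simp add: metric_vol_of_def s_def)
  then have "s ^ 9 = 1 ^ 9"
    using nz by (simp add: power_mult_distrib flip: power_add)
  then have "s = 1" by (rule power_eq_imp_eq_base) (use s in auto)
  then show ?thesis using g' nz by (simp add: s_def)
qed

lemma metric_vol_of_metric:
  assumes mv: "metric_vol_of \<phi> g v"
  shows "metric \<phi> = g" "vol_coeff \<phi> = v"
  unfolding metric_def vol_coeff_def
  by (rule the_equality; use mv metric_vol_unique[OF mv] in blast)+

lemma matrix_inv_eqI:
  fixes g B :: "real^'n^'n"
  assumes "B ** g = mat 1"
  shows "matrix_inv g = B"
proof -
  have "g ** B = mat 1" using assms by (simp add: matrix_left_right_inverse)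
  then have "g ** matrix_inv g = mat 1"
    unfolding matrix_inv_def using assms by (rule_tac someI2[of _ B]) auto
  then have "B ** (g ** matrix_inv g) = B" by simp
  then show ?thesis using assms by (simp add: matrix_mul_assoc)
qed

lemma eps_transpose:
  assumes "a \<noteq> b"
  shows "eps (\<nu> \<circ> Transposition.transpose a b) = - eps \<nu>"
proof -
  have T: "Transposition.transpose a b permutes UNIV" by (simp add: permutes_swap_id)
  show ?thesis
  proof (cases "\<nu> permutes UNIV")
    case True
    then have "sign (\<nu> \<circ> Transposition.transpose a b) = - sign \<nu>"
      using assms sign_compose[of \<nu> "Transposition.transpose a b"] permutation_swap_id[of a b]
        permutation_permutes[of \<nu>] by (auto simp: sign_swap_id)
    then show ?thesis using True permutes_compose[OF T True] by (simp add: eps_def)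
  next
    case False
    have "\<not> (\<nu> \<circ> Transposition.transpose a b) permutes UNIV"
    proof
      assume "(\<nu> \<circ> Transposition.transpose a b) permutes UNIV"
      from permutes_compose[OF T this] show False using False by (simp add: o_assoc[symmetric])
    qed
    then show ?thesis using False by (simp add: eps_def)
  qed
qed

lemma eps_swap:
  "eps (tup x1 x0 x2 x3 x4 x5 x6) = - eps (tup x0 x1 x2 x3 x4 x5 x6)"
  "eps (tup x0 x2 x1 x3 x4 x5 x6) = - eps (tup x0 x1 x2 x3 x4 x5 x6)"
  "eps (tup x0 x1 x3 x2 x4 x5 x6) = - eps (tup x0 x1 x2 x3 x4 x5 x6)"
  "eps (tup x0 x1 x2 x4 x3 x5 x6) = - eps (tup x0 x1 x2 x3 x4 x5 x6)"
  "eps (tup x0 x1 x2 x3 x5 x4 x6) = - eps (tup x0 x1 x2 x3 x4 x5 x6)"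
  "eps (tup x0 x1 x2 x3 x4 x6 x5) = - eps (tup x0 x1 x2 x3 x4 x5 x6)"
  using eps_transpose[of 0 1 "tup x0 x1 x2 x3 x4 x5 x6"] eps_transpose[of 1 2 "tup x0 x1 x2 x3 x4 x5 x6"] eps_transpose[of 2 3 "tup x0 x1 x2 x3 x4 x5 x6"]
    eps_transpose[of 3 4 "tup x0 x1 x2 x3 x4 x5 x6"] eps_transpose[of 4 5 "tup x0 x1 x2 x3 x4 x5 x6"] eps_transpose[of 5 6 "tup x0 x1 x2 x3 x4 x5 x6"]
  by (simp_all add: tup_transpose)

text \<open>Guarded by the order of the indices, the exchange rules terminate as rewrite rules.\<close>

lemma eps_sort:
  "x1 < x0 \<Longrightarrow> eps (tup x0 x1 x2 x3 x4 x5 x6) = - eps (tup x1 x0 x2 x3 x4 x5 x6)"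
  "x2 < x1 \<Longrightarrow> eps (tup x0 x1 x2 x3 x4 x5 x6) = - eps (tup x0 x2 x1 x3 x4 x5 x6)"
  "x3 < x2 \<Longrightarrow> eps (tup x0 x1 x2 x3 x4 x5 x6) = - eps (tup x0 x1 x3 x2 x4 x5 x6)"
  "x4 < x3 \<Longrightarrow> eps (tup x0 x1 x2 x3 x4 x5 x6) = - eps (tup x0 x1 x2 x4 x3 x5 x6)"
  "x5 < x4 \<Longrightarrow> eps (tup x0 x1 x2 x3 x4 x5 x6) = - eps (tup x0 x1 x2 x3 x5 x4 x6)"
  "x6 < x5 \<Longrightarrow> eps (tup x0 x1 x2 x3 x4 x5 x6) = - eps (tup x0 x1 x2 x3 x4 x6 x5)"
  by (rule eps_swap)+

lemma eps_id: "eps (tup 0 1 2 3 4 5 6) = 1"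
  by (simp add: tup_id eps_def permutes_id)

lemma eps_nondistinct:
  assumes "\<not> distinct [x0,x1,x2,x3,x4,x5,x6]"
  shows "eps (tup x0 x1 x2 x3 x4 x5 x6) = 0"
proof -
  have "\<not> inj (tup x0 x1 x2 x3 x4 x5 x6)"
  proof
    assume "inj (tup x0 x1 x2 x3 x4 x5 x6)"
    then have inj: "tup x0 x1 x2 x3 x4 x5 x6 i = tup x0 x1 x2 x3 x4 x5 x6 j \<Longrightarrow> i = j" for i j by (simp add: inj_eq)
    have "distinct [x0,x1,x2,x3,x4,x5,x6]"
      using inj[of 0 1] inj[of 0 2] inj[of 0 3] inj[of 0 4] inj[of 0 5] inj[of 0 6] inj[of 1 2] inj[of 1 3] inj[of 1 4]
        inj[of 1 5] inj[of 1 6] inj[of 2 3] inj[of 2 4] inj[of 2 5] inj[of 2 6] inj[of 3 4] inj[of 3 5] inj[of 3 6]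
        inj[of 4 5] inj[of 4 6] inj[of 5 6] by auto
    then show False using assms by simp
  qed
  then show ?thesis by (simp add: eps_def permutes_UNIV_7)
qed

lemma contraction_phi_std:
  assumes "\<And>i j k. X i j k = - X j i k" "\<And>i j k. X i j k = - X i k j"
  shows "(\<Sum>e\<in>UNIV. \<Sum>f\<in>UNIV. \<Sum>h\<in>UNIV. phi_std$e$f$h * X e f h)
    = 6 * (X 0 1 2 + X 0 3 4 - X 0 5 6 + X 1 3 5 + X 1 4 6 + X 2 3 6 - X 2 4 5)"
proof -
  have "j < i \<Longrightarrow> X i j k = - X j i k" "k < j \<Longrightarrow> X i j k = - X i k j" for i j k
    using assms by blast+
  then show ?thesis
    unfolding sum_7 phi_std_def alt3_def by (simp add: less_7)
qed

lemma tri_sum_left: "tri \<phi> (sum f I) v w = (\<Sum>i\<in>I. tri \<phi> (f i) v w)"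
proof (induction I rule: infinite_finite_induct)
qed (simp_all add: tri_simps, simp_all add: tri_def)

lemma tri_sum_middle: "tri \<phi> u (sum f I) w = (\<Sum>i\<in>I. tri \<phi> u (f i) w)"
proof (induction I rule: infinite_finite_induct)
qed (simp_all add: tri_simps, simp_all add: tri_def)

definition cross :: "real^7^7 \<Rightarrow> real^7^7^7 \<Rightarrow> real^7 \<Rightarrow> real^7 \<Rightarrow> real^7" where
  "cross g \<phi> u v = matrix_inv g *v (\<chi> k. tri \<phi> u v (axis k 1))"

text \<open>The identity expressing that the norm of the octonions is multiplicative, restricted to
  imaginary octonions.\<close>

lemma phi_std_norm_identity:
  fixes X Y :: "7 \<Rightarrow> real"
  shows "(\<Sum>k\<in>UNIV. (\<Sum>i\<in>UNIV. \<Sum>j\<in>UNIV. X i * Y j * phi_std$i$j$k)\<^sup>2)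
    = (\<Sum>i\<in>UNIV. X i * X i) * (\<Sum>i\<in>UNIV. Y i * Y i) - (\<Sum>i\<in>UNIV. X i * Y i)\<^sup>2"
proof -
  let ?t = "\<lambda>k. \<Sum>i\<in>UNIV. \<Sum>j\<in>UNIV. X i * Y j * phi_std$i$j$k"
  have "?t 0 = X 1 * Y 2 - X 2 * Y 1 + X 3 * Y 4 - X 4 * Y 3 - X 5 * Y 6 + X 6 * Y 5"
    "?t 1 = X 2 * Y 0 - X 0 * Y 2 + X 3 * Y 5 - X 5 * Y 3 + X 4 * Y 6 - X 6 * Y 4"
    "?t 2 = X 0 * Y 1 - X 1 * Y 0 + X 3 * Y 6 - X 6 * Y 3 - X 4 * Y 5 + X 5 * Y 4"
    "?t 3 = X 4 * Y 0 - X 0 * Y 4 + X 5 * Y 1 - X 1 * Y 5 + X 6 * Y 2 - X 2 * Y 6"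
    "?t 4 = X 0 * Y 3 - X 3 * Y 0 + X 6 * Y 1 - X 1 * Y 6 - X 5 * Y 2 + X 2 * Y 5"
    "?t 5 = X 0 * Y 6 - X 6 * Y 0 + X 1 * Y 3 - X 3 * Y 1 + X 4 * Y 2 - X 2 * Y 4"
    "?t 6 = X 5 * Y 0 - X 0 * Y 5 + X 1 * Y 4 - X 4 * Y 1 + X 2 * Y 3 - X 3 * Y 2"
    unfolding sum_7 phi_std_def alt3_def by simp_all
  then show ?thesis
    by (simp only: sum_7) (simp add: power2_eq_square algebra_simps)
qed

lemma quad_linear:
  "linear (\<lambda>a. quad \<beta> a b c d)" "linear (\<lambda>b. quad \<beta> a b c d)" "linear (\<lambda>c. quad \<beta> a b c d)" "linear (\<lambda>d. quad \<beta> a b c d)"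
  by (rule linearI; simp add: quad_def sum.distrib sum_distrib_left algebra_simps)+

text \<open>The columns of \<open>P\<close> are a frame as provided by \<open>G2_normal_form\<close>.\<close>

context
  fixes \<phi> g v P
  assumes mv: "metric_vol_of \<phi> g v" and alt: "alternating3 \<phi>"
    and orth: "\<And>i j. gip g (column i P) (column j P) = (if i = j then 1 else 0)"
    and vP: "v * det P = 1" and std: "pull3 P \<phi> = phi_std"
begin

lemma metric_sym: "transpose g = g"
  using mv by (simp add: metric_vol_of_def)

lemma frame_inverse: "(P ** transpose P) ** g = mat 1" "matrix_inv g = P ** transpose P"
proof -
  have "pull2 P g = mat 1"
    by (simp add: vec_eq_iff pull2_gip orth mat_def)
  then have "P ** (transpose P ** g) = mat 1"
    unfolding pull2_matrix by (simp only: matrix_left_right_inverse)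
  then show "(P ** transpose P) ** g = mat 1"
    by (simp add: matrix_mul_assoc)
  then show "matrix_inv g = P ** transpose P"
    by (rule matrix_inv_eqI)
qed

lemma frame_expand: "(\<Sum>i\<in>UNIV. gip g w (column i P) *\<^sub>R column i P) = w"
proof -
  have "(transpose P *v (g *v w)) $ i = gip g w (column i P)" for i
    unfolding gip_commute[OF metric_sym, of w]
    by (simp add: gip_def matrix_vector_mult_def transpose_def column_def inner_vec_def)
  then have "(\<Sum>i\<in>UNIV. gip g w (column i P) *\<^sub>R column i P) = P *v (transpose P *v (g *v w))"
    by (simp add: matrix_mult_sum scalar_mult_eq_scaleR)
  also have "\<dots> = ((P ** transpose P) ** g) *v w"
    by (simp add: matrix_vector_mul_assoc matrix_mul_assoc)
  finally show ?thesis by (simp add: frame_inverse(1))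
qed

lemma gip_cross: "gip g (cross g \<phi> u w) z = tri \<phi> u w z"
proof -
  have "g ** matrix_inv g = mat 1"
    using frame_inverse by (simp add: matrix_left_right_inverse)
  then have "g *v cross g \<phi> u w = (\<chi> k. tri \<phi> u w (axis k 1))"
    by (simp add: cross_def matrix_vector_mul_assoc)
  then show ?thesis
    unfolding gip_commute[OF metric_sym, of _ z] tri_inner[of \<phi> u w z] by (simp add: gip_def inner_commute)
qed

lemma gip_frame_sum: "gip g x y = (\<Sum>i\<in>UNIV. gip g x (column i P) * gip g y (column i P))"
proof -
  have s: "gip g (sum f I) y = (\<Sum>i\<in>I. gip g (f i) y)" for f and I :: "7 set"
    by (simp add: gip_def inner_sum_left)
  have "gip g x y = gip g (\<Sum>i\<in>UNIV. gip g x (column i P) *\<^sub>R column i P) y"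
    by (simp only: frame_expand)
  then show ?thesis
    by (simp add: s gip_simps gip_commute[OF metric_sym, of y])
qed

lemma tri_frame: "tri \<phi> (column i P) (column j P) (column k P) = phi_std$i$j$k"
  using std pull3_tri by metis

lemma G2_cross_product_space: "cross_product_space (gip g) (cross g \<phi>) (\<lambda>i. column i P)"
proof
  fix x y z :: "real^7" and r :: real and i j :: 7
  have eqI: "u = w" if "\<And>z. gip g u z = gip g w z" for u w
  proof -
    have "u = (\<Sum>i\<in>UNIV. gip g u (column i P) *\<^sub>R column i P)" by (rule frame_expand[symmetric])
    also have "\<dots> = (\<Sum>i\<in>UNIV. gip g w (column i P) *\<^sub>R column i P)" by (simp only: that)
    also have "\<dots> = w" by (rule frame_expand)
    finally show ?thesis .
  qed
  show "gip g (x + y) z = gip g x z + gip g y z" "gip g (r *\<^sub>R x) z = r * gip g x z" by (simp_all add: gip_simps)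
  show "gip g x y = gip g y x" by (rule gip_commute[OF metric_sym])
  show "gip g (column i P) (column j P) = (if i = j then 1 else 0)" by (rule orth)
  show "(\<Sum>i\<in>UNIV. gip g x (column i P) *\<^sub>R column i P) = x" by (rule frame_expand)
  show "cross g \<phi> (x + y) z = cross g \<phi> x z + cross g \<phi> y z"
    by (rule eqI) (simp add: gip_simps gip_cross tri_simps)
  show "cross g \<phi> (r *\<^sub>R x) z = r *\<^sub>R cross g \<phi> x z"
    by (rule eqI) (simp add: gip_simps gip_cross tri_simps)
  have "gip g (cross g \<phi> x y) z = gip g ((-1) *\<^sub>R cross g \<phi> y x) z" for z
    unfolding gip_simps gip_cross using tri_swap12[OF alt, of x y z] by simp
  then show "cross g \<phi> x y = - cross g \<phi> y x"
    using eqI[of "cross g \<phi> x y" "(-1) *\<^sub>R cross g \<phi> y x"] by simp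
  show "gip g (cross g \<phi> x y) z = gip g (cross g \<phi> y z) x"
    unfolding gip_cross using tri_swap12[OF alt, of x y z] tri_swap23[OF alt, of y x z] by simp
  show "gip g (cross g \<phi> x y) (cross g \<phi> x y) = gip g x x * gip g y y - (gip g x y)\<^sup>2"
  proof -
    have "tri \<phi> x y (column k P) = (\<Sum>i\<in>UNIV. \<Sum>j\<in>UNIV. gip g x (column i P) * gip g y (column j P) * phi_std$i$j$k)" for k
    proof -
      have "tri \<phi> x y (column k P) = tri \<phi> (\<Sum>i\<in>UNIV. gip g x (column i P) *\<^sub>R column i P)
          (\<Sum>i\<in>UNIV. gip g y (column i P) *\<^sub>R column i P) (column k P)"
        by (simp only: frame_expand)
      also have "\<dots> = (\<Sum>i\<in>UNIV. tri \<phi> (gip g x (column i P) *\<^sub>R column i P)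
          (\<Sum>j\<in>UNIV. gip g y (column j P) *\<^sub>R column j P) (column k P))"
        by (rule tri_sum_left)
      finally show ?thesis
        by (simp only: tri_sum_middle tri_simps tri_frame sum_distrib_left mult_ac)
    qed
    note t = this
    have "gip g (cross g \<phi> x y) (cross g \<phi> x y) = (\<Sum>k\<in>UNIV. (tri \<phi> x y (column k P))\<^sup>2)"
      by (subst gip_frame_sum) (simp add: gip_cross power2_eq_square)
    also have "\<dots> = (\<Sum>i\<in>UNIV. gip g x (column i P) * gip g x (column i P)) * (\<Sum>i\<in>UNIV. gip g y (column i P) * gip g y (column i P))
        - (\<Sum>i\<in>UNIV. gip g x (column i P) * gip g y (column i P))\<^sup>2"
      unfolding t by (rule phi_std_norm_identity)
    also have "\<dots> = gip g x x * gip g y y - (gip g x y)\<^sup>2"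
      by (simp only: gip_frame_sum[of x x] gip_frame_sum[of y y] gip_frame_sum[of x y])
    finally show ?thesis .
  qed
qed

interpretation cross_product_space "gip g" "cross g \<phi>" "\<lambda>i. column i P"
  by (rule G2_cross_product_space)

lemma linear_eq_on_frame:
  fixes f f' :: "real^7 \<Rightarrow> real"
  assumes "linear f" "linear f'" "\<And>i. f (column i P) = f' (column i P)"
  shows "f x = f' x"
proof -
  have "f (\<Sum>i\<in>UNIV. gip g x (column i P) *\<^sub>R column i P) = f' (\<Sum>i\<in>UNIV. gip g x (column i P) *\<^sub>R column i P)"
    by (simp add: linear_sum[OF assms(1)] linear_sum[OF assms(2)] linear_scale[OF assms(1)] linear_scale[OF assms(2)] assms(3))
  then show ?thesis by (simp only: frame_expand)
qed

text \<open>Both sides are alternating in the four indices, so that 35 components remain to be compared, and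
  there both sides are explicit.\<close>

lemma psi_frame: "quad (psi \<phi>) (column a P) (column b P) (column c P) (column d P)
    = gip g (Q (column a P) (column b P) (column c P)) (column d P)"
proof -
  define L where "L a b c d = quad (psi \<phi>) (column a P) (column b P) (column c P) (column d P)" for a b c d
  define R where "R a b c d = gip g (Q (column a P) (column b P) (column c P)) (column d P)" for a b c d
  have Leps: "L a b c d = 1/6 * (\<Sum>e\<in>UNIV. \<Sum>f\<in>UNIV. \<Sum>h\<in>UNIV. phi_std$e$f$h * eps (tup e f h a b c d))" for a b c d
  proof -
    have "matrix_inv (metric \<phi>) $ a $ i = (\<Sum>e\<in>UNIV. P $ a $ e * P $ i $ e)" for a i
      by (simp add: metric_vol_of_metric[OF mv] frame_inverse(2) matrix_matrix_mult_def transpose_def)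
    from quad_psi_frame[OF this, of a b c d] show ?thesis
      by (simp add: L_def metric_vol_of_metric[OF mv] std vP)
  qed
  have L: "L a b c d = eps (tup 0 1 2 a b c d) + eps (tup 0 3 4 a b c d) - eps (tup 0 5 6 a b c d)
      + eps (tup 1 3 5 a b c d) + eps (tup 1 4 6 a b c d) + eps (tup 2 3 6 a b c d) - eps (tup 2 4 5 a b c d)" for a b c d
  proof -
    have "(\<Sum>e\<in>UNIV. \<Sum>f\<in>UNIV. \<Sum>h\<in>UNIV. phi_std$e$f$h * eps (tup e f h a b c d))
      = 6 * (eps (tup 0 1 2 a b c d) + eps (tup 0 3 4 a b c d) - eps (tup 0 5 6 a b c d)
      + eps (tup 1 3 5 a b c d) + eps (tup 1 4 6 a b c d) + eps (tup 2 3 6 a b c d) - eps (tup 2 4 5 a b c d))"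
      by (rule contraction_phi_std) (rule eps_swap)+
    then show ?thesis unfolding Leps by simp
  qed
  have Rstd: "R a b c d = (if a = c \<and> b = d then 1 else 0) - (if b = c \<and> a = d then 1 else 0)
      - (\<Sum>k\<in>UNIV. phi_std$a$b$k * phi_std$k$c$d)" for a b c d
  proof -
    let ?X = "cross g \<phi> (column a P) (column b P)"
    have "tri \<phi> ?X (column c P) (column d P)
        = tri \<phi> (\<Sum>k\<in>UNIV. gip g ?X (column k P) *\<^sub>R column k P) (column c P) (column d P)"
      by (simp only: frame_expand)
    also have "\<dots> = (\<Sum>k\<in>UNIV. phi_std$a$b$k * phi_std$k$c$d)"
      by (simp add: tri_sum_left tri_simps gip_cross tri_frame)
    finally have t: "tri \<phi> ?X (column c P) (column d P) = (\<Sum>k\<in>UNIV. phi_std$a$b$k * phi_std$k$c$d)" .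
    have p: "(if X then 1 else 0) * (if Y then 1 else 0) = (if X \<and> Y then 1 else (0::real))" for X Y
      by simp
    show ?thesis
      by (simp only: R_def Q_def ip_simps gip_cross orth p t)
  qed
  have "L a b c d - R a b c d = 0"
  proof (rule alternating_zeroI4[where d="\<lambda>a b c d. L a b c d - R a b c d"])
    fix a b c d
    show "L a b c d - R a b c d = - (L b a c d - R b a c d)"
      unfolding L R_def using Q_swap12[of "column a P" "column b P" "column c P"]
      by (simp add: eps_swap(4)[where ?x4.0=a and ?x3.0=b and ?x5.0=c and ?x6.0=d] ip_minus_left)
    show "L a b c d - R a b c d = - (L a c b d - R a c b d)"
      unfolding L R_def using Q_swap23[of "column a P" "column b P" "column c P"]
      by (simp add: eps_swap(5)[where ?x3.0=a and ?x5.0=b and ?x4.0=c and ?x6.0=d] ip_minus_left)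
    show "L a b c d - R a b c d = - (L a b d c - R a b d c)"
      unfolding L R_def using ip_Q_swap[of "column a P" "column b P" "column c P" "column d P"]
      by (simp add: eps_swap(6)[where ?x3.0=a and ?x4.0=b and ?x6.0=c and ?x5.0=d])
    show "a < b \<Longrightarrow> b < c \<Longrightarrow> c < d \<Longrightarrow> L a b c d - R a b c d = 0"
      by (rule increasing4I[of "\<lambda>a b c d. L a b c d - R a b c d = 0"]; (assumption | (unfold L Rstd,
        simp add: less_7 eps_nondistinct eps_sort eps_id sum_7 phi_std_def alt3_def)))
  qed
  then show ?thesis by (simp add: L_def R_def)
qed

theorem psi_eq_Q: "quad (psi \<phi>) a b c d = gip g (Q a b c) d"
proof -
  have Qlin: "linear (\<lambda>a. gip g (Q a b c) d)" "linear (\<lambda>b. gip g (Q a b c) d)" "linear (\<lambda>c. gip g (Q a b c) d)"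
      "linear (\<lambda>d. gip g (Q a b c) d)" for a b c d
    by (rule linearI; simp add: Q_def ip_simps cr_simps algebra_simps)+
  have "quad (psi \<phi>) (column i P) (column j P) (column k P) d = gip g (Q (column i P) (column j P) (column k P)) d" for i j k d
    by (rule linear_eq_on_frame[OF quad_linear(4) Qlin(4) psi_frame])
  then have "quad (psi \<phi>) (column i P) (column j P) c d = gip g (Q (column i P) (column j P) c) d" for i j c d
    by (rule linear_eq_on_frame[OF quad_linear(3) Qlin(3)])
  then have "quad (psi \<phi>) (column i P) b c d = gip g (Q (column i P) b c) d" for i b c d
    by (rule linear_eq_on_frame[OF quad_linear(2) Qlin(2)])
  then show ?thesis
    by (rule linear_eq_on_frame[OF quad_linear(1) Qlin(1)])
qed

end

section \<open>Iterated directional derivatives\<close>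

text \<open>The directional derivatives from which \<open>Ck_on\<close> is built.\<close>

abbreviation dd :: "'a::real_normed_vector \<Rightarrow> ('a \<Rightarrow> 'b::real_normed_vector) \<Rightarrow> 'a \<Rightarrow> 'b" where
  "dd v f x \<equiv> frechet_derivative f (at x) v"

lemma dd_eqI: "(f has_derivative f') (at x) \<Longrightarrow> dd v f x = f' v"
  using frechet_derivative_at[of f f' x] by simp

lemma dd_cong:
  assumes "open U" "x \<in> U" "f differentiable at x" "\<And>y. y \<in> U \<Longrightarrow> f y = g y"
  shows "dd v f x = dd v g x" "g differentiable at x"
proof -
  have "(f has_derivative frechet_derivative f (at x)) (at x)"
    using assms(3) by (simp add: frechet_derivative_works[symmetric])
  then have "(g has_derivative frechet_derivative f (at x)) (at x)"
    using assms by (rule_tac has_derivative_transform_within_open[of f _ x UNIV U]) auto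
  then show "dd v f x = dd v g x" "g differentiable at x"
    by (simp_all add: dd_eqI differentiableI)
qed

lemma dd_linear_direction: "f differentiable at x \<Longrightarrow> linear (\<lambda>v. dd v f x)"
  using linear_frechet_derivative by blast

lemma dd_add:
  assumes "f differentiable at x" "g differentiable at x"
  shows "dd v (\<lambda>y. f y + g y) x = dd v f x + dd v g x"
  using assms unfolding frechet_derivative_works by (intro dd_eqI) (rule has_derivative_add)

lemma dd_diff:
  assumes "f differentiable at x" "g differentiable at x"
  shows "dd v (\<lambda>y. f y - g y) x = dd v f x - dd v g x"
  using assms unfolding frechet_derivative_works by (intro dd_eqI) (rule has_derivative_diff)

lemma dd_bounded_linear:
  assumes "bounded_linear L" "f differentiable at x"
  shows "dd v (\<lambda>y. L (f y)) x = L (dd v f x)" "(\<lambda>y. L (f y)) differentiable at x"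
proof -
  have "((\<lambda>y. L (f y)) has_derivative (\<lambda>v. L (dd v f x))) (at x)"
    using assms unfolding frechet_derivative_works by (rule_tac bounded_linear.has_derivative) auto
  then show "dd v (\<lambda>y. L (f y)) x = L (dd v f x)" "(\<lambda>y. L (f y)) differentiable at x"
    by (simp_all add: dd_eqI differentiableI)
qed

lemma dd_bounded_bilinear:
  assumes "bounded_bilinear B" "f differentiable at x" "g differentiable at x"
  shows "dd v (\<lambda>y. B (f y) (g y)) x = B (f x) (dd v g x) + B (dd v f x) (g x)"
    "(\<lambda>y. B (f y) (g y)) differentiable at x"
proof -
  have "((\<lambda>y. B (f y) (g y)) has_derivative (\<lambda>v. B (f x) (dd v g x) + B (dd v f x) (g x))) (at x)"
    using assms unfolding frechet_derivative_works by (rule_tac bounded_bilinear.FDERIV) auto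
  then show "dd v (\<lambda>y. B (f y) (g y)) x = B (f x) (dd v g x) + B (dd v f x) (g x)"
    "(\<lambda>y. B (f y) (g y)) differentiable at x"
    by (simp_all add: dd_eqI differentiableI)
qed

lemma Ck_on_cong:
  assumes "open U" "\<And>x. x \<in> U \<Longrightarrow> f x = g x" "Ck_on k U f"
  shows "Ck_on k U g"
  using assms(2,3)
proof (induction k arbitrary: f g)
  case 0
  then show ?case using continuous_on_cong[of U U f g] by simp
next
  case (Suc k)
  have d: "f differentiable at x" if "x \<in> U" for x using Suc.prems that by simp
  have g: "dd v f x = dd v g x" "g differentiable at x" if "x \<in> U" for x v
    using dd_cong[OF assms(1) that d[OF that] Suc.prems(1)] by simp_all
  have "Ck_on k U (\<lambda>x. dd v f x)" for v using Suc.prems by simp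
  then have "Ck_on k U (\<lambda>x. dd v g x)" for v
    by (rule Suc.IH[rotated]) (rule g)
  then show ?case using g by simp
qed

lemma Ck_on_subset: "Ck_on k U f \<Longrightarrow> V \<subseteq> U \<Longrightarrow> Ck_on k V f"
  by (induction k arbitrary: f) (auto intro: continuous_on_subset)

lemma Ck_on_SucD: "Ck_on (Suc k) U f \<Longrightarrow> Ck_on k U f"
proof (induction k arbitrary: f)
  case 0
  then show ?case
    by (auto intro!: continuous_at_imp_continuous_on differentiable_imp_continuous_within)
qed auto

lemma Ck_on_const: "Ck_on k U (\<lambda>x. c)"
  by (induction k arbitrary: c) simp_all

lemma Ck_on_add:
  assumes "open U" "Ck_on k U f" "Ck_on k U g"
  shows "Ck_on k U (\<lambda>x. f x + g x)"
  using assms(2,3)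
proof (induction k arbitrary: f g)
  case 0
  then show ?case by (simp add: continuous_on_add)
next
  case (Suc k)
  have "Ck_on k U (\<lambda>x. dd v (\<lambda>x. f x + g x) x)" for v
    by (rule Ck_on_cong[OF assms(1) _ Suc.IH[of "\<lambda>x. dd v f x" "\<lambda>x. dd v g x"]])
      (use Suc.prems in \<open>auto simp: dd_add\<close>)
  then show ?case using Suc.prems by simp
qed

lemma Ck_on_bounded_linear:
  assumes "open U" "bounded_linear L" "Ck_on k U f"
  shows "Ck_on k U (\<lambda>x. L (f x))"
  using assms(3)
proof (induction k arbitrary: f)
  case 0
  then show ?case using assms(2) by (simp add: bounded_linear.continuous_on)
next
  case (Suc k)
  have "Ck_on k U (\<lambda>x. dd v (\<lambda>x. L (f x)) x)" for v
    by (rule Ck_on_cong[OF assms(1) _ Suc.IH[of "\<lambda>x. dd v f x"]])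
      (use Suc.prems assms(2) in \<open>auto simp: dd_bounded_linear\<close>)
  then show ?case using Suc.prems assms(2) by (simp add: dd_bounded_linear)
qed

lemma Ck_on_bounded_bilinear:
  assumes "open U" "bounded_bilinear B" "Ck_on k U f" "Ck_on k U g"
  shows "Ck_on k U (\<lambda>x. B (f x) (g x))"
  using assms(3,4)
proof (induction k arbitrary: f g)
  case 0
  then show ?case using assms(2) by (simp add: bounded_bilinear.continuous_on)
next
  case (Suc k)
  have "Ck_on k U f" "Ck_on k U g" using Suc.prems Ck_on_SucD by blast+
  then have "Ck_on k U (\<lambda>x. B (f x) (dd v g x) + B (dd v f x) (g x))" for v
    using Suc.prems by (intro Ck_on_add[OF assms(1)] Suc.IH) auto
  then have "Ck_on k U (\<lambda>x. dd v (\<lambda>x. B (f x) (g x)) x)" for v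
    by (rule Ck_on_cong[OF assms(1), rotated])
      (use Suc.prems assms(2) in \<open>simp add: dd_bounded_bilinear\<close>)
  then show ?case using Suc.prems assms(2) by (simp add: dd_bounded_bilinear)
qed

lemma Ck_on_compose_linear:
  assumes "bounded_linear L" "Ck_on k U f" "open V" "\<And>x. x \<in> V \<Longrightarrow> L x \<in> U"
  shows "Ck_on k V (\<lambda>x. f (L x))"
  using assms(2)
proof (induction k arbitrary: f)
  case 0
  then show ?case
    using assms(1,4)
    by (auto intro!: continuous_on_compose2[of U f V L] bounded_linear.continuous_on[OF assms(1) continuous_on_id])
next
  case (Suc k)
  have der: "((\<lambda>x. f (L x)) has_derivative (\<lambda>v. dd (L v) f (L x))) (at x)" if "x \<in> V" for x
  proof -
    have "(f has_derivative frechet_derivative f (at (L x))) (at (L x))"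
      using Suc.prems assms(4)[OF that] by (simp add: frechet_derivative_works[symmetric])
    from diff_chain_at[OF bounded_linear_imp_has_derivative[OF assms(1)] this]
    show ?thesis by (simp add: o_def)
  qed
  have "Ck_on k V (\<lambda>x. dd v (\<lambda>x. f (L x)) x)" for v
    by (rule Ck_on_cong[OF assms(3) _ Suc.IH[of "\<lambda>y. dd (L v) f y"]])
      (use Suc.prems in \<open>auto simp: dd_eqI[OF der]\<close>)
  then show ?case using der by (auto intro: differentiableI)
qed

text \<open>All exponents are treated at once because differentiation lowers the exponent by one.\<close>

lemma Ck_on_powr:
  fixes b s :: real
  shows "Ck_on k {t. b * t < 1} (\<lambda>t. (1 - b * t) powr s)"
proof (induction k arbitrary: s)
  case 0
  then show ?case by (auto intro!: continuous_intros)
next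
  case (Suc k)
  let ?U = "{t. b * t < 1}"
  have op: "open ?U" by (intro open_Collect_less continuous_intros)
  have der: "((\<lambda>t. (1 - b * t) powr s) has_derivative (\<lambda>v. (- s * b * v) * (1 - b * t) powr (s - 1))) (at t)"
    if "t \<in> ?U" for t
  proof -
    have "((\<lambda>t. (1 - b * t) powr s) has_real_derivative (s * (1 - b * t) powr (s - 1) * (- b))) (at t)"
      using that by (auto intro!: derivative_eq_intros simp: powr_diff)
    moreover have "(*) (s * (1 - b * t) powr (s - 1) * (- b)) = (\<lambda>v. (- s * b * v) * (1 - b * t) powr (s - 1))"
      by (simp add: fun_eq_iff)
    ultimately show ?thesis
      by (simp only: has_field_derivative_def)
  qed
  have "Ck_on k ?U (\<lambda>t. dd v (\<lambda>t. (1 - b * t) powr s) t)" for v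
    by (rule Ck_on_cong[OF op _ Ck_on_bounded_linear[OF op bounded_linear_mult_right[of "- s * b * v"] Suc.IH[of "s - 1"]]])
      (simp add: dd_eqI[OF der])
  then show ?case using der by (auto intro: differentiableI)
qed

lemma smooth_on_openD: "smooth_on S f \<Longrightarrow> open S \<Longrightarrow> Ck_on k S f"
  unfolding smooth_on_def using Ck_on_cong Ck_on_subset by metis

text \<open>The mean value theorem, once in the direction \<open>u\<close> and once in the direction \<open>v\<close>.\<close>

lemma second_difference:
  fixes f :: "'a::real_normed_vector \<Rightarrow> real"
  assumes diff: "\<And>y. y \<in> U \<Longrightarrow> f differentiable at y" "\<And>y. y \<in> U \<Longrightarrow> (\<lambda>z. dd u f z) differentiable at y"
    and t: "t > 0" and sub: "cball x (t * (norm u + norm v)) \<subseteq> U"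
  obtains \<xi> where "\<xi> \<in> cball x (t * (norm u + norm v))"
    "f (x + t *\<^sub>R u + t *\<^sub>R v) - f (x + t *\<^sub>R u) - f (x + t *\<^sub>R v) + f x = t\<^sup>2 * dd v (\<lambda>z. dd u f z) \<xi>"
proof -
  have line: "((\<lambda>s. h (p + s *\<^sub>R w)) has_real_derivative dd w h (p + s *\<^sub>R w)) (at s)"
    if "h differentiable at (p + s *\<^sub>R w)" for h :: "'a \<Rightarrow> real" and p w s
  proof -
    have d: "(h has_derivative frechet_derivative h (at (p + s *\<^sub>R w))) (at (p + s *\<^sub>R w))"
      using that by (simp add: frechet_derivative_works[symmetric])
    have "((\<lambda>s. p + s *\<^sub>R w) has_derivative (\<lambda>k. k *\<^sub>R w)) (at s)"
      by (auto intro!: derivative_eq_intros)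
    from diff_chain_at[OF this d] have "((\<lambda>s. h (p + s *\<^sub>R w)) has_derivative (\<lambda>k. dd (k *\<^sub>R w) h (p + s *\<^sub>R w))) (at s)"
      by (simp add: o_def)
    moreover have "(\<lambda>k. dd (k *\<^sub>R w) h (p + s *\<^sub>R w)) = (*) (dd w h (p + s *\<^sub>R w))"
      using linear_scale[OF dd_linear_direction[OF that]] by (auto simp: mult.commute)
    ultimately show ?thesis by (simp add: has_field_derivative_def)
  qed
  have near: "x + s *\<^sub>R u + r *\<^sub>R v \<in> cball x (t * (norm u + norm v))" if "0 \<le> s" "s \<le> t" "0 \<le> r" "r \<le> t" for s r
  proof -
    have "norm (s *\<^sub>R u + r *\<^sub>R v) \<le> s * norm u + r * norm v"
      using norm_triangle_ineq[of "s *\<^sub>R u" "r *\<^sub>R v"] that by simp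
    also have "\<dots> \<le> t * norm u + t * norm v"
      using that by (intro add_mono mult_right_mono) auto
    moreover have "x - (x + s *\<^sub>R u + r *\<^sub>R v) = - (s *\<^sub>R u + r *\<^sub>R v)" by simp
    ultimately show ?thesis by (simp only: mem_cball dist_norm norm_minus_cancel distrib_left)
  qed
  have inU: "x + s *\<^sub>R u + r *\<^sub>R v \<in> U" if "0 \<le> s" "s \<le> t" "0 \<le> r" "r \<le> t" for s r
    using near[OF that] sub by blast
  let ?p = "\<lambda>s. f ((x + t *\<^sub>R v) + s *\<^sub>R u) - f (x + s *\<^sub>R u)"
  have "\<exists>z. 0 < z \<and> z < t \<and> ?p t - ?p 0 = (t - 0) * (dd u f ((x + t *\<^sub>R v) + z *\<^sub>R u) - dd u f (x + z *\<^sub>R u))"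
  proof (rule MVT2[OF t])
    fix s assume s: "0 \<le> s" "s \<le> t"
    have "f differentiable at ((x + t *\<^sub>R v) + s *\<^sub>R u)" "f differentiable at (x + s *\<^sub>R u)"
      using diff(1)[OF inU[of s t]] diff(1)[OF inU[of s 0]] s t by (simp_all add: algebra_simps)
    then show "DERIV ?p s :> dd u f ((x + t *\<^sub>R v) + s *\<^sub>R u) - dd u f (x + s *\<^sub>R u)"
      by (intro DERIV_diff line)
  qed
  then obtain s where s: "0 < s" "s < t" "?p t - ?p 0 = t * (dd u f ((x + t *\<^sub>R v) + s *\<^sub>R u) - dd u f (x + s *\<^sub>R u))"
    by auto
  let ?q = "\<lambda>r. dd u f ((x + s *\<^sub>R u) + r *\<^sub>R v)"
  have "\<exists>z. 0 < z \<and> z < t \<and> ?q t - ?q 0 = (t - 0) * dd v (\<lambda>z. dd u f z) ((x + s *\<^sub>R u) + z *\<^sub>R v)"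
  proof (rule MVT2[OF t])
    fix r assume r: "0 \<le> r" "r \<le> t"
    have "(\<lambda>z. dd u f z) differentiable at ((x + s *\<^sub>R u) + r *\<^sub>R v)"
      using diff(2)[OF inU[of s r]] s r by simp
    then show "DERIV ?q r :> dd v (\<lambda>z. dd u f z) ((x + s *\<^sub>R u) + r *\<^sub>R v)"
      by (rule line)
  qed
  then obtain r where r: "0 < r" "r < t" "?q t - ?q 0 = t * dd v (\<lambda>z. dd u f z) ((x + s *\<^sub>R u) + r *\<^sub>R v)"
    by auto
  have comm: "x + t *\<^sub>R v + s *\<^sub>R u = x + s *\<^sub>R u + t *\<^sub>R v" "x + t *\<^sub>R v + t *\<^sub>R u = x + t *\<^sub>R u + t *\<^sub>R v"
    by simp_all
  have "f (x + t *\<^sub>R u + t *\<^sub>R v) - f (x + t *\<^sub>R u) - f (x + t *\<^sub>R v) + f x = ?p t - ?p 0"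
    by (simp add: comm)
  also have "\<dots> = t * (?q t - ?q 0)"
    unfolding s(3) by (simp add: comm)
  also have "\<dots> = t\<^sup>2 * dd v (\<lambda>z. dd u f z) ((x + s *\<^sub>R u) + r *\<^sub>R v)"
    unfolding r(3) by (simp add: power2_eq_square)
  finally show ?thesis
    using near[of s r] s r by (intro that[of "(x + s *\<^sub>R u) + r *\<^sub>R v"]) auto
qed

text \<open>The second difference is symmetric in \<open>u\<close> and \<open>v\<close>, so by \<open>second_difference\<close> the two mixed
  derivatives have a common value at points arbitrarily close to \<open>x\<close>; continuity does the rest.\<close>

lemma dd_commute_real:
  fixes f :: "'a::real_normed_vector \<Rightarrow> real"
  assumes U: "open U" "x \<in> U" and C2: "Ck_on 2 U f"
  shows "dd v (\<lambda>y. dd u f y) x = dd u (\<lambda>y. dd v f y) x"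
proof (rule ccontr)
  let ?A = "dd v (\<lambda>z. dd u f z)" and ?B = "dd u (\<lambda>z. dd v f z)"
  have C2': "Ck_on (Suc (Suc 0)) U f" using C2 by (simp add: numeral_2_eq_2)
  then have d1: "f differentiable at y" and d2: "(\<lambda>z. dd w f z) differentiable at y" if "y \<in> U" for y w
    using that by simp_all
  have "continuous_on U ?A" "continuous_on U ?B"
    using C2' by simp_all
  then have cont: "continuous (at x) ?A" "continuous (at x) ?B"
    using U by (simp_all add: continuous_on_eq_continuous_at)
  assume ne: "?A x \<noteq> ?B x"
  define e where "e = dist (?A x) (?B x) / 2"
  have e: "e > 0" using ne by (simp add: e_def)
  have "\<exists>d>0. \<forall>y. dist y x < d \<longrightarrow> dist (?A y) (?A x) < e"
    using cont(1) e unfolding continuous_at_eps_delta by blast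
  moreover have "\<exists>d>0. \<forall>y. dist y x < d \<longrightarrow> dist (?B y) (?B x) < e"
    using cont(2) e unfolding continuous_at_eps_delta by blast
  ultimately obtain d1' d2' where d: "d1' > 0" "\<And>y. dist y x < d1' \<Longrightarrow> dist (?A y) (?A x) < e"
      "d2' > 0" "\<And>y. dist y x < d2' \<Longrightarrow> dist (?B y) (?B x) < e"
    by blast
  obtain r where r: "r > 0" "cball x r \<subseteq> U"
    using U open_contains_cball by blast
  define m where "m = Min {d1' / 2, d2' / 2, r}"
  have m: "m > 0" "m \<le> r" "m < d1'" "m < d2'" using d r by (auto simp: m_def)
  define t where "t = m / (norm u + norm v + 1)"
  have pos: "norm u + norm v + 1 > 0" by (simp add: add_nonneg_pos)
  have t: "t > 0" using m pos by (simp add: t_def)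
  have le: "t * (norm u + norm v) \<le> m"
    using m pos by (simp add: t_def field_simps)
  have sub: "cball x (t * (norm u + norm v)) \<subseteq> U" "cball x (t * (norm v + norm u)) \<subseteq> U"
    using le m r by (auto simp: add.commute)
  obtain \<xi> where xi: "\<xi> \<in> cball x (t * (norm u + norm v))"
    "f (x + t *\<^sub>R u + t *\<^sub>R v) - f (x + t *\<^sub>R u) - f (x + t *\<^sub>R v) + f x = t\<^sup>2 * ?A \<xi>"
    by (rule second_difference[OF d1 d2 t sub(1)])
  obtain \<eta> where eta: "\<eta> \<in> cball x (t * (norm v + norm u))"
    "f (x + t *\<^sub>R v + t *\<^sub>R u) - f (x + t *\<^sub>R v) - f (x + t *\<^sub>R u) + f x = t\<^sup>2 * ?B \<eta>"
    by (rule second_difference[OF d1 d2 t sub(2)])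
  have comm: "x + t *\<^sub>R v + t *\<^sub>R u = x + t *\<^sub>R u + t *\<^sub>R v" by simp
  have "t\<^sup>2 * ?A \<xi> = t\<^sup>2 * ?B \<eta>"
    using xi(2) eta(2) unfolding comm by linarith
  then have "?A \<xi> = ?B \<eta>" using t by simp
  moreover have "dist (?A \<xi>) (?A x) < e" "dist (?B \<eta>) (?B x) < e"
    using d(2)[of \<xi>] d(4)[of \<eta>] xi(1) eta(1) le m by (simp_all add: dist_commute add.commute)
  ultimately have "dist (?A x) (?B x) < e + e"
    using dist_triangle3[of "?A x" "?B x" "?A \<xi>"] by (simp add: dist_commute)
  then show False by (simp add: e_def)
qed

lemma dd_commute:
  fixes f :: "'a::real_normed_vector \<Rightarrow> 'b::euclidean_space"
  assumes U: "open U" "x \<in> U" and C2: "Ck_on 2 U f"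
  shows "dd v (\<lambda>y. dd u f y) x = dd u (\<lambda>y. dd v f y) x"
proof (rule euclidean_eqI)
  fix b :: 'b
  have L: "bounded_linear (\<lambda>z. z \<bullet> b)" by (rule bounded_linear_inner_left)
  have C2': "Ck_on (Suc (Suc 0)) U f" using C2 by (simp add: numeral_2_eq_2)
  have d1: "f differentiable at y" and d2: "(\<lambda>z. dd w f z) differentiable at y" if "y \<in> U" for y w
    using C2' that by simp_all
  have "dd v (\<lambda>y. dd u f y) x \<bullet> b = dd v (\<lambda>y. dd u (\<lambda>z. f z \<bullet> b) y) x" for u v
  proof -
    have "dd v (\<lambda>y. dd u f y) x \<bullet> b = dd v (\<lambda>y. dd u f y \<bullet> b) x"
      by (rule dd_bounded_linear(1)[OF L d2[OF U(2)], symmetric])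
    also have "\<dots> = dd v (\<lambda>y. dd u (\<lambda>z. f z \<bullet> b) y) x"
      by (rule dd_cong(1)[OF U dd_bounded_linear(2)[OF L d2[OF U(2)]]])
        (simp add: dd_bounded_linear(1)[OF L d1])
    finally show ?thesis .
  qed
  then show "dd v (\<lambda>y. dd u f y) x \<bullet> b = dd u (\<lambda>y. dd v f y) x \<bullet> b"
    using dd_commute_real[OF U Ck_on_bounded_linear[OF U(1) L C2]] by simp
qed

lemma bounded_linear_vec_insert: "bounded_linear (\<lambda>z::'b::euclidean_space. (\<chi> j. if j = i then z else 0) :: 'b^'n)"
  by (rule linear_conv_bounded_linear[THEN iffD1], rule linearI) (auto simp: vec_eq_iff)

lemma differentiable_vec_lambda:
  fixes f :: "'a::real_normed_vector \<Rightarrow> 'n::finite \<Rightarrow> 'b::euclidean_space"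
  assumes "\<And>i. (\<lambda>x. f x i) differentiable at x"
  shows "(\<lambda>x. \<chi> i. f x i) differentiable at x"
proof -
  have "(\<lambda>x. \<chi> i. f x i) = (\<lambda>x. \<Sum>i\<in>UNIV. (\<chi> j. if j = i then f x i else 0))"
    by (auto simp: vec_eq_iff)
  moreover have "\<dots> differentiable at x"
    by (intro differentiable_sum ballI dd_bounded_linear(2)[OF bounded_linear_vec_insert] assms) simp
  ultimately show ?thesis by simp
qed

lemma differentiable_det:
  fixes A :: "'a::real_normed_vector \<Rightarrow> real^'n^'n"
  assumes "\<And>i j. (\<lambda>x. A x $ i $ j) differentiable at x"
  shows "(\<lambda>x. det (A x)) differentiable at x"
proof -
  have "(\<lambda>x. \<Prod>i\<in>UNIV. A x $ i $ p i) differentiable at x" for p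
  proof -
    have "((\<lambda>x. \<Prod>i\<in>UNIV. A x $ i $ p i) has_derivative
        (\<lambda>y. \<Sum>i\<in>UNIV. dd y (\<lambda>x. A x $ i $ p i) x * (\<Prod>j\<in>UNIV - {i}. A x $ j $ p j))) (at x)"
      using assms unfolding frechet_derivative_works by (intro has_derivative_prod) auto
    then show ?thesis by (rule differentiableI)
  qed
  then show ?thesis
    unfolding det_def by (intro differentiable_sum differentiable_mult) (auto simp: finite_permutations)
qed

lemma matrix_inverse:
  assumes "det (g :: real^'n^'n) \<noteq> 0"
  shows "g ** matrix_inv g = mat 1" "matrix_inv g ** g = mat 1"
  using assms invertible_det_nz[of g] unfolding invertible_def matrix_inv_def
  by (metis (mono_tags, lifting) someI_ex)+

text \<open>Cramer's rule. It makes the inverse differentiable, since the determinant is a polynomial.\<close>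

lemma matrix_inv_entry:
  fixes A :: "real^'n^'n"
  assumes "det A \<noteq> 0"
  shows "matrix_inv A $ k $ j = det (\<chi> i l. if l = k then axis j 1 $ i else A $ i $ l) / det A"
proof -
  have "A *v (matrix_inv A *v axis j 1) = axis j 1"
    by (simp add: matrix_vector_mul_assoc matrix_inverse(1)[OF assms])
  then have "matrix_inv A *v axis j 1 = (\<chi> k. det (\<chi> i l. if l = k then axis j 1 $ i else A $ i $ l) / det A)"
    using cramer[OF assms] by blast
  moreover have "(matrix_inv A *v axis j 1) $ k = matrix_inv A $ k $ j"
    by (simp add: matrix_vector_mult_basis column_def)
  ultimately show ?thesis by simp
qed

lemma bounded_bilinear_matrix_mult: "bounded_bilinear ((**) :: real^'n^'m \<Rightarrow> real^'p^'n \<Rightarrow> real^'p^'m)"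
  by (rule bilinear_conv_bounded_bilinear[THEN iffD1], unfold bilinear_def)
    (auto intro!: linearI simp: vec_eq_iff matrix_matrix_mult_def sum.distrib algebra_simps sum_distrib_left)

lemma bounded_bilinear_matrix_vector: "bounded_bilinear ((*v) :: real^'n^'m \<Rightarrow> real^'n \<Rightarrow> real^'m)"
  by (rule bilinear_conv_bounded_bilinear[THEN iffD1], unfold bilinear_def)
    (auto intro!: linearI simp: vec_eq_iff matrix_vector_mult_def sum.distrib algebra_simps sum_distrib_left)

lemma dd_matrix_inv:
  fixes A :: "'a::real_normed_vector \<Rightarrow> real^'n^'n"
  assumes U: "open U" "x \<in> U" and nz: "\<And>y. y \<in> U \<Longrightarrow> det (A y) \<noteq> 0" and d: "A differentiable at x"
  shows "(\<lambda>y. matrix_inv (A y)) differentiable at x"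
    "dd v (\<lambda>y. matrix_inv (A y)) x = - (matrix_inv (A x) ** dd v A x ** matrix_inv (A x))"
proof -
  have e: "(\<lambda>x. A x $ i $ j) differentiable at x" for i j
    by (rule dd_bounded_linear(2)[OF bounded_linear_vec_nth dd_bounded_linear(2)[OF bounded_linear_vec_nth d]])
  have "(\<lambda>y. \<chi> k j. det (\<chi> i l. if l = k then axis j 1 $ i else A y $ i $ l) / det (A y)) differentiable at x"
  proof (intro differentiable_vec_lambda differentiable_divide differentiable_det)
    show "(\<lambda>x. (\<chi> i l. if l = k then axis j 1 $ i else A x $ i $ l) $ ia $ ja) differentiable at x" for k j ia ja
      using e by (cases "ja = k") simp_all
  qed (use e nz U in auto)
  then show D: "(\<lambda>y. matrix_inv (A y)) differentiable at x"
    by (rule dd_cong(2)[OF U]) (simp add: vec_eq_iff matrix_inv_entry nz)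
  have inv: "A y ** matrix_inv (A y) = mat 1" "matrix_inv (A y) ** A y = mat 1" if "y \<in> U" for y
    by (rule matrix_inverse[OF nz[OF that]])+
  have "dd v (\<lambda>y. A y ** matrix_inv (A y)) x = dd v (\<lambda>y. mat 1 :: real^'n^'n) x"
    by (rule dd_cong(1)[OF U dd_bounded_bilinear(2)[OF bounded_bilinear_matrix_mult d D]]) (rule inv)
  then have "A x ** dd v (\<lambda>y. matrix_inv (A y)) x + dd v A x ** matrix_inv (A x) = 0"
    by (simp add: dd_bounded_bilinear(1)[OF bounded_bilinear_matrix_mult d D])
  then have "A x ** dd v (\<lambda>y. matrix_inv (A y)) x = - (dd v A x ** matrix_inv (A x))"
    by (simp only: eq_neg_iff_add_eq_0)
  then have "matrix_inv (A x) ** (A x ** dd v (\<lambda>y. matrix_inv (A y)) x) = matrix_inv (A x) ** (- (dd v A x ** matrix_inv (A x)))"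
    by simp
  moreover have "matrix_inv (A x) ** (- B) = - (matrix_inv (A x) ** B)" for B :: "real^'n^'n"
    by (rule bounded_bilinear.minus_right[OF bounded_bilinear_matrix_mult])
  ultimately show "dd v (\<lambda>y. matrix_inv (A y)) x = - (matrix_inv (A x) ** dd v A x ** matrix_inv (A x))"
    by (simp add: matrix_mul_assoc inv[OF U(2)])
qed

text \<open>The derivative \<open>- A\<^sup>-\<^sup>1 A' A\<^sup>-\<^sup>1\<close> is a product of \<open>A'\<close> with the inverse itself, so the order of
  differentiability of the inverse increases by one in each step.\<close>

lemma Ck_on_matrix_inv:
  fixes A :: "'a::real_normed_vector \<Rightarrow> real^'n^'n"
  assumes U: "open U" and nz: "\<And>y. y \<in> U \<Longrightarrow> det (A y) \<noteq> 0" and A: "\<And>k. Ck_on k U A"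
  shows "Ck_on k U (\<lambda>y. matrix_inv (A y))"
proof (induction k)
  have d: "A differentiable at x" if "x \<in> U" for x using A[of 1] that by simp
  case 0
  then show ?case
    using dd_matrix_inv(1)[OF U _ nz d] by (auto intro!: continuous_at_imp_continuous_on differentiable_imp_continuous_within)
next
  have d: "A differentiable at x" if "x \<in> U" for x using A[of 1] that by simp
  case (Suc k)
  have "Ck_on k U (\<lambda>x. dd v A x)" for v using A[of "Suc k"] by simp
  then have "Ck_on k U (\<lambda>x. - (matrix_inv (A x) ** dd v A x ** matrix_inv (A x)))" for v
    by (intro Ck_on_bounded_linear[OF U bounded_linear_minus[OF bounded_linear_ident]]
        Ck_on_bounded_bilinear[OF U bounded_bilinear_matrix_mult] Suc)
  then have "Ck_on k U (\<lambda>x. dd v (\<lambda>y. matrix_inv (A y)) x)" for v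
    by (rule Ck_on_cong[OF U, rotated]) (simp add: dd_matrix_inv(2)[OF U _ nz d])
  then show ?case using dd_matrix_inv(1)[OF U _ nz d] by simp
qed

section \<open>Curvature of a metric whose torsion is a constant multiple of it\<close>

lemma metric_det:
  assumes "metric_vol_of \<phi> g v"
  shows "det g \<noteq> 0"
proof -
  have "v\<^sup>2 = det g" using assms by (simp add: metric_vol_of_def)
  then show ?thesis using metric_vol_nonzero[OF assms] by auto
qed

lemma metric_vol_sym:
  assumes "metric_vol_of \<phi> g v"
  shows "g$i$j = g$j$i"
proof -
  have "transpose g = g" using assms by (simp add: metric_vol_of_def)
  from arg_cong[OF this, of "\<lambda>m. m $ j $ i"] show ?thesis
    by (simp add: transpose_def)
qed

lemma linear_eq_axis:
  fixes f f' :: "real^7 \<Rightarrow> 'b::real_vector"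
  assumes "linear f" "linear f'" "\<And>i. f (axis i 1) = f' (axis i 1)"
  shows "f x = f' x"
proof -
  have "f (\<Sum>i\<in>UNIV. x$i *\<^sub>R axis i 1) = f' (\<Sum>i\<in>UNIV. x$i *\<^sub>R axis i 1)"
    by (simp add: linear_sum[OF assms(1)] linear_sum[OF assms(2)] linear_scale[OF assms(1)] linear_scale[OF assms(2)] assms(3))
  then show ?thesis using basis_expansion[of x] by (simp add: scalar_mult_eq_scaleR)
qed

lemma gip_axis_right: "gip A u (axis j 1) = (\<Sum>l\<in>UNIV. u$l * A$l$j)"
  by (simp add: gip_def matrix_vector_mult_basis column_def inner_vec_def)

lemma gip_axis_left: "gip A (axis i 1) u = (\<Sum>l\<in>UNIV. A$i$l * u$l)"
  by (simp add: gip_def inner_axis' matrix_vector_mult_def)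

lemma gip_axis_axis: "gip A (axis i 1) (axis j 1) = A$i$j"
proof -
  have "gip A (axis i 1) (axis j 1) = (\<Sum>l\<in>UNIV. A$l$j * axis i 1 $ l)"
    by (simp only: gip_axis_right mult.commute)
  then show ?thesis by (simp only: sum_axis)
qed

lemma tri_axis_23: "tri \<phi> u (axis j 1) (axis k 1) = (\<Sum>l\<in>UNIV. \<phi>$l$j$k * u$l)"
proof -
  have "tri \<phi> (\<Sum>l\<in>UNIV. u$l *\<^sub>R axis l 1) (axis j 1) (axis k 1) = (\<Sum>l\<in>UNIV. \<phi>$l$j$k * u$l)"
    by (simp add: tri_sum_left tri_simps tri_axis mult.commute)
  then show ?thesis using basis_expansion[of u] by (simp add: scalar_mult_eq_scaleR)
qed

lemma tri_axis_13: "tri \<phi> (axis i 1) u (axis k 1) = (\<Sum>l\<in>UNIV. \<phi>$i$l$k * u$l)"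
proof -
  have "tri \<phi> (axis i 1) (\<Sum>l\<in>UNIV. u$l *\<^sub>R axis l 1) (axis k 1) = (\<Sum>l\<in>UNIV. \<phi>$i$l$k * u$l)"
    by (simp add: tri_sum_middle tri_simps tri_axis mult.commute)
  then show ?thesis using basis_expansion[of u] by (simp add: scalar_mult_eq_scaleR)
qed

lemma tri_axis_12: "tri \<phi> (axis i 1) (axis j 1) u = (\<Sum>l\<in>UNIV. \<phi>$i$j$l * u$l)"
proof -
  have "tri \<phi> (axis i 1) (axis j 1) (\<Sum>l\<in>UNIV. u$l *\<^sub>R axis l 1) = (\<Sum>l\<in>UNIV. \<phi>$i$j$l * u$l)"
    by (simp add: tri_sum_right tri_simps tri_axis mult.commute)
  then show ?thesis using basis_expansion[of u] by (simp add: scalar_mult_eq_scaleR)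
qed

lemma quad_axis: "quad \<beta> (axis i 1) (axis j 1) (axis k 1) (axis l 1) = \<beta>$i$j$k$l"
  unfolding quad_def mult.assoc[symmetric] sum_axis ..

lemma linear_gip: "linear (\<lambda>A. gip A u w)" "linear (\<lambda>u. gip A u w)" "linear (\<lambda>w. gip A u w)"
proof -
  show "linear (\<lambda>A. gip A u w)"
    by (rule linearI) (simp_all add: gip_def matrix_vector_mult_add_rdistrib scaleR_matrix_vector_assoc[symmetric] inner_add_right)
qed (rule linearI; simp add: gip_simps)+

lemma linear_tri: "linear (\<lambda>\<alpha>. tri \<alpha> u v w)" "linear (\<lambda>u. tri \<alpha> u v w)" "linear (\<lambda>v. tri \<alpha> u v w)" "linear (\<lambda>w. tri \<alpha> u v w)"
proof -
  show "linear (\<lambda>\<alpha>. tri \<alpha> u v w)"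
    by (rule linearI) (simp_all add: tri_def sum.distrib sum_distrib_left algebra_simps)
qed (rule linearI; simp add: tri_simps)+

text \<open>The matrix of the connection form evaluated on \<open>x\<close>, so that \<open>\<nabla>\<^sub>x V = dd x V + Gam g y x *v V\<close>.\<close>

definition Gam :: "(real^7 \<Rightarrow> real^7^7) \<Rightarrow> real^7 \<Rightarrow> real^7 \<Rightarrow> real^7^7" where
  "Gam g y x = (\<chi> l i. \<Sum>a\<in>UNIV. christoffel g y $ l $ a $ i * x $ a)"

lemma Gam_axis: "Gam g y (axis m 1) = (\<chi> l i. christoffel g y $ l $ m $ i)"
  by (simp add: Gam_def sum_axis)

lemma Gam_axis_axis: "Gam g y (axis m 1) *v axis i 1 = (\<chi> l. christoffel g y $ l $ m $ i)"
  by (simp add: Gam_axis matrix_vector_mult_basis column_def)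

lemma linear_Gam: "linear (\<lambda>x. Gam g y x)" "linear (\<lambda>x. Gam g y x *v u)" "linear (\<lambda>u. Gam g y x *v u)"
  by (rule linearI; simp add: vec_eq_iff Gam_def matrix_vector_mult_def sum.distrib sum_distrib_left algebra_simps)+

lemma bounded_linear_Gam: "bounded_linear (\<lambda>\<Gamma>::real^7^7^7. (\<chi> l i. \<Sum>a\<in>UNIV. \<Gamma> $ l $ a $ i * x $ a) :: real^7^7)"
  by (rule linear_conv_bounded_linear[THEN iffD1], rule linearI)
    (simp_all add: vec_eq_iff sum.distrib sum_distrib_left algebra_simps)

lemma bounded_linear_entry: "bounded_linear (\<lambda>m::'b::real_normed_vector^'n^'m. m $ i $ j)"
  using bounded_linear_compose[OF bounded_linear_vec_nth bounded_linear_vec_nth] by blast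

lemma tri_as_gip: "tri \<alpha> v w u = gip (\<chi> i j. \<Sum>k\<in>UNIV. \<alpha>$i$j$k * u$k) v w"
  by (simp add: tri_def gip_def inner_vec_def matrix_vector_mult_def sum_distrib_left sum_distrib_right mult_ac)

lemma bounded_linear_contract: "bounded_linear (\<lambda>\<alpha>::real^7^7^7. (\<chi> i j. \<Sum>k\<in>UNIV. \<alpha>$i$j$k * u$k) :: real^7^7)"
  by (rule linear_conv_bounded_linear[THEN iffD1], rule linearI)
    (simp_all add: vec_eq_iff sum.distrib sum_distrib_left algebra_simps)

lemma dd_gip:
  assumes "A differentiable at y" "V differentiable at y" "W differentiable at y"
  shows "dd x (\<lambda>z. gip (A z) (V z) (W z)) y = gip (dd x A y) (V y) (W y) + gip (A y) (dd x V y) (W y) + gip (A y) (V y) (dd x W y)"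
    "(\<lambda>z. gip (A z) (V z) (W z)) differentiable at y"
proof -
  note AW = dd_bounded_bilinear[OF bounded_bilinear_matrix_vector assms(1,3)]
  note VAW = dd_bounded_bilinear[OF bounded_bilinear_inner assms(2) AW(2)]
  show "dd x (\<lambda>z. gip (A z) (V z) (W z)) y = gip (dd x A y) (V y) (W y) + gip (A y) (dd x V y) (W y) + gip (A y) (V y) (dd x W y)"
    unfolding gip_def VAW(1) AW(1) by (simp add: inner_add_right)
  show "(\<lambda>z. gip (A z) (V z) (W z)) differentiable at y"
    unfolding gip_def by (rule VAW(2))
qed

lemma dd_tri:
  assumes "A differentiable at y" "V differentiable at y" "W differentiable at y"
  shows "dd x (\<lambda>z. tri (A z) (V z) (W z) u) y = tri (dd x A y) (V y) (W y) u + tri (A y) (dd x V y) (W y) u + tri (A y) (V y) (dd x W y) u"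
    "(\<lambda>z. tri (A z) (V z) (W z) u) differentiable at y"
  using dd_gip[OF dd_bounded_linear(2)[OF bounded_linear_contract[of u] assms(1)] assms(2,3)]
  unfolding tri_as_gip dd_bounded_linear(1)[OF bounded_linear_contract assms(1)] by simp_all

lemma trilinear_eqI:
  fixes F F' :: "real^7 \<Rightarrow> real^7 \<Rightarrow> real^7 \<Rightarrow> real"
  assumes "\<And>v w. linear (\<lambda>u. F u v w)" "\<And>u w. linear (\<lambda>v. F u v w)" "\<And>u v. linear (\<lambda>w. F u v w)"
    "\<And>v w. linear (\<lambda>u. F' u v w)" "\<And>u w. linear (\<lambda>v. F' u v w)" "\<And>u v. linear (\<lambda>w. F' u v w)"
    "\<And>i j k. F (axis i 1) (axis j 1) (axis k 1) = F' (axis i 1) (axis j 1) (axis k 1)"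
  shows "F u v w = F' u v w"
proof -
  have "F (axis i 1) (axis j 1) w = F' (axis i 1) (axis j 1) w" for i j w
    by (rule linear_eq_axis[OF assms(3,6,7)])
  then have "F (axis i 1) v w = F' (axis i 1) v w" for i v w
    by (rule linear_eq_axis[OF assms(2,5)])
  then show ?thesis
    by (rule linear_eq_axis[OF assms(1,4)])
qed

text \<open>A coordinate domain with a \<open>G\<^sub>2\<close>-structure whose torsion is \<open>c g\<close>, that is \<open>\<nabla>\<phi> = c \<psi>\<close>.\<close>

locale G2_chart =
  fixes U :: "(real^7) set" and g :: "real^7 \<Rightarrow> real^7^7" and \<phi> :: "real^7 \<Rightarrow> real^7^7^7" and c :: real
  assumes open_U: "open U"
    and g_smooth: "\<And>k. Ck_on k U g"
    and phi_smooth: "\<And>k. Ck_on k U \<phi>"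
    and mv: "\<And>y. y \<in> U \<Longrightarrow> \<exists>v. metric_vol_of (\<phi> y) (g y) v"
    and alt: "\<And>y. y \<in> U \<Longrightarrow> alternating3 (\<phi> y)"
    and torsion: "\<And>y m i j l. y \<in> U \<Longrightarrow> nabla3 g \<phi> y $ m $ i $ j $ l = c * psi (\<phi> y) $ m $ i $ j $ l"
begin

abbreviation "G y \<equiv> gip (g y)"
abbreviation "X y \<equiv> cross (g y) (\<phi> y)"
abbreviation "QQ y \<equiv> cross_product_space.Q (gip (g y)) (cross (g y) (\<phi> y))"

definition nab :: "real^7 \<Rightarrow> (real^7 \<Rightarrow> real^7) \<Rightarrow> real^7 \<Rightarrow> real^7" where
  "nab x V y = dd x V y + Gam g y x *v V y"

lemma
  assumes "y \<in> U"
  shows cross_space: "\<exists>e. cross_product_space (G y) (X y) e"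
    and psi_QQ: "quad (psi (\<phi> y)) a b d z = G y (QQ y a b d) z"
    and G_cross: "G y (X y u w) z = tri (\<phi> y) u w z"
proof -
  obtain v where v: "metric_vol_of (\<phi> y) (g y) v" using mv[OF assms] ..
  obtain P where P: "\<And>i j. gip (g y) (column i P) (column j P) = (if i = j then 1 else 0)" "v * det P = 1" "pull3 P (\<phi> y) = phi_std"
    using G2_normal_form[OF v alt[OF assms]] by blast
  show "\<exists>e. cross_product_space (G y) (X y) e"
    using G2_cross_product_space[OF v alt[OF assms] P] by blast
  show "quad (psi (\<phi> y)) a b d z = G y (QQ y a b d) z"
    by (rule psi_eq_Q[OF v alt[OF assms] P])
  show "G y (X y u w) z = tri (\<phi> y) u w z"
    by (rule gip_cross[OF v alt[OF assms] P])
qed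

lemma g_det: "y \<in> U \<Longrightarrow> det (g y) \<noteq> 0"
  using mv[of y] metric_det by blast

lemma g_sym: "y \<in> U \<Longrightarrow> g y $ i $ j = g y $ j $ i"
  using mv[of y] metric_vol_sym by blast

lemma diff:
  assumes "y \<in> U"
  shows "g differentiable at y" "\<phi> differentiable at y" "(\<lambda>z. dd x g z) differentiable at y"
    "(\<lambda>z. matrix_inv (g z)) differentiable at y"
  using g_smooth[of "Suc (Suc 0)"] phi_smooth[of 1] assms dd_matrix_inv(1)[OF open_U assms g_det] by simp_all

lemma pd_g_sym: "y \<in> U \<Longrightarrow> pd m g y $ i $ j = pd m g y $ j $ i"
proof -
  assume y: "y \<in> U"
  have e: "dd x g y $ i $ j = dd x (\<lambda>z. g z $ i $ j) y" for x i j
    using dd_bounded_linear(1)[OF bounded_linear_entry diff(1)[OF y]] by simp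
  show ?thesis unfolding pd_def e
    by (rule dd_cong(1)[OF open_U y dd_bounded_linear(2)[OF bounded_linear_entry diff(1)[OF y]]]) (rule g_sym)
qed

lemma christoffel_sym: "y \<in> U \<Longrightarrow> christoffel g y $ k $ i $ j = christoffel g y $ k $ j $ i"
  unfolding christoffel_def using pd_g_sym[of y _ i j] by (simp add: add_ac)

lemma christoffel_lower:
  assumes y: "y \<in> U"
  shows "(\<Sum>k\<in>UNIV. christoffel g y $ k $ m $ i * g y $ k $ n) = 1/2 * (pd m g y $ i $ n + pd i g y $ m $ n - pd n g y $ m $ i)"
proof -
  define Z where "Z l = pd m g y $ i $ l + pd i g y $ m $ l - pd l g y $ m $ i" for l
  have "g y ** matrix_inv (g y) = mat 1"
    by (rule matrix_inverse(1)[OF g_det[OF y]])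
  then have gh: "(\<Sum>k\<in>UNIV. g y $ n $ k * matrix_inv (g y) $ k $ l) = (if n = l then 1 else 0)" for l
    by (simp add: vec_eq_iff matrix_matrix_mult_def mat_def)
  have "(\<Sum>k\<in>UNIV. christoffel g y $ k $ m $ i * g y $ k $ n) = (\<Sum>k\<in>UNIV. \<Sum>l\<in>UNIV. 1/2 * (g y $ n $ k * matrix_inv (g y) $ k $ l * Z l))"
    by (simp add: christoffel_def Z_def sum_distrib_left sum_distrib_right g_sym[OF y, of _ n] mult_ac)
  also have "\<dots> = (\<Sum>l\<in>UNIV. \<Sum>k\<in>UNIV. 1/2 * (g y $ n $ k * matrix_inv (g y) $ k $ l * Z l))"
    by (rule sum.swap)
  also have "\<dots> = (\<Sum>l\<in>UNIV. 1/2 * ((\<Sum>k\<in>UNIV. g y $ n $ k * matrix_inv (g y) $ k $ l) * Z l))"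
    by (simp add: sum_distrib_left sum_distrib_right)
  also have "\<dots> = (\<Sum>l\<in>UNIV. if n = l then 1/2 * Z l else 0)"
    unfolding gh by (rule sum.cong) auto
  finally show ?thesis by (simp add: Z_def)
qed

lemma metric_compat:
  assumes y: "y \<in> U"
  shows "pd m g y $ i $ j = (\<Sum>l\<in>UNIV. christoffel g y $ l $ m $ i * g y $ l $ j) + (\<Sum>l\<in>UNIV. christoffel g y $ l $ m $ j * g y $ i $ l)"
proof -
  have "(\<Sum>l\<in>UNIV. christoffel g y $ l $ m $ j * g y $ i $ l) = (\<Sum>l\<in>UNIV. christoffel g y $ l $ m $ j * g y $ l $ i)"
    by (simp add: g_sym[OF y, of i])
  then show ?thesis
    unfolding christoffel_lower[OF y] using pd_g_sym[OF y] by (simp add: field_simps)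
qed

text \<open>The equation \<open>\<nabla>g = 0\<close> without indices.\<close>

lemma dd_metric:
  assumes y: "y \<in> U"
  shows "gip (dd x g y) u w = G y (Gam g y x *v u) w + G y u (Gam g y x *v w)"
proof (rule trilinear_eqI[where F="\<lambda>x u w. gip (dd x g y) u w" and F'="\<lambda>x u w. G y (Gam g y x *v u) w + G y u (Gam g y x *v w)"])
  show "linear (\<lambda>x. gip (dd x g y) u w)" for u w
    using linear_compose[OF dd_linear_direction[OF diff(1)[OF y]] linear_gip(1)] by (simp add: o_def)
  show "linear (\<lambda>x. G y (Gam g y x *v u) w + G y u (Gam g y x *v w))" for u w
    using linear_compose[OF linear_Gam(2) linear_gip(2)] linear_compose[OF linear_Gam(2) linear_gip(3)]
    by (intro linear_compose_add) (simp_all add: o_def)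
  show "linear (\<lambda>u. G y (Gam g y x *v u) w + G y u (Gam g y x *v w))" for x w
    using linear_compose[OF linear_Gam(3) linear_gip(2)] linear_gip(2)
    by (intro linear_compose_add) (simp_all add: o_def)
  show "linear (\<lambda>w. G y (Gam g y x *v u) w + G y u (Gam g y x *v w))" for x u
    using linear_compose[OF linear_Gam(3) linear_gip(3)] linear_gip(3)
    by (intro linear_compose_add) (simp_all add: o_def)
  show "gip (dd (axis m 1) g y) (axis i 1) (axis j 1)
    = G y (Gam g y (axis m 1) *v axis i 1) (axis j 1) + G y (axis i 1) (Gam g y (axis m 1) *v axis j 1)" for m i j
    using metric_compat[OF y, of m i j]
    unfolding Gam_axis_axis gip_axis_axis gip_axis_right[of "g y" "vec_lambda _"] gip_axis_left[of "g y" i "vec_lambda _"]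
    by (simp add: pd_def mult.commute)
qed (rule linear_gip)+

text \<open>The equation \<open>\<nabla>\<phi> = c \<psi>\<close> without indices.\<close>

lemma dd_phi:
  assumes y: "y \<in> U"
  shows "tri (dd x \<phi> y) u v w = tri (\<phi> y) (Gam g y x *v u) v w + tri (\<phi> y) u (Gam g y x *v v) w
    + tri (\<phi> y) u v (Gam g y x *v w) + c * quad (psi (\<phi> y)) x u v w"
proof -
  let ?R = "\<lambda>x u v w. tri (\<phi> y) (Gam g y x *v u) v w + tri (\<phi> y) u (Gam g y x *v v) w
    + tri (\<phi> y) u v (Gam g y x *v w) + c * quad (psi (\<phi> y)) x u v w"
  have Rlin: "linear (\<lambda>x. ?R x u v w)" "linear (\<lambda>u. ?R x u v w)" "linear (\<lambda>v. ?R x u v w)" "linear (\<lambda>w. ?R x u v w)" for x u v w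
    by (rule linearI; simp add: linear_add[OF linear_Gam(2)] linear_scale[OF linear_Gam(2)] linear_add[OF linear_Gam(3)] linear_scale[OF linear_Gam(3)]
      tri_simps linear_add[OF quad_linear(1)] linear_add[OF quad_linear(2)] linear_add[OF quad_linear(3)] linear_add[OF quad_linear(4)]
      linear_scale[OF quad_linear(1)] linear_scale[OF quad_linear(2)] linear_scale[OF quad_linear(3)] linear_scale[OF quad_linear(4)] algebra_simps)+
  have Llin: "linear (\<lambda>x. tri (dd x \<phi> y) u v w)" for u v w
    using linear_compose[OF dd_linear_direction[OF diff(2)[OF y]] linear_tri(1)] by (simp add: o_def)
  have "tri (dd (axis m 1) \<phi> y) u v w = ?R (axis m 1) u v w" for m u v w
  proof (rule trilinear_eqI[where F="\<lambda>u v w. tri (dd (axis m 1) \<phi> y) u v w" and F'="\<lambda>u v w. ?R (axis m 1) u v w"])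
    fix i j k
    show "tri (dd (axis m 1) \<phi> y) (axis i 1) (axis j 1) (axis k 1) = ?R (axis m 1) (axis i 1) (axis j 1) (axis k 1)"
      using torsion[OF y, of m i j k]
      unfolding Gam_axis_axis tri_axis quad_axis tri_axis_23[of _ "vec_lambda _"] tri_axis_13[of _ _ "vec_lambda _"] tri_axis_12[of _ _ _ "vec_lambda _"]
      by (simp add: nabla3_def pd_def mult.commute algebra_simps)
  qed (rule linear_tri Rlin)+
  then show ?thesis
    by (rule linear_eq_axis[OF Llin Rlin(1), THEN trans[OF _ refl]])
qed

lemma dd_G:
  assumes y: "y \<in> U" and V: "V differentiable at y" "W differentiable at y"
  shows "dd x (\<lambda>z. G z (V z) (W z)) y = G y (nab x V y) (W y) + G y (V y) (nab x W y)"
  unfolding dd_gip(1)[OF diff(1)[OF y] V] dd_metric[OF y] nab_def by (simp add: gip_simps)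

lemma cross_diff:
  assumes y: "y \<in> U" and V: "V differentiable at y" "W differentiable at y"
  shows "(\<lambda>z. X z (V z) (W z)) differentiable at y"
  unfolding cross_def
  by (intro dd_bounded_bilinear(2)[OF bounded_bilinear_matrix_vector] diff(4)[OF y] differentiable_vec_lambda
      dd_tri(2) diff(2)[OF y] V)

text \<open>Differentiating \<open>g(V \<times> W, u) = \<phi>(V, W, u)\<close> gives this, since the metric is parallel and the
  derivative of \<open>\<phi>\<close> is \<open>c \<psi>\<close>, with \<open>\<psi>\<close> given by \<open>Q\<close>.\<close>

lemma nab_cross:
  assumes y: "y \<in> U" and V: "V differentiable at y" "W differentiable at y"
  shows "nab x (\<lambda>z. X z (V z) (W z)) y = X y (nab x V y) (W y) + X y (V y) (nab x W y) + c *\<^sub>R QQ y x (V y) (W y)"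
proof -
  obtain e where cps: "cross_product_space (G y) (X y) e" using cross_space[OF y] by blast
  interpret cross_product_space "G y" "X y" e by (rule cps)
  show ?thesis
  proof (rule vector_eqI)
    fix u
    have "dd x (\<lambda>z. G z (X z (V z) (W z)) u) y = dd x (\<lambda>z. tri (\<phi> z) (V z) (W z) u) y"
    proof (rule dd_cong(1)[OF open_U y])
      show "(\<lambda>z. G z (X z (V z) (W z)) u) differentiable at y"
        by (rule dd_gip(2)[OF diff(1)[OF y] cross_diff[OF y V]]) simp
      fix z assume "z \<in> U"
      then show "G z (X z (V z) (W z)) u = tri (\<phi> z) (V z) (W z) u" by (rule G_cross)
    qed
    moreover have "dd x (\<lambda>z. G z (X z (V z) (W z)) u) y = G y (nab x (\<lambda>z. X z (V z) (W z)) y) u + G y (X y (V y) (W y)) (Gam g y x *v u)"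
      using dd_G[OF y cross_diff[OF y V], of "\<lambda>_. u"] by (simp add: nab_def[of x "\<lambda>_. u"])
    moreover have "dd x (\<lambda>z. tri (\<phi> z) (V z) (W z) u) y = tri (\<phi> y) (nab x V y) (W y) u + tri (\<phi> y) (V y) (nab x W y) u
        + tri (\<phi> y) (V y) (W y) (Gam g y x *v u) + c * G y (QQ y x (V y) (W y)) u"
      unfolding dd_tri(1)[OF diff(2)[OF y] V] dd_phi[OF y] nab_def psi_QQ[OF y] by (simp add: tri_simps)
    ultimately show "G y (nab x (\<lambda>z. X z (V z) (W z)) y) u
        = G y (X y (nab x V y) (W y) + X y (V y) (nab x W y) + c *\<^sub>R QQ y x (V y) (W y)) u"
      by (simp add: ip_simps G_cross[OF y])
  qed
qed

lemma nab_diff: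
  assumes "V differentiable at y" "W differentiable at y"
  shows "nab x (\<lambda>z. V z - W z) y = nab x V y - nab x W y"
  unfolding nab_def dd_diff[OF assms] by (simp add: matrix_vector_mult_diff_distrib)

lemma nab_add:
  assumes "V differentiable at y" "W differentiable at y"
  shows "nab x (\<lambda>z. V z + W z) y = nab x V y + nab x W y"
  unfolding nab_def dd_add[OF assms] by (simp add: matrix_vector_right_distrib)

lemma nab_scale:
  fixes f :: "real^7 \<Rightarrow> real"
  assumes "f differentiable at y" "V differentiable at y"
  shows "nab x (\<lambda>z. f z *\<^sub>R V z) y = dd x f y *\<^sub>R V y + f y *\<^sub>R nab x V y"
  unfolding nab_def dd_bounded_bilinear(1)[OF bounded_bilinear_scaleR assms]
  by (simp add: matrix_vector_mult_scaleR algebra_simps)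

lemma QQ_eq: "y \<in> U \<Longrightarrow> QQ y a b u = G y a u *\<^sub>R b - G y b u *\<^sub>R a - X y (X y a b) u"
proof -
  assume "y \<in> U"
  then obtain e where "cross_product_space (G y) (X y) e" using cross_space by blast
  then show ?thesis by (rule cross_product_space.Q_def)
qed

lemma QQ_diff:
  assumes y: "y \<in> U" and d: "B differentiable at y" "V differentiable at y" "W differentiable at y"
  shows "(\<lambda>z. QQ z (B z) (V z) (W z)) differentiable at y"
proof (rule dd_cong(2)[OF open_U y])
  show "(\<lambda>z. G z (B z) (W z) *\<^sub>R V z - G z (V z) (W z) *\<^sub>R B z - X z (X z (B z) (V z)) (W z)) differentiable at y"
    by (intro differentiable_diff differentiable_scaleR dd_gip(2) cross_diff y d diff(1))
qed (simp add: QQ_eq)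

lemma nab_cong:
  assumes y: "y \<in> U" and d: "V differentiable at y" and eq: "\<And>z. z \<in> U \<Longrightarrow> V z = W z"
  shows "nab x V y = nab x W y"
  unfolding nab_def using dd_cong(1)[OF open_U y d eq] eq[OF y] by simp

text \<open>\<open>Q\<close> is made from the metric, which is parallel, and an iterated cross product; each of the two
  cross products contributes one torsion term.\<close>

lemma nab_QQ:
  assumes y: "y \<in> U" and d: "B differentiable at y" "V differentiable at y" "W differentiable at y"
  shows "nab x (\<lambda>z. QQ z (B z) (V z) (W z)) y = QQ y (nab x B y) (V y) (W y) + QQ y (B y) (nab x V y) (W y)
    + QQ y (B y) (V y) (nab x W y) - c *\<^sub>R (X y (QQ y x (B y) (V y)) (W y) + QQ y x (X y (B y) (V y)) (W y))"
proof -
  obtain e where cps: "cross_product_space (G y) (X y) e" using cross_space[OF y] by blast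
  interpret cross_product_space "G y" "X y" e by (rule cps)
  have "nab x (\<lambda>z. QQ z (B z) (V z) (W z)) y
      = nab x (\<lambda>z. G z (B z) (W z) *\<^sub>R V z - G z (V z) (W z) *\<^sub>R B z - X z (X z (B z) (V z)) (W z)) y"
    by (rule nab_cong[OF y QQ_diff[OF y d]]) (rule QQ_eq)
  also have "\<dots> = (G y (nab x B y) (W y) + G y (B y) (nab x W y)) *\<^sub>R V y + G y (B y) (W y) *\<^sub>R nab x V y
      - ((G y (nab x V y) (W y) + G y (V y) (nab x W y)) *\<^sub>R B y + G y (V y) (W y) *\<^sub>R nab x B y)
      - (X y (X y (nab x B y) (V y) + X y (B y) (nab x V y) + c *\<^sub>R QQ y x (B y) (V y)) (W y)
         + X y (X y (B y) (V y)) (nab x W y) + c *\<^sub>R QQ y x (X y (B y) (V y)) (W y))"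
    by (simp add: nab_diff nab_scale dd_G nab_cross y d diff(1) cross_diff dd_gip(2))
  also have "\<dots> = QQ y (nab x B y) (V y) (W y) + QQ y (B y) (nab x V y) (W y)
    + QQ y (B y) (V y) (nab x W y) - c *\<^sub>R (X y (QQ y x (B y) (V y)) (W y) + QQ y x (X y (B y) (V y)) (W y))"
    unfolding Q_def[of "nab x B y"] Q_def[of "B y"] by (simp add: cr_simps algebra_simps)
  finally show ?thesis .
qed

lemma Gam_commute: "y \<in> U \<Longrightarrow> Gam g y a *v b = Gam g y b *v a"
proof -
  assume y: "y \<in> U"
  have "Gam g y (axis i 1) *v b = Gam g y b *v axis i 1" for i b
    by (rule linear_eq_axis[OF linear_Gam(3) linear_Gam(2)])
      (simp add: Gam_axis_axis christoffel_sym[OF y, of _ i])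
  then show ?thesis
    by (rule linear_eq_axis[OF linear_Gam(2) linear_Gam(3)])
qed

lemma christoffel_diff:
  assumes y: "y \<in> U"
  shows "christoffel g differentiable at y"
proof -
  have e: "(\<lambda>x. matrix_inv (g x) $ k $ l) differentiable at y" "(\<lambda>x. pd i g x $ j $ l) differentiable at y" for i j k l
    unfolding pd_def by (rule dd_bounded_linear(2)[OF bounded_linear_entry diff(4)[OF y]], rule dd_bounded_linear(2)[OF bounded_linear_entry diff(3)[OF y]])
  have "(\<lambda>x. christoffel g x) differentiable at y"
    unfolding christoffel_def
    by (intro differentiable_vec_lambda differentiable_mult differentiable_sum ballI differentiable_add differentiable_diff differentiable_const e) simp
  then show ?thesis by simp
qed

lemma Gam_diff: "y \<in> U \<Longrightarrow> (\<lambda>z. Gam g z b) differentiable at y"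
  unfolding Gam_def by (rule dd_bounded_linear(2)[OF bounded_linear_Gam christoffel_diff])

lemma Gam_vec_diff: "y \<in> U \<Longrightarrow> V differentiable at y \<Longrightarrow> (\<lambda>z. Gam g z b *v V z) differentiable at y"
  by (rule dd_bounded_bilinear(2)[OF bounded_bilinear_matrix_vector Gam_diff])

text \<open>The curvature operator \<open>R(a, b)\<close> as a matrix, from the second structure equation.\<close>

definition Rm :: "real^7 \<Rightarrow> real^7 \<Rightarrow> real^7 \<Rightarrow> real^7^7" where
  "Rm y a b = dd a (\<lambda>z. Gam g z b) y - dd b (\<lambda>z. Gam g z a) y + Gam g y a ** Gam g y b - Gam g y b ** Gam g y a"

text \<open>Second derivatives commute, so only the connection forms are left in the commutator.\<close>

lemma ricci_identity:
  assumes y: "y \<in> U" and V: "Ck_on 2 U V"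
  shows "nab a (\<lambda>z. nab b V z) y - nab b (\<lambda>z. nab a V z) y = Rm y a b *v V y"
proof -
  have C2: "Ck_on (Suc (Suc 0)) U V" using V by (simp add: numeral_2_eq_2)
  then have d: "V differentiable at y" "(\<lambda>z. dd b V z) differentiable at y" for b
    using y by simp_all
  have n: "nab a (\<lambda>z. nab b V z) y = dd a (\<lambda>z. dd b V z) y + (Gam g y b *v dd a V y + dd a (\<lambda>z. Gam g z b) y *v V y)
      + Gam g y a *v (dd b V y + Gam g y b *v V y)" for a b
    unfolding nab_def dd_add[OF d(2) Gam_vec_diff[OF y d(1)]]
      dd_bounded_bilinear(1)[OF bounded_bilinear_matrix_vector Gam_diff[OF y] d(1)] ..
  show ?thesis
    unfolding n Rm_def dd_commute[OF open_U y V, of a b]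
    by (simp add: matrix_vector_mult_add_rdistrib matrix_vector_mult_diff_rdistrib matrix_vector_right_distrib
      matrix_vector_mul_assoc[symmetric] algebra_simps)
qed

lemma nab_const: "nab x (\<lambda>_. u) = (\<lambda>y. Gam g y x *v u)"
  by (simp add: nab_def fun_eq_iff)

lemma Rm_const: "y \<in> U \<Longrightarrow> Rm y a b *v u = nab a (\<lambda>z. Gam g z b *v u) y - nab b (\<lambda>z. Gam g z a *v u) y"
  using ricci_identity[of y "\<lambda>_. u" a b, OF _ Ck_on_const] by (simp add: nab_const)

text \<open>The second derivatives of the function \<open>g(u, w)\<close> commute and the metric is parallel.\<close>

lemma Rm_skew:
  assumes y: "y \<in> U"
  shows "G y (Rm y a b *v u) w = - G y u (Rm y a b *v w)"
proof -
  let ?f = "\<lambda>z. G z u w"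
  have lin: "bounded_linear (\<lambda>A. gip A u w)"
    using linear_gip(1) by (simp add: linear_conv_bounded_linear)
  have C2: "Ck_on 2 U ?f" by (rule Ck_on_bounded_linear[OF open_U lin g_smooth])
  have d1: "dd b ?f z = G z (Gam g z b *v u) w + G z u (Gam g z b *v w)" if "z \<in> U" for b z
    using dd_G[OF that, of "\<lambda>_. u" "\<lambda>_. w" b] by (simp add: nab_const)
  have dif: "(\<lambda>z. dd b ?f z) differentiable at y" for b
    using C2 y by (simp add: numeral_2_eq_2)
  have d2: "dd a (\<lambda>z. dd b ?f z) y = G y (nab a (\<lambda>z. Gam g z b *v u) y) w + G y (Gam g y b *v u) (Gam g y a *v w)
      + (G y (Gam g y a *v u) (Gam g y b *v w) + G y u (nab a (\<lambda>z. Gam g z b *v w) y))" for a b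
  proof -
    have g1: "(\<lambda>z. Gam g z b *v u) differentiable at y" "(\<lambda>z. Gam g z b *v w) differentiable at y"
      by (rule Gam_vec_diff[OF y], simp)+
    have "dd a (\<lambda>z. dd b ?f z) y = dd a (\<lambda>z. G z (Gam g z b *v u) w + G z u (Gam g z b *v w)) y"
      by (rule dd_cong(1)[OF open_U y dif]) (rule d1)
    also have "\<dots> = dd a (\<lambda>z. G z (Gam g z b *v u) w) y + dd a (\<lambda>z. G z u (Gam g z b *v w)) y"
      by (rule dd_add) (intro dd_gip(2) diff(1)[OF y] g1 differentiable_const)+
    finally show ?thesis
      using dd_G[OF y g1(1), of "\<lambda>_. w" a] dd_G[OF y _ g1(2), of "\<lambda>_. u" a] by (simp add: nab_const)
  qed
  have "dd a (\<lambda>z. dd b ?f z) y = dd b (\<lambda>z. dd a ?f z) y"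
    by (rule dd_commute_real[OF open_U y C2])
  then show ?thesis
    unfolding d2 Rm_const[OF y] by (simp add: gip_simps linear_diff[OF linear_gip(2)] linear_diff[OF linear_gip(3)])
qed

text \<open>The connection is symmetric, so \<open>\<nabla>\<^sub>b w = \<nabla>\<^sub>w b\<close> for constant fields; the six second derivatives
  cancel in pairs.\<close>

lemma Rm_bianchi:
  assumes y: "y \<in> U"
  shows "Rm y a b *v w + Rm y b w *v a + Rm y w a *v b = 0"
proof -
  have "nab x (\<lambda>z. Gam g z b *v w) y = nab x (\<lambda>z. Gam g z w *v b) y" for x b w
    by (rule nab_cong[OF y Gam_vec_diff[OF y]]) (simp_all add: Gam_commute)
  then show ?thesis
    unfolding Rm_const[OF y] by (metis (no_types, lifting) add_diff_cancel_left' diff_add_cancel diff_self add.commute add_diff_eq)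
qed

text \<open>This is the commutator of two covariant derivatives of the field \<open>u \<times> v\<close>, for constant \<open>u\<close> and
  \<open>v\<close>. The terms of first order in \<open>c\<close> are symmetric in \<open>a\<close> and \<open>b\<close> and cancel; the derivative of
  the torsion term \<open>c Q\<close> leaves the terms of second order.\<close>

lemma Rm_cross:
  assumes y: "y \<in> U"
  shows "Rm y a b *v X y u v = X y (Rm y a b *v u) v + X y u (Rm y a b *v v)
    - c\<^sup>2 *\<^sub>R ((X y (QQ y a b u) v + QQ y a (X y b u) v) - (X y (QQ y b a u) v + QQ y b (X y a u) v))"
proof -
  obtain e where cps: "cross_product_space (G y) (X y) e" using cross_space[OF y] by blast
  interpret cross_product_space "G y" "X y" e by (rule cps)
  let ?V = "\<lambda>z. X z u v"
  have "bounded_linear (\<lambda>\<alpha>. (\<chi> k. tri \<alpha> u v (axis k 1)) :: real^7)"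
    by (rule linear_conv_bounded_linear[THEN iffD1], rule linearI)
      (simp_all add: vec_eq_iff linear_add[OF linear_tri(1)] linear_scale[OF linear_tri(1)])
  then have C2: "Ck_on 2 U ?V"
    unfolding cross_def
    by (intro Ck_on_bounded_bilinear[OF open_U bounded_bilinear_matrix_vector] Ck_on_matrix_inv open_U g_det g_smooth
        Ck_on_bounded_linear[OF open_U _ phi_smooth])
  have first: "nab b ?V z = X z (Gam g z b *v u) v + X z u (Gam g z b *v v) + c *\<^sub>R QQ z b u v" if "z \<in> U" for b z
    using nab_cross[OF that, of "\<lambda>_. u" "\<lambda>_. v" b] by (simp add: nab_const)
  have d: "(\<lambda>z. Gam g z b *v u) differentiable at y" for b u
    by (rule Gam_vec_diff[OF y]) simp
  have second: "nab a (\<lambda>z. nab b ?V z) y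
    = X y (nab a (\<lambda>z. Gam g z b *v u) y) v + X y (Gam g y b *v u) (Gam g y a *v v) + c *\<^sub>R QQ y a (Gam g y b *v u) v
    + (X y (Gam g y a *v u) (Gam g y b *v v) + X y u (nab a (\<lambda>z. Gam g z b *v v) y) + c *\<^sub>R QQ y a u (Gam g y b *v v))
    + c *\<^sub>R (QQ y (Gam g y a *v b) u v + QQ y b (Gam g y a *v u) v + QQ y b u (Gam g y a *v v)
        - c *\<^sub>R (X y (QQ y a b u) v + QQ y a (X y b u) v))" for a b
  proof -
    have d1: "(\<lambda>z. X z (Gam g z b *v u) v) differentiable at y" "(\<lambda>z. X z u (Gam g z b *v v)) differentiable at y"
        "(\<lambda>z. QQ z b u v) differentiable at y"
      by (intro cross_diff QQ_diff y d differentiable_const)+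
    have d2: "(\<lambda>z. c *\<^sub>R QQ z b u v) differentiable at y"
      by (intro differentiable_scaleR d1 differentiable_const)
    have "nab a (\<lambda>z. nab b ?V z) y = nab a (\<lambda>z. X z (Gam g z b *v u) v + X z u (Gam g z b *v v) + c *\<^sub>R QQ z b u v) y"
      by (rule nab_cong[symmetric, OF y]) (intro differentiable_add d1 d2, rule first[symmetric])
    also have "\<dots> = nab a (\<lambda>z. X z (Gam g z b *v u) v) y + nab a (\<lambda>z. X z u (Gam g z b *v v)) y + c *\<^sub>R nab a (\<lambda>z. QQ z b u v) y"
      by (simp add: nab_add d1 d2 differentiable_add nab_scale)
    finally show ?thesis
      using nab_cross[OF y d, of "\<lambda>_. v" a b u] nab_cross[OF y _ d, of "\<lambda>_. u" a b v] nab_QQ[OF y, of "\<lambda>_. b" "\<lambda>_. u" "\<lambda>_. v" a]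
      by (simp add: nab_const)
  qed
  have "Rm y a b *v X y u v = nab a (\<lambda>z. nab b ?V z) y - nab b (\<lambda>z. nab a ?V z) y"
    by (rule ricci_identity[OF y C2, symmetric])
  also have "\<dots> = X y (Rm y a b *v u) v + X y u (Rm y a b *v v)
    - c\<^sup>2 *\<^sub>R ((X y (QQ y a b u) v + QQ y a (X y b u) v) - (X y (QQ y b a u) v + QQ y b (X y a u) v))"
    unfolding second Rm_const[OF y] Gam_commute[OF y, of b a]
    by (simp add: cr_simps power2_eq_square algebra_simps)
  finally show ?thesis .
qed

lemma ricci_Rm:
  assumes y: "y \<in> U"
  shows "ricci g y $ j $ k = (\<Sum>i\<in>UNIV. (Rm y (axis i 1) (axis j 1) *v axis k 1) $ i)"
proof -
  have D: "dd x (\<lambda>z. Gam g z (axis m 1)) y $ l $ n = (dd x (christoffel g) y) $ l $ m $ n" for x m l n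
    using dd_bounded_linear(1)[OF bounded_linear_Gam christoffel_diff[OF y], of "axis m 1" x]
    by (simp add: Gam_def sum_axis)
  show ?thesis
    by (simp add: ricci_def Let_def matrix_vector_mult_basis column_def Rm_def D pd_def)
      (simp add: Gam_axis matrix_matrix_mult_def sum_subtractf sum.distrib)
qed

lemma Rm_linear_first: "y \<in> U \<Longrightarrow> linear (\<lambda>a. Rm y a b *v w)"
proof (rule linearI)
  assume y: "y \<in> U"
  have 1: "Gam g z (a + a') = Gam g z a + Gam g z a'" "Gam g z (r *\<^sub>R a) = r *\<^sub>R Gam g z a" for z a a' r
    using linear_add[OF linear_Gam(1)] linear_scale[OF linear_Gam(1)] by blast+
  have 2: "dd b (\<lambda>z. r *\<^sub>R Gam g z a) y = r *\<^sub>R dd b (\<lambda>z. Gam g z a) y" for r a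
    by (rule dd_bounded_linear(1)[OF bounded_linear_scaleR_right Gam_diff[OF y]])
  note 3 = linear_add[OF dd_linear_direction[OF Gam_diff[OF y]]] linear_scale[OF dd_linear_direction[OF Gam_diff[OF y]]]
  note mm = bounded_bilinear.add_left[OF bounded_bilinear_matrix_mult] bounded_bilinear.add_right[OF bounded_bilinear_matrix_mult]
    bounded_bilinear.scaleR_left[OF bounded_bilinear_matrix_mult] bounded_bilinear.scaleR_right[OF bounded_bilinear_matrix_mult]
  show "Rm y (a + a') b *v w = Rm y a b *v w + Rm y a' b *v w" for a a'
    unfolding Rm_def 1 3 dd_add[OF Gam_diff[OF y] Gam_diff[OF y]] mm
    by (simp add: matrix_vector_mult_add_rdistrib matrix_vector_mult_diff_rdistrib algebra_simps)
  show "Rm y (r *\<^sub>R a) b *v w = r *\<^sub>R (Rm y a b *v w)" for r a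
    unfolding Rm_def 1 2 3 mm
    by (simp add: matrix_vector_mult_add_rdistrib matrix_vector_mult_diff_rdistrib scaleR_matrix_vector_assoc[symmetric] algebra_simps)
qed

text \<open>By \<open>Rm_cross\<close> the curvature satisfies the hypotheses of \<open>einstein\<close> with \<open>k = c\<^sup>2\<close>; the Ricci tensor
  is a trace over coordinates, which has to be rewritten as a trace over an orthonormal frame.\<close>

theorem ricci_eq:
  assumes y: "y \<in> U"
  shows "ricci g y = (6 * c\<^sup>2) *\<^sub>R g y"
proof -
  obtain e where cps: "cross_product_space (G y) (X y) e" using cross_space[OF y] by blast
  interpret cross_product_space "G y" "X y" e by (rule cps)
  have E: "(\<Sum>i\<in>UNIV. G y (Rm y (e i) a *v b) (e i)) = 6 * c\<^sup>2 * G y a b" for a b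
  proof (rule einstein[where R="\<lambda>a b w. Rm y a b *v w"])
    show "Rm y a b *v w = - (Rm y b a *v w)" for a b w
      by (simp add: Rm_const[OF y])
    show "linear (\<lambda>w. Rm y a b *v w)" for a b by simp
  qed (rule Rm_bianchi[OF y] Rm_skew[OF y] Rm_cross[OF y])+
  have "ricci g y $ j $ k = (6 * c\<^sup>2) * g y $ j $ k" for j k
  proof -
    let ?F = "\<lambda>a. Rm y a (axis j 1) *v axis k 1"
    have lin: "linear ?F" by (rule Rm_linear_first[OF y])
    have "ricci g y $ j $ k = (\<Sum>a\<in>UNIV. (\<Sum>i\<in>UNIV. G y (?F (axis a 1)) (e i) *\<^sub>R e i) $ a)"
      unfolding ricci_Rm[OF y] frame_expansion ..
    also have "\<dots> = (\<Sum>a\<in>UNIV. \<Sum>i\<in>UNIV. e i $ a * G y (?F (axis a 1)) (e i))"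
      by (simp add: mult.commute)
    also have "\<dots> = (\<Sum>i\<in>UNIV. \<Sum>a\<in>UNIV. e i $ a * G y (?F (axis a 1)) (e i))"
      by (rule sum.swap)
    also have "\<dots> = (\<Sum>i\<in>UNIV. G y (?F (e i)) (e i))"
    proof (rule sum.cong[OF refl])
      fix i
      have "?F (e i) = ?F (\<Sum>a\<in>UNIV. e i $ a *\<^sub>R axis a 1)"
        using basis_expansion[of "e i"] by (simp add: scalar_mult_eq_scaleR)
      also have "\<dots> = (\<Sum>a\<in>UNIV. e i $ a *\<^sub>R ?F (axis a 1))"
        unfolding linear_sum[OF lin] linear_scale[OF lin] ..
      finally show "(\<Sum>a\<in>UNIV. e i $ a * G y (?F (axis a 1)) (e i)) = G y (?F (e i)) (e i)"
        by (simp add: ip_sum_left ip_scale_left)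
    qed
    also have "\<dots> = 6 * c\<^sup>2 * G y (axis j 1) (axis k 1)"
      by (rule E)
    also have "G y (axis j 1) (axis k 1) = g y $ j $ k"
      by (rule gip_axis_axis)
    finally show ?thesis .
  qed
  then show ?thesis by (simp add: vec_eq_iff)
qed

end

section \<open>Rescaling\<close>

lemma wedge_coeff_scaleR: "wedge_coeff (s *\<^sub>R \<phi>) i j = s ^ 3 * wedge_coeff \<phi> i j"
  by (simp add: wedge_coeff_def sum_distrib_left power3_eq_cube mult_ac)

text \<open>The wedge coefficients are cubic in \<open>\<phi>\<close>, so they scale by \<open>r\<^sup>9 = r\<^sup>2 r\<^sup>7\<close>, as metric times volume
  does.\<close>

lemma metric_vol_of_scaleR:
  assumes mv: "metric_vol_of \<phi> g v" and r: "r > 0"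
  shows "metric_vol_of (r ^ 3 *\<^sub>R \<phi>) (r\<^sup>2 *\<^sub>R g) (r ^ 7 * v)"
  unfolding metric_vol_of_def
proof (intro conjI allI impI)
  have g: "g$i$j = g$j$i" for i j by (rule metric_vol_sym[OF mv])
  show "transpose (r\<^sup>2 *\<^sub>R g) = r\<^sup>2 *\<^sub>R g"
    unfolding vec_eq_iff transpose_def
    by (intro allI, simp) (metis g)
  show "X \<bullet> (r\<^sup>2 *\<^sub>R g *v X) > 0" if "X \<noteq> 0" for X
    using mv that r by (simp add: metric_vol_of_def scaleR_matrix_vector_assoc[symmetric])
  show "(r ^ 7 * v)\<^sup>2 = det (r\<^sup>2 *\<^sub>R g)"
    using mv by (simp add: metric_vol_of_def det_scaleR power_mult_distrib flip: power_mult)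
  show "wedge_coeff (r ^ 3 *\<^sub>R \<phi>) i j = - 6 * (r\<^sup>2 *\<^sub>R g) $ i $ j * (r ^ 7 * v)" for i j
  proof -
    have "(r ^ 3) ^ 3 = r\<^sup>2 * r ^ 7" by (simp flip: power_mult power_add)
    then show ?thesis using mv by (simp add: wedge_coeff_scaleR metric_vol_of_def)
  qed
qed

lemma nondegenerate_metric_vol: "nondegenerate \<phi> \<Longrightarrow> metric_vol_of \<phi> (metric \<phi>) (vol_coeff \<phi>)"
  unfolding nondegenerate_def using metric_vol_of_metric by blast

lemma nondegenerate_scaleR: "nondegenerate \<phi> \<Longrightarrow> r > 0 \<Longrightarrow> nondegenerate (r ^ 3 *\<^sub>R \<phi>)"
  unfolding nondegenerate_def using metric_vol_of_scaleR by blast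

lemma metric_scaleR:
  assumes "nondegenerate \<phi>" "r > 0"
  shows "metric (r ^ 3 *\<^sub>R \<phi>) = r\<^sup>2 *\<^sub>R metric \<phi>" "vol_coeff (r ^ 3 *\<^sub>R \<phi>) = r ^ 7 * vol_coeff \<phi>"
  using metric_vol_of_metric[OF metric_vol_of_scaleR[OF nondegenerate_metric_vol[OF assms(1)] assms(2)]] by simp_all

lemma matrix_inv_scaleR:
  assumes "det (g :: real^7^7) \<noteq> 0" "s \<noteq> 0"
  shows "matrix_inv (s *\<^sub>R g) = (1 / s) *\<^sub>R matrix_inv g"
proof (rule matrix_inv_eqI)
  note b = bounded_bilinear_matrix_mult
  show "(1 / s) *\<^sub>R matrix_inv g ** s *\<^sub>R g = mat 1"
    using assms matrix_inverse[OF assms(1)]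
    by (simp add: bounded_bilinear.scaleR_left[OF b] bounded_bilinear.scaleR_right[OF b])
qed

text \<open>The volume coefficient contributes \<open>r\<^sup>7\<close>, the three inverse metrics \<open>r\<^sup>-\<^sup>6\<close> and the 3-form itself
  \<open>r\<^sup>3\<close>.\<close>

lemma psi_scaleR:
  assumes nd: "nondegenerate \<phi>" and r: "r > 0"
  shows "psi (r ^ 3 *\<^sub>R \<phi>) = r ^ 4 *\<^sub>R psi \<phi>"
proof -
  have inv: "matrix_inv (r\<^sup>2 *\<^sub>R metric \<phi>) = (1 / r\<^sup>2) *\<^sub>R matrix_inv (metric \<phi>)"
    using r by (intro matrix_inv_scaleR metric_det[OF nondegenerate_metric_vol[OF nd]]) simp
  have r3: "1 / r\<^sup>2 * (1 / r\<^sup>2) * (1 / r\<^sup>2) * r ^ 3 = 1 / r ^ 3" and r7: "r ^ 7 * (1 / r ^ 3) = r ^ 4"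
    using r by (simp_all add: power_eq_if field_simps)
  have raise: "raise3 (r\<^sup>2 *\<^sub>R metric \<phi>) (r ^ 3 *\<^sub>R \<phi>) $ a $ b $ d = 1 / r ^ 3 * raise3 (metric \<phi>) \<phi> $ a $ b $ d" for a b d
    unfolding raise3_def inv r3[symmetric] by (simp add: sum_distrib_left mult_ac)
  have "psi (r ^ 3 *\<^sub>R \<phi>) $ i $ j $ k $ l = r ^ 4 * psi \<phi> $ i $ j $ k $ l" for i j k l
  proof -
    let ?P = "{p. p permutes (UNIV::7 set) \<and> p 3 = i \<and> p 4 = j \<and> p 5 = k \<and> p 6 = l}"
    let ?R = "\<lambda>p. raise3 (metric \<phi>) \<phi> $ p 0 $ p 1 $ p (2::7)"
    have "psi (r ^ 3 *\<^sub>R \<phi>) $ i $ j $ k $ l = r ^ 7 * vol_coeff \<phi> / 6 * (\<Sum>p\<in>?P. of_int (sign p) * (1 / r ^ 3 * ?R p))"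
      unfolding psi_def metric_scaleR[OF nd r] raise by simp
    also have "(\<Sum>p\<in>?P. of_int (sign p) * (1 / r ^ 3 * ?R p)) = 1 / r ^ 3 * (\<Sum>p\<in>?P. of_int (sign p) * ?R p)"
      by (simp only: sum_distrib_left mult.left_commute)
    also have "r ^ 7 * vol_coeff \<phi> / 6 * (1 / r ^ 3 * (\<Sum>p\<in>?P. of_int (sign p) * ?R p))
        = (r ^ 7 * (1 / r ^ 3)) * (vol_coeff \<phi> / 6 * (\<Sum>p\<in>?P. of_int (sign p) * ?R p))"
      by simp
    finally show ?thesis
      unfolding r7 by (simp add: psi_def)
  qed
  then show ?thesis by (simp add: vec_eq_iff)
qed

lemma smooth_on_scaleR: "smooth_on S f \<Longrightarrow> smooth_on S (\<lambda>x. s *\<^sub>R f x)"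
proof -
  assume "smooth_on S f"
  then obtain V F where F: "open V" "S \<subseteq> V" "\<forall>x\<in>S. F x = f x" "\<And>k. Ck_on k V F"
    unfolding smooth_on_def by blast
  then have "Ck_on k V (\<lambda>x. s *\<^sub>R F x)" for k
    by (intro Ck_on_bounded_linear[OF _ bounded_linear_scaleR_right])
  then show ?thesis
    unfolding smooth_on_def using F by (intro exI[of _ V] exI[of _ "\<lambda>x. s *\<^sub>R F x"]) auto
qed

lemma pull2_scaleR: "pull2 J (s *\<^sub>R h) = s *\<^sub>R pull2 J h"
  by (simp add: pull2_def vec_eq_iff sum_distrib_left mult_ac)

lemma pull3_scaleR: "pull3 J (s *\<^sub>R \<alpha>) = s *\<^sub>R pull3 J \<alpha>"
  by (simp add: pull3_def vec_eq_iff sum_distrib_left mult_ac)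

lemma is_pullback_scaleR:
  assumes "\<And>J h. \<P> J (s *\<^sub>R h) = s *\<^sub>R \<P> J h" and "is_pullback \<P> A \<Theta> \<alpha> \<beta>"
  shows "is_pullback \<P> A \<Theta> (\<lambda>k x. s *\<^sub>R \<alpha> k x) (\<lambda>k x. s *\<^sub>R \<beta> k x)"
  using assms by (simp add: is_pullback_def)

lemma tensor2_scaleR: "tensor2 A h \<Longrightarrow> tensor2 A (\<lambda>k x. s *\<^sub>R h k x)"
  unfolding tensor2_def by (auto intro!: smooth_on_scaleR is_pullback_scaleR pull2_scaleR)

lemma form3_scaleR:
  assumes "form3 A \<phi>"
  shows "form3 A (\<lambda>k x. s *\<^sub>R \<phi> k x)"
  unfolding form3_def
proof (intro conjI ballI allI smooth_on_scaleR is_pullback_scaleR pull3_scaleR)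
  show "smooth_on (cimg k) (\<phi> k)" if "k \<in> A" for k using assms that by (simp add: form3_def)
  show "is_pullback pull3 A id \<phi> \<phi>" using assms by (simp add: form3_def)
  fix k x a b d assume "k \<in> A" "x \<in> cimg k"
  then have "\<phi> k x $a$b$d = - \<phi> k x $b$a$d" "\<phi> k x $a$b$d = - \<phi> k x $a$d$b"
    using assms unfolding form3_def by blast+
  then have "s * \<phi> k x $a$b$d = - (s * \<phi> k x $b$a$d)" "s * \<phi> k x $a$b$d = - (s * \<phi> k x $a$d$b)"
    by (metis mult_minus_right)+
  then show "(s *\<^sub>R \<phi> k x) $a$b$d = - (s *\<^sub>R \<phi> k x) $b$a$d"
    "(s *\<^sub>R \<phi> k x) $a$b$d = - (s *\<^sub>R \<phi> k x) $a$d$b"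
    by (simp_all only: vector_scaleR_component real_scaleR_def)
qed

lemma G2_structure_scaleR: "G2_structure A \<phi> \<Longrightarrow> r > 0 \<Longrightarrow> G2_structure A (\<lambda>k x. r ^ 3 *\<^sub>R \<phi> k x)"
  unfolding G2_structure_def by (auto intro: form3_scaleR nondegenerate_scaleR)

lemma diffeo_id:
  assumes "smooth_atlas A"
  shows "diffeo A id"
  using assms by (auto simp: diffeo_def smooth_map_def smooth_atlas_def inv_id)

context
  fixes g :: "real^7^7"
  assumes det: "det g \<noteq> 0" and sym: "\<And>i j. g$i$j = g$j$i"
begin

lemma contract1: "(\<Sum>q\<in>UNIV. matrix_inv g $p$q * g$q$j) = (if p = j then 1 else 0)"
  using matrix_inverse(2)[OF det] by (simp add: vec_eq_iff matrix_matrix_mult_def mat_def)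

lemma contract2: "(\<Sum>p\<in>UNIV. g$i$p * matrix_inv g $p$q) = (if i = q then 1 else 0)"
  using matrix_inverse(1)[OF det] by (simp add: vec_eq_iff matrix_matrix_mult_def mat_def)

lemma contract_torsion: "(\<Sum>p\<in>UNIV. \<Sum>q\<in>UNIV. g$m$p * matrix_inv g $p$q * z q) = (z m :: real)"
proof -
  have "(\<Sum>p\<in>UNIV. \<Sum>q\<in>UNIV. g$m$p * matrix_inv g $p$q * z q) = (\<Sum>q\<in>UNIV. (\<Sum>p\<in>UNIV. g$m$p * matrix_inv g $p$q) * z q)"
    by (subst sum.swap) (simp add: sum_distrib_right)
  also have "\<dots> = (\<Sum>q\<in>UNIV. if q = m then z q else 0)"
    unfolding contract2 by (rule sum.cong) auto
  finally show ?thesis by simp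
qed

lemma TtT_metric: "TtT g g = g"
proof -
  have "(\<Sum>p\<in>UNIV. \<Sum>q\<in>UNIV. matrix_inv g $p$q * g$p$i * g$q$j) = g$i$j" for i j
  proof -
    have "(\<Sum>p\<in>UNIV. \<Sum>q\<in>UNIV. matrix_inv g $p$q * g$p$i * g$q$j) = (\<Sum>p\<in>UNIV. g$p$i * (\<Sum>q\<in>UNIV. matrix_inv g $p$q * g$q$j))"
      by (simp add: sum_distrib_left mult_ac)
    also have "\<dots> = (\<Sum>p\<in>UNIV. if p = j then g$p$i else 0)"
      unfolding contract1 by (rule sum.cong) auto
    also have "\<dots> = g$j$i" by simp
    finally show ?thesis using sym[of i j] by simp
  qed
  then show ?thesis by (simp add: TtT_def vec_eq_iff)
qed

lemma normsq2_metric: "normsq2 g g = 7"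
proof -
  have "(\<Sum>q\<in>UNIV. matrix_inv g $i$p * matrix_inv g $j$q * g$i$j * g$p$q)
      = (if p = j then matrix_inv g $i$p * g$i$j else 0)" for i j p
  proof -
    have "(\<Sum>q\<in>UNIV. matrix_inv g $i$p * matrix_inv g $j$q * g$i$j * g$p$q)
        = (\<Sum>q\<in>UNIV. matrix_inv g $i$p * g$i$j * (matrix_inv g $j$q * g$q$p))"
    proof (rule sum.cong[OF refl])
      fix q
      have "g$p$q = g$q$p" by (rule sym)
      then show "matrix_inv g $i$p * matrix_inv g $j$q * g$i$j * g$p$q
          = matrix_inv g $i$p * g$i$j * (matrix_inv g $j$q * g$q$p)" by simp
    qed
    also have "\<dots> = matrix_inv g $i$p * g$i$j * (if j = p then 1 else 0)"
      by (simp only: sum_distrib_left[symmetric] contract1)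
    finally show ?thesis by auto
  qed
  then have "normsq2 g g = (\<Sum>i\<in>UNIV. \<Sum>j\<in>UNIV. matrix_inv g $i$j * g$i$j)"
    by (simp add: normsq2_def)
  also have "\<dots> = (\<Sum>i\<in>UNIV. \<Sum>j\<in>UNIV. matrix_inv g $i$j * g$j$i)"
  proof (intro sum.cong refl)
    fix i j
    have "g$i$j = g$j$i" by (rule sym)
    then show "matrix_inv g $i$j * g$i$j = matrix_inv g $i$j * g$j$i" by simp
  qed
  also have "\<dots> = 7"
    unfolding contract1 by simp
  finally show ?thesis .
qed

lemma diamond_metric: "diamond g g \<phi> = 3 *\<^sub>R \<phi>"
proof -
  have c: "(\<Sum>p\<in>UNIV. \<Sum>q\<in>UNIV. matrix_inv g $p$q * (g$m$p * z q)) = (z m :: real)" for m z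
    using contract_torsion[of m z] by (simp add: mult_ac)
  show ?thesis
    unfolding diamond_def vec_eq_iff
    by (simp add: distrib_left sum.distrib c)
qed

end

lemma diamond_scaleR:
  assumes "det g \<noteq> 0" "s \<noteq> 0"
  shows "diamond (s *\<^sub>R g) (\<mu> *\<^sub>R h) (\<rho> *\<^sub>R \<phi>) = (\<mu> * \<rho> / s) *\<^sub>R diamond g h \<phi>"
  unfolding diamond_def matrix_inv_scaleR[OF assms] vec_eq_iff
  by (simp add: sum_distrib_left) (simp add: field_simps sum_divide_distrib)

lemma TtT_scaleR:
  assumes "det g \<noteq> 0" "s \<noteq> 0"
  shows "TtT (s *\<^sub>R g) (\<mu> *\<^sub>R T) = (\<mu>\<^sup>2 / s) *\<^sub>R TtT g T"
  unfolding TtT_def matrix_inv_scaleR[OF assms] vec_eq_iff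
  by (simp add: sum_distrib_left power2_eq_square mult_ac)

lemma normsq2_scaleR:
  assumes "det g \<noteq> 0" "s \<noteq> 0"
  shows "normsq2 (s *\<^sub>R g) (\<mu> *\<^sub>R T) = (\<mu>\<^sup>2 / s\<^sup>2) * normsq2 g T"
  unfolding normsq2_def matrix_inv_scaleR[OF assms]
  by (simp add: sum_distrib_left power2_eq_square mult_ac)

lemma pd_scaleR: "f differentiable at x \<Longrightarrow> pd i (\<lambda>y. s *\<^sub>R f y) x = s *\<^sub>R pd i f x"
  unfolding pd_def by (rule dd_bounded_linear(1)[OF bounded_linear_scaleR_right])

lemma pd_cong:
  assumes "open U" "x \<in> U" "f differentiable at x" "\<And>y. y \<in> U \<Longrightarrow> h y = f y"
  shows "pd i h x = pd i f x"
  unfolding pd_def using dd_cong(1)[OF assms(1-3), of h] assms(4) by simp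

context G2_chart
begin

lemma christoffel_scaleR:
  assumes y: "y \<in> U" and s: "s \<noteq> 0" and h: "\<And>z. z \<in> U \<Longrightarrow> h z = s *\<^sub>R g z"
  shows "christoffel h y = christoffel g y"
proof -
  have "pd i h y = pd i (\<lambda>z. s *\<^sub>R g z) y" for i
    by (rule pd_cong[OF open_U y]) (use h dd_bounded_linear(2)[OF bounded_linear_scaleR_right diff(1)[OF y]] in auto)
  then have p: "pd i h y = s *\<^sub>R pd i g y" for i
    by (simp add: pd_scaleR[OF diff(1)[OF y]])
  show ?thesis
    unfolding christoffel_def h[OF y] matrix_inv_scaleR[OF g_det[OF y] s] p vec_eq_iff
    using s by (simp add: sum_distrib_left algebra_simps)
qed

lemma ricci_scaleR:
  assumes y: "y \<in> U" and s: "s \<noteq> 0" and h: "\<And>z. z \<in> U \<Longrightarrow> h z = s *\<^sub>R g z"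
  shows "ricci h y = ricci g y"
proof -
  have c: "christoffel h z = christoffel g z" if "z \<in> U" for z
    using christoffel_scaleR[OF that s h] .
  have "pd i (christoffel h) y = pd i (christoffel g) y" for i
    by (rule pd_cong[OF open_U y christoffel_diff[OF y] c])
  then show ?thesis by (simp add: ricci_def Let_def c[OF y])
qed

lemma nabla2_multiple:
  assumes y: "y \<in> U" and s: "s \<noteq> 0" and h: "\<And>z. z \<in> U \<Longrightarrow> h z = s *\<^sub>R g z"
  shows "nabla2 h (\<lambda>z. \<mu> *\<^sub>R g z) y = 0"
proof -
  have "christoffel h y = christoffel g y" by (rule christoffel_scaleR[OF y s h])
  then show ?thesis
    unfolding nabla2_def pd_scaleR[OF diff(1)[OF y]]
    by (simp add: vec_eq_iff metric_compat[OF y] sum_distrib_left algebra_simps)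
qed

lemma nabla3_multiple:
  assumes y: "y \<in> U" and s: "s \<noteq> 0" and h: "\<And>z. z \<in> U \<Longrightarrow> h z = s *\<^sub>R g z"
  shows "nabla3 h (\<lambda>z. \<mu> *\<^sub>R \<phi> z) y = \<mu> *\<^sub>R nabla3 g \<phi> y"
proof -
  have "christoffel h y = christoffel g y" by (rule christoffel_scaleR[OF y s h])
  then show ?thesis
    unfolding nabla3_def pd_scaleR[OF diff(2)[OF y]]
    by (simp add: vec_eq_iff sum_distrib_left algebra_simps)
qed

text \<open>The volume coefficient in \<open>\<psi>\<close> is defined pointwise, so its regularity is not visible from the definition.
  But \<open>\<psi> = \<nabla>\<phi> / c\<close>, and this is differentiable.\<close>

lemma psi_diff:
  assumes y: "y \<in> U" and c: "c \<noteq> 0"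
  shows "(\<lambda>z. psi (\<phi> z)) differentiable at y"
proof -
  have e3: "(\<lambda>z. f z $ i $ j $ k) differentiable at y" if "f differentiable at y" for f :: "real^7 \<Rightarrow> real^7^7^7" and i j k
    by (rule dd_bounded_linear(2)[OF bounded_linear_entry dd_bounded_linear(2)[OF bounded_linear_vec_nth that]])
  have "(\<lambda>z. pd m \<phi> z) differentiable at y" for m
    unfolding pd_def using phi_smooth[of "Suc (Suc 0)"] y by simp
  note d = e3[OF this] e3[OF christoffel_diff[OF y]] e3[OF diff(2)[OF y]]
  have "(\<lambda>z. nabla3 g \<phi> z) differentiable at y"
    unfolding nabla3_def
    by (intro differentiable_vec_lambda differentiable_diff differentiable_sum ballI differentiable_mult d) simp_all
  then have "(\<lambda>z. (1 / c) *\<^sub>R nabla3 g \<phi> z) differentiable at y"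
    by (rule dd_bounded_linear(2)[OF bounded_linear_scaleR_right])
  then show ?thesis
    by (rule dd_cong(2)[OF open_U y]) (simp add: vec_eq_iff torsion c)
qed

end

lemma ext_deriv3_scaleR:
  "\<alpha> differentiable at x \<Longrightarrow> ext_deriv3 (\<lambda>y. s *\<^sub>R \<alpha> y) x = s *\<^sub>R ext_deriv3 \<alpha> x"
  by (simp add: ext_deriv3_def vec_eq_iff pd_scaleR algebra_simps)

lemma ext_deriv4_scaleR:
  assumes "open U" "x \<in> U" "\<beta> differentiable at x" "\<And>y. y \<in> U \<Longrightarrow> \<beta>' y = s *\<^sub>R \<beta> y"
  shows "ext_deriv4 \<beta>' x = s *\<^sub>R ext_deriv4 \<beta> x"
proof -
  have "pd i \<beta>' x = pd i (\<lambda>y. s *\<^sub>R \<beta> y) x" for i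
    by (rule pd_cong[OF assms(1,2)]) (use assms(4) dd_bounded_linear(2)[OF bounded_linear_scaleR_right assms(3)] in auto)
  then show ?thesis
    by (simp add: ext_deriv4_def vec_eq_iff pd_scaleR[OF assms(3)] algebra_simps)
qed

section \<open>The solution of the flow\<close>

lemma metric_vol_of_zero: "\<not> metric_vol_of 0 g v"
proof
  assume mv: "metric_vol_of 0 g v"
  have "wedge_coeff 0 i j = 0" for i j by (simp add: wedge_coeff_def)
  then have "g = 0"
    using mv metric_vol_nonzero[OF mv] by (simp add: metric_vol_of_def vec_eq_iff)
  moreover have "axis 0 1 \<noteq> (0 :: real^7)" by (simp add: axis_eq_0_iff)
  ultimately show False
    using mv unfolding metric_vol_of_def by (metis inner_zero_right less_irrefl matrix_vector_mult_0)
qed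

text \<open>The metric is likewise defined pointwise; it is smooth because \<open>c g\<close> is, as a torsion tensor.\<close>

lemma nearly_G2_chart:
  fixes A :: "'m::{t2_space,second_countable_topology} chart set"
  assumes "smooth_atlas A" "G2_structure A \<phi>\<^sub>0"
    and T: "is_torsion A \<phi>\<^sub>0 (\<lambda>k x. c *\<^sub>R metric_of \<phi>\<^sub>0 k x)" and c: "c \<noteq> 0" and k: "k \<in> A"
  shows "G2_chart (cimg k) (metric_of \<phi>\<^sub>0 k) (\<phi>\<^sub>0 k) c"
proof
  have F: "form3 A \<phi>\<^sub>0" using assms(2) unfolding G2_structure_def by blast
  show op: "open (cimg k)" using assms(1) k unfolding smooth_atlas_def is_chart_def by blast
  have nd: "nondegenerate (\<phi>\<^sub>0 k y)" if "y \<in> cimg k" for y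
    using assms(2) k that unfolding G2_structure_def by blast
  then have mv: "metric_vol_of (\<phi>\<^sub>0 k y) (metric_of \<phi>\<^sub>0 k y) (vol_coeff (\<phi>\<^sub>0 k y))" if "y \<in> cimg k" for y
    using nondegenerate_metric_vol that by (simp add: metric_of_def)
  then show "\<exists>v. metric_vol_of (\<phi>\<^sub>0 k y) (metric_of \<phi>\<^sub>0 k y) v" if "y \<in> cimg k" for y using that by blast
  show "Ck_on n (cimg k) (metric_of \<phi>\<^sub>0 k)" for n
  proof -
    have "smooth_on (cimg k) (\<lambda>x. c *\<^sub>R metric_of \<phi>\<^sub>0 k x)"
      using T k by (auto simp: is_torsion_def tensor2_def)
    then have "Ck_on n (cimg k) (\<lambda>x. (1 / c) *\<^sub>R (c *\<^sub>R metric_of \<phi>\<^sub>0 k x))"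
      by (intro Ck_on_bounded_linear[OF op bounded_linear_scaleR_right] smooth_on_openD op)
    then show ?thesis using c by simp
  qed
  show "Ck_on n (cimg k) (\<phi>\<^sub>0 k)" for n
    using F k unfolding form3_def by (intro smooth_on_openD op) blast
  show "alternating3 (\<phi>\<^sub>0 k y)" if "y \<in> cimg k" for y
    unfolding alternating3_def using F k that unfolding form3_def by blast
  show "nabla3 (metric_of \<phi>\<^sub>0 k) (\<phi>\<^sub>0 k) y $ m $ i $ j $ l = c * psi (\<phi>\<^sub>0 k y) $ m $ i $ j $ l" if "y \<in> cimg k" for y m i j l
  proof -
    have "nabla3 (metric_of \<phi>\<^sub>0 k) (\<phi>\<^sub>0 k) y $ m $ i $ j $ l
      = (\<Sum>p\<in>UNIV. \<Sum>q\<in>UNIV. (c *\<^sub>R metric_of \<phi>\<^sub>0 k y) $ m $ p * matrix_inv (metric_of \<phi>\<^sub>0 k y) $ p $ q * psi (\<phi>\<^sub>0 k y) $ q $ i $ j $ l)"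
      using T k that unfolding is_torsion_def by blast
    also have "\<dots> = c * (\<Sum>p\<in>UNIV. \<Sum>q\<in>UNIV. metric_of \<phi>\<^sub>0 k y $ m $ p * matrix_inv (metric_of \<phi>\<^sub>0 k y) $ p $ q * psi (\<phi>\<^sub>0 k y) $ q $ i $ j $ l)"
      by (simp add: sum_distrib_left mult_ac)
    also have "\<dots> = c * psi (\<phi>\<^sub>0 k y) $ m $ i $ j $ l"
      by (simp only: contract_torsion[OF metric_det[OF mv[OF that]] metric_vol_sym[OF mv[OF that]]])
    finally show ?thesis .
  qed
qed

theorem proposition3p13:
  fixes A :: "'m::{t2_space,second_countable_topology} chart set"
    and \<phi>\<^sub>0 :: "'m field3"
    and c \<tau> :: real
  assumes "compact (UNIV :: 'm set)"
    and "smooth_atlas A"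
    and "nearly_G2 A \<phi>\<^sub>0"
    and "is_torsion A \<phi>\<^sub>0 (\<lambda>k x. c *\<^sub>R metric_of \<phi>\<^sub>0 k x)"
    and "c \<noteq> 0"
    and "\<tau> = 1 / (20 * c\<^sup>2)"
  shows "\<exists>\<phi>. flow_solution A \<tau> \<phi> \<and> field_eq A (\<phi> 0) \<phi>\<^sub>0 \<and>
      (\<forall>t\<in>{0..<\<tau>}. nearly_G2 A (\<phi> t)) \<and>
      shrinking A \<tau> \<phi> \<and>
      (\<forall>\<tau>'>\<tau>. \<not> (\<exists>\<phi>'. flow_solution A \<tau>' \<phi>' \<and> (\<forall>t\<in>{0..<\<tau>}. field_eq A (\<phi>' t) (\<phi> t))))"
proof -
  (* The square of r solves (r^2)' = - 20 c^2 with r(0) = 1, and it vanishes at \<tau>. *)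
  define r where "r t = sqrt (1 - 20 * c\<^sup>2 * t)" for t
  define \<phi> where "\<phi> t k x = r t ^ 3 *\<^sub>R \<phi>\<^sub>0 k x" for t k x
  define T where "T t k x = (r t * c) *\<^sub>R metric_of \<phi>\<^sub>0 k x" for t k x
  have \<phi>_abs: "\<phi> t k = (\<lambda>x. r t ^ 3 *\<^sub>R \<phi>\<^sub>0 k x)" for t k by (simp add: \<phi>_def fun_eq_iff)
  have T_abs: "T t k = (\<lambda>x. (r t * c) *\<^sub>R metric_of \<phi>\<^sub>0 k x)" for t k by (simp add: T_def fun_eq_iff)
  have b: "20 * c\<^sup>2 > 0" using assms(5) by simp
  have lt: "t < \<tau> \<longleftrightarrow> 20 * c\<^sup>2 * t < 1" for t
  proof -
    have "20 * c\<^sup>2 * \<tau> = 1" using assms(5,6) by simp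
    then show ?thesis using mult_less_cancel_left_pos[OF b, of t \<tau>] by simp
  qed
  have rpos: "r t > 0" if "t < \<tau>" for t
    using that lt[of t] by (simp add: r_def)
  have r0: "r 0 = 1" by (simp add: r_def)
  have rtau: "r \<tau> = 0" using assms(5,6) by (simp add: r_def)
  have \<tau>: "\<tau> > 0" using assms(5,6) by simp
  have G0: "G2_structure A \<phi>\<^sub>0" using assms(3) by (simp add: nearly_G2_def)
  have chart: "G2_chart (cimg k) (metric_of \<phi>\<^sub>0 k) (\<phi>\<^sub>0 k) c" if "k \<in> A" for k
    by (rule nearly_G2_chart[OF assms(2) G0 assms(4,5) that])
  have nd: "nondegenerate (\<phi>\<^sub>0 k x)" if "k \<in> A" "x \<in> cimg k" for k x
    using G0 that unfolding G2_structure_def by blast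
  have met: "metric_of (\<phi> t) k x = (r t)\<^sup>2 *\<^sub>R metric_of \<phi>\<^sub>0 k x" if "t < \<tau>" "k \<in> A" "x \<in> cimg k" for t k x
    unfolding metric_of_def \<phi>_def by (rule metric_scaleR(1)[OF nd[OF that(2,3)] rpos[OF that(1)]])
  have psi: "psi (\<phi> t k x) = r t ^ 4 *\<^sub>R psi (\<phi>\<^sub>0 k x)" if "t < \<tau>" "k \<in> A" "x \<in> cimg k" for t k x
    unfolding \<phi>_def by (rule psi_scaleR[OF nd[OF that(2,3)] rpos[OF that(1)]])
  have G: "G2_structure A (\<phi> t)" if "t < \<tau>" for t
    unfolding \<phi>_def by (rule G2_structure_scaleR[OF G0 rpos[OF that]])

  have flow: "flow_solution A \<tau> \<phi>"
    unfolding flow_solution_def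
  proof (intro conjI exI[of _ T] ballI)
    show "G2_structure A (\<phi> t)" if "t \<in> {0..<\<tau>}" for t using G that by simp
    show "smooth_on ({0..<\<tau>} \<times> cimg k) (\<lambda>(t, x). \<phi> t k x)" if "k \<in> A" for k
    proof -
      have "smooth_on (cimg k) (\<phi>\<^sub>0 k)" using G0 that unfolding G2_structure_def form3_def by blast
      then obtain V F where F: "open V" "cimg k \<subseteq> V" "\<forall>x\<in>cimg k. F x = \<phi>\<^sub>0 k x" "\<And>n. Ck_on n V F"
        unfolding smooth_on_def by blast
      (* The formula for the solution makes sense for all t below \<tau>, negative ones included,
         and so extends it smoothly to an open set. *)
      let ?I = "{t. (20 * c\<^sup>2) * t < 1}"
      have I: "open ?I" by (intro open_Collect_less continuous_intros)
      have op: "open (?I \<times> V)" using I F by (intro open_Times)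
      have "Ck_on n ?I r" for n
        by (rule Ck_on_cong[OF I _ Ck_on_powr[of n "20 * c\<^sup>2" "1/2"]]) (simp add: r_def powr_half_sqrt)
      then have "Ck_on n ?I (\<lambda>t. r t * (r t * r t))" for n
        by (intro Ck_on_bounded_bilinear[OF I bounded_bilinear_mult])
      then have R: "Ck_on n (?I \<times> V) (\<lambda>p. r (fst p) * (r (fst p) * r (fst p)))" for n
        by (rule Ck_on_compose_linear[OF bounded_linear_fst _ op]) auto
      have S: "Ck_on n (?I \<times> V) (\<lambda>p. F (snd p))" for n
        by (rule Ck_on_compose_linear[OF bounded_linear_snd F(4) op]) auto
      have "Ck_on n (?I \<times> V) (\<lambda>p. (r (fst p) * (r (fst p) * r (fst p))) *\<^sub>R F (snd p))" for n
        by (intro Ck_on_bounded_bilinear[OF op bounded_bilinear_scaleR] R S)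
      then show ?thesis
        unfolding smooth_on_def using op F(2,3)
        by (intro exI[of _ "?I \<times> V"] exI[of _ "\<lambda>p. (r (fst p) * (r (fst p) * r (fst p))) *\<^sub>R F (snd p)"])
          (auto simp: lt \<phi>_def power3_eq_cube mult.assoc)
    qed
    fix t assume "t \<in> {0..<\<tau>}"
    then have t: "0 \<le> t" "t < \<tau>" by auto
    note r = rpos[OF t(2)]
    then have r2: "(r t)\<^sup>2 \<noteq> 0" by simp
    show "is_torsion A (\<phi> t) (T t)"
      unfolding is_torsion_def
    proof (intro conjI ballI allI)
      have "tensor2 A (\<lambda>k x. c *\<^sub>R metric_of \<phi>\<^sub>0 k x)"
        using assms(4) unfolding is_torsion_def by blast
      then have "tensor2 A (\<lambda>k x. r t *\<^sub>R (c *\<^sub>R metric_of \<phi>\<^sub>0 k x))"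
        by (rule tensor2_scaleR)
      then show "tensor2 A (T t)" by (simp add: T_def[abs_def])
      fix k x m i j l assume k: "k \<in> A" and x: "x \<in> cimg k"
      interpret G2_chart "cimg k" "metric_of \<phi>\<^sub>0 k" "\<phi>\<^sub>0 k" c by (rule chart[OF k])
      have N: "nabla3 (metric_of (\<phi> t) k) (\<phi> t k) x = r t ^ 3 *\<^sub>R nabla3 (metric_of \<phi>\<^sub>0 k) (\<phi>\<^sub>0 k) x"
        unfolding \<phi>_abs[of t k] by (rule nabla3_multiple[OF x r2]) (simp only: met[OF t(2) k] flip: \<phi>_abs)
      have "(\<Sum>p\<in>UNIV. \<Sum>q\<in>UNIV. T t k x $ m $ p * matrix_inv (metric_of (\<phi> t) k x) $ p $ q * psi (\<phi> t k x) $ q $ i $ j $ l)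
        = (r t * c / (r t)\<^sup>2 * r t ^ 4) * (\<Sum>p\<in>UNIV. \<Sum>q\<in>UNIV. metric_of \<phi>\<^sub>0 k x $ m $ p * matrix_inv (metric_of \<phi>\<^sub>0 k x) $ p $ q * psi (\<phi>\<^sub>0 k x) $ q $ i $ j $ l)"
        unfolding T_def met[OF t(2) k x] psi[OF t(2) k x] matrix_inv_scaleR[OF g_det[OF x] r2]
        by (simp add: sum_distrib_left mult_ac)
      also have "(\<Sum>p\<in>UNIV. \<Sum>q\<in>UNIV. metric_of \<phi>\<^sub>0 k x $ m $ p * matrix_inv (metric_of \<phi>\<^sub>0 k x) $ p $ q * psi (\<phi>\<^sub>0 k x) $ q $ i $ j $ l)
          = psi (\<phi>\<^sub>0 k x) $ m $ i $ j $ l"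
        by (rule contract_torsion[OF g_det[OF x] g_sym[OF x]])
      also have "(r t * c / (r t)\<^sup>2 * r t ^ 4) * \<dots> = r t ^ 3 * (c * psi (\<phi>\<^sub>0 k x) $ m $ i $ j $ l)"
        using r by (simp add: power_eq_if field_simps)
      finally show "nabla3 (metric_of (\<phi> t) k) (\<phi> t k) x $ m $ i $ j $ l
        = (\<Sum>p\<in>UNIV. \<Sum>q\<in>UNIV. T t k x $ m $ p * matrix_inv (metric_of (\<phi> t) k x) $ p $ q * psi (\<phi> t k x) $ q $ i $ j $ l)"
        by (simp add: N torsion[OF x])
    qed
    fix k x assume k: "k \<in> A" and x: "x \<in> cimg k"
    interpret G2_chart "cimg k" "metric_of \<phi>\<^sub>0 k" "\<phi>\<^sub>0 k" c by (rule chart[OF k])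
    let ?g = "metric_of \<phi>\<^sub>0 k"
    have "flow_rhs (\<phi> t k) (T t k) x = (- 30 * c\<^sup>2 * r t) *\<^sub>R \<phi>\<^sub>0 k x"
    proof -
      have gt: "(\<lambda>y. metric (\<phi> t k y)) = metric_of (\<phi> t) k" by (simp add: metric_of_def fun_eq_iff)
      have 1: "ricci (metric_of (\<phi> t) k) x = (6 * c\<^sup>2) *\<^sub>R ?g x"
        using ricci_scaleR[OF x r2 met[OF t(2) k]] ricci_eq[OF x] by simp
      have 2: "TtT (metric_of (\<phi> t) k x) (T t k x) = c\<^sup>2 *\<^sub>R ?g x"
        unfolding T_def met[OF t(2) k x] TtT_scaleR[OF g_det[OF x] r2] TtT_metric[OF g_det[OF x] g_sym[OF x]]
        using r by (simp add: power_mult_distrib)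
      have 3: "normsq2 (metric_of (\<phi> t) k x) (T t k x) *\<^sub>R metric_of (\<phi> t) k x = (7 * c\<^sup>2) *\<^sub>R ?g x"
        unfolding T_def met[OF t(2) k x] normsq2_scaleR[OF g_det[OF x] r2] normsq2_metric[OF g_det[OF x] g_sym[OF x]]
        using r by (simp add: power_mult_distrib power2_eq_square)
      have "nabla2 (metric_of (\<phi> t) k) (T t k) x = 0"
        unfolding T_abs by (rule nabla2_multiple[OF x r2 met[OF t(2) k]])
      then have 4: "divergence (metric_of (\<phi> t) k) (T t k) x = 0"
        by (simp add: divergence_def vec_eq_iff)
      have 5: "interior4 h 0 \<beta> = 0" for h \<beta> by (simp add: interior4_def vec_eq_iff)
      have 6: "- ((6 * c\<^sup>2) *\<^sub>R ?g x) + 3 *\<^sub>R (c\<^sup>2 *\<^sub>R ?g x) - (7 * c\<^sup>2) *\<^sub>R ?g x = (- 10 * c\<^sup>2) *\<^sub>R ?g x"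
        by (simp add: vec_eq_iff)
      have "flow_rhs (\<phi> t k) (T t k) x = diamond ((r t)\<^sup>2 *\<^sub>R ?g x) ((- 10 * c\<^sup>2) *\<^sub>R ?g x) (r t ^ 3 *\<^sub>R \<phi>\<^sub>0 k x)"
        unfolding flow_rhs_def Let_def gt fun_cong[OF gt] 1 2 3 4 5 6 by (simp add: met[OF t(2) k x] \<phi>_def)
      also have "\<dots> = (- 30 * c\<^sup>2 * r t) *\<^sub>R \<phi>\<^sub>0 k x"
        unfolding diamond_scaleR[OF g_det[OF x] r2] diamond_metric[OF g_det[OF x] g_sym[OF x]]
        using r by (simp add: power3_eq_cube power2_eq_square)
      finally show ?thesis .
    qed
    moreover have "((\<lambda>s. \<phi> s k x) has_vector_derivative (- 30 * c\<^sup>2 * r t) *\<^sub>R \<phi>\<^sub>0 k x) (at t within {0..<\<tau>})"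
    proof -
      have "(r has_real_derivative - (10 * c\<^sup>2) / r t) (at t within {0..<\<tau>})"
        unfolding r_def using lt[of t] t by (auto intro!: derivative_eq_intros simp: field_simps)
      then have "((\<lambda>s. r s ^ 3) has_real_derivative 3 * (r t)\<^sup>2 * (- (10 * c\<^sup>2) / r t)) (at t within {0..<\<tau>})"
        by (auto intro!: derivative_eq_intros)
      moreover have "3 * (r t)\<^sup>2 * (- (10 * c\<^sup>2) / r t) = - 30 * c\<^sup>2 * r t"
        using r by (simp add: power2_eq_square)
      ultimately have "((\<lambda>s. r s ^ 3) has_real_derivative - 30 * c\<^sup>2 * r t) (at t within {0..<\<tau>})"
        by (simp only:)
      then show ?thesis
        unfolding \<phi>_def by (rule has_vector_derivative_scaleR[OF _ has_vector_derivative_const, THEN has_vector_derivative_eq_rhs]) simp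
    qed
    ultimately show "((\<lambda>s. \<phi> s k x) has_vector_derivative flow_rhs (\<phi> t k) (T t k) x) (at t within {0..<\<tau>})"
      by simp
  qed

  have nearly: "nearly_G2 A (\<phi> t)" if t: "t \<in> {0..<\<tau>}" for t
  proof -
    have t': "t < \<tau>" using t by simp
    note r = rpos[OF t']
    obtain \<kappa> where \<kappa>: "\<And>k x. k \<in> A \<Longrightarrow> x \<in> cimg k \<Longrightarrow>
        ext_deriv3 (\<phi>\<^sub>0 k) x = \<kappa> *\<^sub>R psi (\<phi>\<^sub>0 k x) \<and> ext_deriv4 (\<lambda>y. psi (\<phi>\<^sub>0 k y)) x = 0"
      using assms(3) unfolding nearly_G2_def by blast
    have "ext_deriv3 (\<phi> t k) x = (\<kappa> / r t) *\<^sub>R psi (\<phi> t k x) \<and> ext_deriv4 (\<lambda>y. psi (\<phi> t k y)) x = 0"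
      if k: "k \<in> A" and x: "x \<in> cimg k" for k x
    proof
      interpret G2_chart "cimg k" "metric_of \<phi>\<^sub>0 k" "\<phi>\<^sub>0 k" c by (rule chart[OF k])
      have "ext_deriv3 (\<phi> t k) x = r t ^ 3 *\<^sub>R ext_deriv3 (\<phi>\<^sub>0 k) x"
        unfolding \<phi>_abs by (rule ext_deriv3_scaleR[OF diff(2)[OF x]])
      then show "ext_deriv3 (\<phi> t k) x = (\<kappa> / r t) *\<^sub>R psi (\<phi> t k x)"
        using r \<kappa>[OF k x] by (simp add: psi[OF t' k x] power_eq_if field_simps)
      have "ext_deriv4 (\<lambda>y. psi (\<phi> t k y)) x = r t ^ 4 *\<^sub>R ext_deriv4 (\<lambda>y. psi (\<phi>\<^sub>0 k y)) x"
        by (rule ext_deriv4_scaleR[OF open_U x psi_diff[OF x assms(5)] psi[OF t' k]])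
      then show "ext_deriv4 (\<lambda>y. psi (\<phi> t k y)) x = 0"
        using \<kappa>[OF k x] by simp
    qed
    then show ?thesis
      unfolding nearly_G2_def using G[OF t'] by blast
  qed

  have shrink: "shrinking A \<tau> \<phi>"
    unfolding shrinking_def
  proof (intro exI[of _ "\<lambda>t. r t ^ 3"] exI[of _ "\<lambda>t. id"] conjI ballI)
    show "r 0 ^ 3 = 1" by (simp add: r0)
    show "0 < r t ^ 3" if "t \<in> {0..<\<tau>}" for t using rpos that by simp
    show "strict_antimono_on {0..<\<tau>} (\<lambda>t. r t ^ 3)"
    proof (rule monotone_onI)
      fix s t assume st: "s \<in> {0..<\<tau>}" "t \<in> {0..<\<tau>}" "s < t"
      have "r t < r s" using b st(3) by (simp add: r_def)
      then show "r t ^ 3 < r s ^ 3" using rpos[of t] st by (intro power_strict_mono) auto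
    qed
    show "diffeo A id" for t by (rule diffeo_id[OF assms(2)])
    have "is_pullback pull3 A id \<phi>\<^sub>0 \<phi>\<^sub>0"
      using G0 unfolding G2_structure_def form3_def by blast
    moreover have "\<phi> 0 = \<phi>\<^sub>0" by (simp add: \<phi>_def fun_eq_iff r0)
    ultimately have "is_pullback pull3 A id (\<phi> 0) \<phi>\<^sub>0" by simp
    then show "\<exists>\<eta>. is_pullback pull3 A id (\<phi> 0) \<eta> \<and> field_eq A (\<phi> t) (\<lambda>k x. r t ^ 3 *\<^sub>R \<eta> k x)" for t
      by (intro exI[of _ \<phi>\<^sub>0]) (simp add: field_eq_def \<phi>_def)
  qed

  (* A longer solution would be continuous at \<tau>, hence equal to r(\<tau>)^3 \<phi>\<^sub>0 = 0 there. *)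
  have maximal: "\<not> (\<exists>\<phi>'. flow_solution A \<tau>' \<phi>' \<and> (\<forall>t\<in>{0..<\<tau>}. field_eq A (\<phi>' t) (\<phi> t)))" if \<tau>': "\<tau>' > \<tau>" for \<tau>'
  proof
    assume "\<exists>\<phi>'. flow_solution A \<tau>' \<phi>' \<and> (\<forall>t\<in>{0..<\<tau>}. field_eq A (\<phi>' t) (\<phi> t))"
    then obtain \<phi>' where \<phi>': "flow_solution A \<tau>' \<phi>'" "\<And>t. t \<in> {0..<\<tau>} \<Longrightarrow> field_eq A (\<phi>' t) (\<phi> t)" by blast
    obtain k p where k: "k \<in> A" "p \<in> cdom k"
      using assms(2) unfolding smooth_atlas_def by blast
    define x where "x = cmap k p"
    have x: "x \<in> cimg k" using k by (simp add: x_def cimg_def)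
    have mem: "\<tau> \<in> {0..<\<tau>'}" using \<tau> \<tau>' by simp
    obtain D where "((\<lambda>s. \<phi>' s k x) has_vector_derivative D) (at \<tau> within {0..<\<tau>'})"
      using \<phi>'(1) mem k(1) x unfolding flow_solution_def by blast
    then have cont: "continuous (at \<tau> within {0..<\<tau>'}) (\<lambda>s. \<phi>' s k x)"
      by (rule has_vector_derivative_continuous)
    define s where "s n = \<tau> * (real n / real (Suc n))" for n
    have frac: "real n / real (Suc n) < 1" "0 \<le> real n / real (Suc n)" for n by simp_all
    have s: "s n \<in> {0..<\<tau>}" for n
      using \<tau> mult_strict_left_mono[OF frac(1) \<tau>, of n] frac(2)[of n] unfolding s_def by simp
    have lim: "s \<longlonglongrightarrow> \<tau>"
      unfolding s_def using tendsto_mult[OF tendsto_const[of \<tau>] LIMSEQ_n_over_Suc_n] by simp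
    have "(\<lambda>n. \<phi>' (s n) k x) \<longlonglongrightarrow> \<phi>' \<tau> k x"
      by (rule continuous_within_tendsto_compose'[OF cont _ lim]) (use s \<tau>' in \<open>auto intro: less_trans\<close>)
    moreover have "(\<lambda>n. \<phi>' (s n) k x) = (\<lambda>n. r (s n) ^ 3 *\<^sub>R \<phi>\<^sub>0 k x)"
      using \<phi>'(2)[OF s] k(1) x by (simp add: field_eq_def \<phi>_def)
    moreover have "(\<lambda>n. r (s n) ^ 3 *\<^sub>R \<phi>\<^sub>0 k x) \<longlonglongrightarrow> r \<tau> ^ 3 *\<^sub>R \<phi>\<^sub>0 k x"
      unfolding r_def by (intro tendsto_intros lim)
    ultimately have "\<phi>' \<tau> k x = r \<tau> ^ 3 *\<^sub>R \<phi>\<^sub>0 k x"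
      using LIMSEQ_unique by metis
    then have "\<phi>' \<tau> k x = 0" by (simp add: rtau)
    moreover have "nondegenerate (\<phi>' \<tau> k x)"
      using \<phi>'(1) mem k(1) x unfolding flow_solution_def G2_structure_def by blast
    ultimately show False by (simp add: nondegenerate_def metric_vol_of_zero)
  qed

  have "field_eq A (\<phi> 0) \<phi>\<^sub>0" by (simp add: field_eq_def \<phi>_def r0)
  then show ?thesis
    using flow nearly shrink maximal by blast
qed

end
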